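(* Let $\mathbb{F}$ be a locally compact topological field and $\mathbb{K}$ a topological field extending $\mathbb{F}$. Let $E$, $F$ and $\widetilde Z$ be topological $\mathbb{K}$-vector spaces, $U\subseteq E$ an open subset, $r,k\in\mathbb{N}_0\cup\{\infty\}$, $\widetilde M$ a $C^{r+k}_{\mathbb{K}}$-manifold modeled on $\widetilde Z$, and $\tilde f\colon\widetilde M\times U\to F$ a map of class $C^{r+k}_{\mathbb{K}}$. Let $M$ be a finite-dimensional $C^r_{\mathbb{F}}$-manifold and $K\subseteq M$ a compact subset. Given a map $\sigma\colon M\to\widetilde M$ of class $C^r_{\mathbb{F}}$, define $f:=\tilde f\circ(\sigma\times\mathrm{id}_U)\colon M\times U\to F$. If $K\neq M$, assume that $0\in U$ and $f(x,0)=0$ for all $x\in M\setminus K$. Then $C^r_K(M,U):=\{\gamma\in C^r_K(M,E):\gamma(M)\subseteq U\}$ is an open subset of $C^r_K(M,E)$, and $$f_*\colon C^r_K(M,U)\to C^r_K(M,F),\qquad f_*(\gamma)(x):=f(x,\gamma(x))$$ is a map of class $C^k_{\mathbb{K}}$.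
   Context: All topological spaces, topological fields and topological vector spaces are Hausdorff; topological fields are non-discrete. "$\mathbb{K}$ extends $\mathbb{F}$" means that $\mathbb{F}$ is a subfield of $\mathbb{K}$ and the inclusion $\mathbb{F}\to\mathbb{K}$ is continuous. Differential calculus over a topological field $\mathbb{K}$: For a topological $\mathbb{K}$-vector space $E$ and $U\subseteq E$ open, put $U^{[0]}:=U$, $U^{[1]}:=\{(x,y,t)\in U\times E\times\mathbb{K}: x+ty\in U\}$ and $U^{[j+1]}:=(U^{[j]})^{[1]}$. A map $f\colon U\to F$ into a topological $\mathbb{K}$-vector space is $C^0_{\mathbb{K}}$ if it is continuous ($f^{[0]}:=f$); it is $C^1_{\mathbb{K}}$ if it is continuous and there is a (necessarily unique) continuous map $f^{[1]}\colon U^{[1]}\to F$ with $f^{[1]}(x,y,t)=\frac1t(f(x+ty)-f(x))$ for all $(x,y,t)\in U^{[1]}$ with $t\neq0$; for $k\ge2$ it is $C^k_{\mathbb{K}}$ if it is $C^{k-1}_{\mathbb{K}}$ and $f^{[k-1]}$ is $C^1_{\mathbb{K}}$, and then $f^{[k]}:=(f^{[k-1]})^{[1]}$; it is $C^\infty_{\mathbb{K}}$ if it is $C^k_{\mathbb{K}}$ for all $k$. $C^k_{\mathbb{K}}$-manifolds modeled on topological $\mathbb{K}$-vector spaces and $C^k_{\mathbb{K}}$-maps between them are defined as usual via charts. $\mathbb{K}$-vector spaces and $\mathbb{K}$-manifolds are also regarded as objects over $\mathbb{F}$ by restriction of scalars. Finite-dimensional vector spaces carry the topology making them isomorphic to $\mathbb{F}^d$.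 Function spaces: Let $E$ be a topological $\mathbb{K}$-vector space. For $V$ open in a topological $\mathbb{F}$-vector space, $C^r(V,E)$ is the $\mathbb{K}$-vector space of $C^r_{\mathbb{F}}$-maps $V\to E$ with the initial topology with respect to the maps $\gamma\mapsto\gamma^{[j]}\in C(V^{[j]},E)$, $j\in\mathbb{N}_0$, $j\le r$, where $C(V^{[j]},E)$ carries the compact-open topology. For a $C^r_{\mathbb{F}}$-manifold $M$, $C^r(M,E)$ is the space of $C^r_{\mathbb{F}}$-maps $M\to E$ with the initial topology with respect to the maps $\gamma\mapsto\gamma|_U\circ\kappa^{-1}\in C^r(V,E)$, for $\kappa\colon U\to V$ ranging through the charts of $M$. For compact $K\subseteq M$, $C^r_K(M,E):=\{\gamma\in C^r(M,E):\operatorname{supp}(\gamma)\subseteq K\}$ carries the induced topology. *)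

theory Defs
  imports
    "HOL-Analysis.Analysis"
    "HOL-Library.Function_Algebras"
    "HOL-Library.Extended_Nat"
begin

section \<open>Topological fields and topological vector spaces\<close>

text \<open>
  A topological field is a topology on a subfield (its topspace) of an ambient field. In this way
  two fields with \<open>F \<subseteq> K\<close> and possibly different topologies live on the same type, and restriction
  of scalars leaves a vector space unchanged.
\<close>

locale topological_field =
  fixes T :: "'k::field topology"
  assumes Hausdorff: "Hausdorff_space T"
    and non_discrete: "T \<noteq> discrete_topology (topspace T)"
    and zero_closed: "0 \<in> topspace T"
    and one_closed: "1 \<in> topspace T"
    and continuous_add: "continuous_map (prod_topology T T) T (\<lambda>(a, b). a + b)"
    and continuous_uminus: "continuous_map T T uminus"
    and continuous_mult: "continuous_map (prod_topology T T) T (\<lambda>(a, b). a * b)"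
    and continuous_inverse: "continuous_map (subtopology T (topspace T - {0})) T inverse"

definition extends :: "'k::field topology \<Rightarrow> 'k topology \<Rightarrow> bool" where
  "extends TK TF \<longleftrightarrow> topological_field TK \<and> topological_field TF \<and>
     topspace TF \<subseteq> topspace TK \<and> continuous_map TF TK (\<lambda>a. a)"

text \<open>
  The carrier of a topological vector space is the topspace of its topology, a subgroup of the
  ambient abelian group. The values of the scalar multiplication outside the carriers are
  irrelevant.
\<close>

record ('k, 'e) tvs =
  scal :: "'k \<Rightarrow> 'e \<Rightarrow> 'e"
  topo :: "'e topology"

locale topological_vector_space = topological_field S
  for S :: "'k::field topology" +
  fixes E :: "('k, 'e::ab_group_add) tvs"
  assumes Hausdorff_space: "Hausdorff_space (topo E)"
    and zero_mem: "0 \<in> topspace (topo E)"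
    and continuous_plus:
      "continuous_map (prod_topology (topo E) (topo E)) (topo E) (\<lambda>(x, y). x + y)"
    and continuous_scal: "continuous_map (prod_topology S (topo E)) (topo E) (\<lambda>(a, x). scal E a x)"
    and scal_add_right: "\<lbrakk>a \<in> topspace S; x \<in> topspace (topo E); y \<in> topspace (topo E)\<rbrakk>
      \<Longrightarrow> scal E a (x + y) = scal E a x + scal E a y"
    and scal_add_left: "\<lbrakk>a \<in> topspace S; b \<in> topspace S; x \<in> topspace (topo E)\<rbrakk>
      \<Longrightarrow> scal E (a + b) x = scal E a x + scal E b x"
    and scal_scal: "\<lbrakk>a \<in> topspace S; b \<in> topspace S; x \<in> topspace (topo E)\<rbrakk>
      \<Longrightarrow> scal E a (scal E b x) = scal E (a * b) x"
    and scal_one: "x \<in> topspace (topo E) \<Longrightarrow> scal E 1 x = x"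

definition prod_tvs ::
    "('k, 'e) tvs \<Rightarrow> ('k, 'f) tvs \<Rightarrow> ('k, 'e \<times> 'f) tvs" where
  "prod_tvs E F = \<lparr>scal = (\<lambda>a (x, y). (scal E a x, scal F a y)),
                   topo = prod_topology (topo E) (topo F)\<rparr>"

text \<open>
  The isomorphism with the \<open>d\<close>-th power of the field is given by a basis \<open>b 0, \<dots>, b (d - 1)\<close>.
\<close>

definition finite_dimensional_tvs ::
    "'k::field topology \<Rightarrow> ('k, 'z::ab_group_add) tvs \<Rightarrow> bool" where
  "finite_dimensional_tvs S Z \<longleftrightarrow> topological_vector_space S Z \<and>
     (\<exists>(d::nat) b. homeomorphic_map (product_topology (\<lambda>_. S) {..<d}) (topo Z)
                     (\<lambda>c. \<Sum>i<d. scal Z (c i) (b i)))"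


section \<open>Differential calculus over a topological field\<close>

text \<open>
  The vector spaces \<open>E\<close>, \<open>E \<times> E \<times> S\<close>, \<open>(E \<times> E \<times> S) \<times> (E \<times> E \<times> S) \<times> S\<close>, \<dots> containing
  \<open>U\<^sup>[\<^sup>0\<^sup>]\<close>, \<open>U\<^sup>[\<^sup>1\<^sup>]\<close>, \<open>U\<^sup>[\<^sup>2\<^sup>]\<close>, \<dots> are all realised inside one type, where \<open>Tr x y t\<close> plays the
  role of the triple \<open>(x, y, t)\<close>.
\<close>

datatype ('e, 'k) tower =
    is_Pt: Pt (pt: 'e)
  | Tr (base: "('e, 'k) tower") (dir: "('e, 'k) tower") (par: 'k)

primrec tower_topology ::
    "'k topology \<Rightarrow> 'e topology \<Rightarrow> nat \<Rightarrow> ('e, 'k) tower topology" where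
  "tower_topology S T 0 = pullback_topology {z. is_Pt z} pt T"
| "tower_topology S T (Suc j) =
     pullback_topology {z. \<not> is_Pt z} (\<lambda>z. (base z, dir z, par z))
       (prod_topology (tower_topology S T j) (prod_topology (tower_topology S T j) S))"

text \<open>
  \<open>tower_line E x y t\<close> is \<open>x + t y\<close>; it is only used for \<open>x\<close> and \<open>y\<close> at the same level of the tower.
\<close>

fun tower_line ::
    "('k::field, 'e::ab_group_add) tvs \<Rightarrow> ('e, 'k) tower \<Rightarrow> ('e, 'k) tower \<Rightarrow> 'k \<Rightarrow> ('e, 'k) tower"
where
  "tower_line E (Pt x) (Pt y) t = Pt (x + scal E t y)"
| "tower_line E (Tr x x' a) (Tr y y' b) t =
     Tr (tower_line E x y t) (tower_line E x' y' t) (a + t * b)"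

text \<open>The set \<open>U\<^sup>[\<^sup>j\<^sup>]\<close>.\<close>

primrec tower_dom ::
    "'k::field topology \<Rightarrow> ('k, 'e::ab_group_add) tvs \<Rightarrow> 'e set \<Rightarrow> nat \<Rightarrow> ('e, 'k) tower set" where
  "tower_dom S E U 0 = Pt ` U"
| "tower_dom S E U (Suc j) =
     {Tr x y t | x y t. x \<in> tower_dom S E U j \<and> y \<in> topspace (tower_topology S (topo E) j) \<and>
                        t \<in> topspace S \<and> tower_line E x y t \<in> tower_dom S E U j}"

abbreviation tower_dom_topology ::
    "'k::field topology \<Rightarrow> ('k, 'e::ab_group_add) tvs \<Rightarrow> 'e set \<Rightarrow> nat \<Rightarrow> ('e, 'k) tower topology" where
  "tower_dom_topology S E U j \<equiv> subtopology (tower_topology S (topo E) j) (tower_dom S E U j)"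

text \<open>
  Convention used throughout: a map from a set \<open>A\<close> to a vector space is turned into a unique
  HOL function by requiring the value \<open>0\<close> off \<open>A\<close>. Pointwise operations on functions
  are then the vector space operations on spaces of maps on \<open>A\<close>.
\<close>

definition zero_off :: "'a set \<Rightarrow> ('a \<Rightarrow> 'b::zero) \<Rightarrow> bool" where
  "zero_off A f \<longleftrightarrow> (\<forall>x. x \<notin> A \<longrightarrow> f x = 0)"

text \<open>
  For \<open>g : U\<^sup>[\<^sup>j\<^sup>] \<rightarrow> F\<close>, the following says that \<open>h : U\<^sup>[\<^sup>j\<^sup>+\<^sup>1\<^sup>] \<rightarrow> F\<close> is \<open>g\<^sup>[\<^sup>1\<^sup>]\<close>.
\<close>

definition is_difference_quotient ::
    "'k::field topology \<Rightarrow> ('k, 'e::ab_group_add) tvs \<Rightarrow> 'e set \<Rightarrow> ('k, 'f::ab_group_add) tvs \<Rightarrow> nat \<Rightarrow>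
     (('e, 'k) tower \<Rightarrow> 'f) \<Rightarrow> (('e, 'k) tower \<Rightarrow> 'f) \<Rightarrow> bool" where
  "is_difference_quotient S E U F j g h \<longleftrightarrow>
     continuous_map (tower_dom_topology S E U (Suc j)) (topo F) h \<and>
     zero_off (tower_dom S E U (Suc j)) h \<and>
     (\<forall>x y t. Tr x y t \<in> tower_dom S E U (Suc j) \<and> t \<noteq> 0 \<longrightarrow>
        h (Tr x y t) = scal F (inverse t) (g (tower_line E x y t) - g x))"

text \<open>
  The map \<open>f\<^sup>[\<^sup>j\<^sup>]\<close>. It is meaningful if \<open>U\<close> is open and \<open>f\<close> is of class \<open>C\<^sup>j\<close>; the description is then
  unique since the ground field is not discrete and \<open>F\<close> is Hausdorff.
\<close>

primrec iter_quotient ::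
    "'k::field topology \<Rightarrow> ('k, 'e::ab_group_add) tvs \<Rightarrow> 'e set \<Rightarrow> ('k, 'f::ab_group_add) tvs \<Rightarrow>
     ('e \<Rightarrow> 'f) \<Rightarrow> nat \<Rightarrow> ('e, 'k) tower \<Rightarrow> 'f" where
  "iter_quotient S E U F f 0 = (\<lambda>z. if z \<in> tower_dom S E U 0 then f (pt z) else 0)"
| "iter_quotient S E U F f (Suc j) =
     (THE h. is_difference_quotient S E U F j (iter_quotient S E U F f j) h)"

primrec Ck_nat ::
    "'k::field topology \<Rightarrow> ('k, 'e::ab_group_add) tvs \<Rightarrow> 'e set \<Rightarrow> ('k, 'f::ab_group_add) tvs \<Rightarrow>
     nat \<Rightarrow> ('e \<Rightarrow> 'f) \<Rightarrow> bool" where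
  "Ck_nat S E U F 0 f \<longleftrightarrow> continuous_map (subtopology (topo E) U) (topo F) f"
| "Ck_nat S E U F (Suc j) f \<longleftrightarrow> Ck_nat S E U F j f \<and>
     (\<exists>h. is_difference_quotient S E U F j (iter_quotient S E U F f j) h)"

definition Ck ::
    "'k::field topology \<Rightarrow> ('k, 'e::ab_group_add) tvs \<Rightarrow> 'e set \<Rightarrow> ('k, 'f::ab_group_add) tvs \<Rightarrow>
     enat \<Rightarrow> ('e \<Rightarrow> 'f) \<Rightarrow> bool" where
  "Ck S E U F k f \<longleftrightarrow> (\<forall>j. enat j \<le> k \<longrightarrow> Ck_nat S E U F j f)"


section \<open>Manifolds\<close>

type_synonym ('m, 'z) chart = "'m set \<times> ('m \<Rightarrow> 'z)"

record ('m, 'z) mfd =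
  mtop :: "'m topology"
  atlas :: "('m, 'z) chart set"

definition is_chart :: "'m topology \<Rightarrow> 'z topology \<Rightarrow> ('m, 'z) chart \<Rightarrow> bool" where
  "is_chart T TZ = (\<lambda>(U, \<kappa>). openin T U \<and> openin TZ (\<kappa> ` U) \<and>
     homeomorphic_map (subtopology T U) (subtopology TZ (\<kappa> ` U)) \<kappa>)"

definition compatible ::
    "'k::field topology \<Rightarrow> enat \<Rightarrow> ('k, 'z::ab_group_add) tvs \<Rightarrow> ('m, 'z) chart \<Rightarrow> ('m, 'z) chart \<Rightarrow> bool"
where
  "compatible S r Z = (\<lambda>(U, \<kappa>) (V, \<phi>).
     Ck S Z (\<kappa> ` (U \<inter> V)) Z r (\<phi> \<circ> inv_into U \<kappa>) \<and>
     Ck S Z (\<phi> ` (U \<inter> V)) Z r (\<kappa> \<circ> inv_into V \<phi>))"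

definition maximal_atlas ::
    "'k::field topology \<Rightarrow> enat \<Rightarrow> ('k, 'z::ab_group_add) tvs \<Rightarrow> 'm topology \<Rightarrow>
     ('m, 'z) chart set \<Rightarrow> ('m, 'z) chart set" where
  "maximal_atlas S r Z T A = {c. is_chart T (topo Z) c \<and> (\<forall>c'\<in>A. compatible S r Z c c')}"

text \<open>
  The equation \<open>maximal\<close> says both that all members of the atlas are pairwise compatible charts and
  that the atlas is maximal, so \<open>atlas M\<close> consists of all charts of \<open>M\<close>.
\<close>

locale manifold = topological_vector_space S Z
  for S :: "'k::field topology" and Z :: "('k, 'z::ab_group_add) tvs" +
  fixes r :: enat and M :: "('m, 'z) mfd"
  assumes Hausdorff_mtop: "Hausdorff_space (mtop M)"
    and covering: "(\<Union>(U, \<kappa>)\<in>atlas M. U) = topspace (mtop M)"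
    and maximal: "atlas M = maximal_atlas S r Z (mtop M) (atlas M)"

definition open_mfd ::
    "'k::field topology \<Rightarrow> enat \<Rightarrow> ('k, 'e::ab_group_add) tvs \<Rightarrow> 'e set \<Rightarrow> ('e, 'e) mfd" where
  "open_mfd S r E U =
     \<lparr>mtop = subtopology (topo E) U,
      atlas = maximal_atlas S r E (subtopology (topo E) U) {(U, \<lambda>x. x)}\<rparr>"

definition prod_mfd ::
    "'k::field topology \<Rightarrow> enat \<Rightarrow> ('k, 'z::ab_group_add) tvs \<Rightarrow> ('m, 'z) mfd \<Rightarrow>
     ('k, 'y::ab_group_add) tvs \<Rightarrow> ('n, 'y) mfd \<Rightarrow> ('m \<times> 'n, 'z \<times> 'y) mfd" where
  "prod_mfd S r Z M Y N =
     \<lparr>mtop = prod_topology (mtop M) (mtop N),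
      atlas = maximal_atlas S r (prod_tvs Z Y) (prod_topology (mtop M) (mtop N))
        {(U \<times> V, map_prod \<kappa> \<phi>) | U \<kappa> V \<phi>. (U, \<kappa>) \<in> atlas M \<and> (V, \<phi>) \<in> atlas N}\<rparr>"

definition Ck_mfd_to_tvs ::
    "'k::field topology \<Rightarrow> ('k, 'z::ab_group_add) tvs \<Rightarrow> ('m, 'z) mfd \<Rightarrow>
     ('k, 'e::ab_group_add) tvs \<Rightarrow> enat \<Rightarrow> ('m \<Rightarrow> 'e) \<Rightarrow> bool" where
  "Ck_mfd_to_tvs S Z M E r f \<longleftrightarrow> continuous_map (mtop M) (topo E) f \<and>
     (\<forall>(U, \<kappa>)\<in>atlas M. Ck S Z (\<kappa> ` U) E r (f \<circ> inv_into U \<kappa>))"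

definition Ck_mfd_to_mfd ::
    "'k::field topology \<Rightarrow> ('k, 'z::ab_group_add) tvs \<Rightarrow> ('m, 'z) mfd \<Rightarrow>
     ('k, 'y::ab_group_add) tvs \<Rightarrow> ('n, 'y) mfd \<Rightarrow> enat \<Rightarrow> ('m \<Rightarrow> 'n) \<Rightarrow> bool" where
  "Ck_mfd_to_mfd S Z M Y N r f \<longleftrightarrow> continuous_map (mtop M) (mtop N) f \<and>
     (\<forall>(U, \<kappa>)\<in>atlas M. \<forall>(V, \<phi>)\<in>atlas N.
        Ck S Z (\<kappa> ` (U \<inter> f -` V)) Y r (\<phi> \<circ> f \<circ> inv_into U \<kappa>))"


section \<open>Function spaces\<close>

definition initial_topology ::
    "'a set \<Rightarrow> 'i set \<Rightarrow> ('i \<Rightarrow> 'a \<Rightarrow> 'b) \<Rightarrow> ('i \<Rightarrow> 'b topology) \<Rightarrow> 'a topology" where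
  "initial_topology X I f T = topology_generated_by
     (insert X {{x \<in> X. f i x \<in> W} | i W. i \<in> I \<and> openin (T i) W})"

definition compact_open_topology :: "'a topology \<Rightarrow> 'b::zero topology \<Rightarrow> ('a \<Rightarrow> 'b) topology" where
  "compact_open_topology X Y = topology_generated_by
     {{f. continuous_map X Y f \<and> zero_off (topspace X) f \<and> f ` C \<subseteq> W} | C W.
        compactin X C \<and> openin Y W}"

text \<open>The space \<open>C\<^sup>r(V, E)\<close>, with \<open>V\<close> open in the vector space \<open>Z\<close> over \<open>S\<close>.\<close>

definition Cr_topology ::
    "'k::field topology \<Rightarrow> ('k, 'z::ab_group_add) tvs \<Rightarrow> 'z set \<Rightarrow> ('k, 'e::ab_group_add) tvs \<Rightarrow>
     enat \<Rightarrow> ('z \<Rightarrow> 'e) topology" where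
  "Cr_topology S Z V E r =
     initial_topology {\<gamma>. Ck S Z V E r \<gamma> \<and> zero_off V \<gamma>} {j. enat j \<le> r}
       (\<lambda>j \<gamma>. iter_quotient S Z V E \<gamma> j)
       (\<lambda>j. compact_open_topology (tower_dom_topology S Z V j) (topo E))"

text \<open>The spaces \<open>C\<^sup>r(M, E)\<close> and \<open>C\<^sup>r\<^sub>K(M, E)\<close> of maps of class \<open>C\<^sup>r\<close> over \<open>S\<close>.\<close>

definition local_rep :: "('m, 'z) chart \<Rightarrow> ('m \<Rightarrow> 'e::zero) \<Rightarrow> 'z \<Rightarrow> 'e" where
  "local_rep = (\<lambda>(U, \<kappa>) \<gamma> z. if z \<in> \<kappa> ` U then \<gamma> (inv_into U \<kappa> z) else 0)"

definition Cr_mfd_topology ::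
    "'k::field topology \<Rightarrow> ('k, 'z::ab_group_add) tvs \<Rightarrow> ('m, 'z) mfd \<Rightarrow> ('k, 'e::ab_group_add) tvs \<Rightarrow>
     enat \<Rightarrow> ('m \<Rightarrow> 'e) topology" where
  "Cr_mfd_topology S Z M E r =
     initial_topology {\<gamma>. Ck_mfd_to_tvs S Z M E r \<gamma> \<and> zero_off (topspace (mtop M)) \<gamma>} (atlas M)
       local_rep (\<lambda>(U, \<kappa>). Cr_topology S Z (\<kappa> ` U) E r)"

definition supp :: "'m topology \<Rightarrow> ('m \<Rightarrow> 'e::zero) \<Rightarrow> 'm set" where
  "supp T \<gamma> = T closure_of {x \<in> topspace T. \<gamma> x \<noteq> 0}"

definition CrK ::
    "'k::field topology \<Rightarrow> ('k, 'z::ab_group_add) tvs \<Rightarrow> ('m, 'z) mfd \<Rightarrow> 'm set \<Rightarrow>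
     ('k, 'e::ab_group_add) tvs \<Rightarrow> enat \<Rightarrow> ('k, 'm \<Rightarrow> 'e) tvs" where
  "CrK S Z M K E r =
     \<lparr>scal = (\<lambda>a \<gamma> x. scal E a (\<gamma> x)),
      topo = subtopology (Cr_mfd_topology S Z M E r) {\<gamma>. supp (mtop M) \<gamma> \<subseteq> K}\<rparr>"

text \<open>The set \<open>C\<^sup>r\<^sub>K(M, U)\<close>.\<close>

definition CrK_into ::
    "'k::field topology \<Rightarrow> ('k, 'z::ab_group_add) tvs \<Rightarrow> ('m, 'z) mfd \<Rightarrow> 'm set \<Rightarrow>
     ('k, 'e::ab_group_add) tvs \<Rightarrow> enat \<Rightarrow> 'e set \<Rightarrow> ('m \<Rightarrow> 'e) set" where
  "CrK_into S Z M K E r U =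
     {\<gamma> \<in> topspace (topo (CrK S Z M K E r)). \<gamma> ` topspace (mtop M) \<subseteq> U}"

definition pushforward :: "'m set \<Rightarrow> ('m \<times> 'e \<Rightarrow> 'f::zero) \<Rightarrow> ('m \<Rightarrow> 'e) \<Rightarrow> 'm \<Rightarrow> 'f" where
  "pushforward A f \<gamma> = (\<lambda>x. if x \<in> A then f (x, \<gamma> x) else 0)"

end

theory Submission
  imports Defs
begin

text \<open>
  A map \<open>\<phi>\<close> from a topological space \<open>A\<close> into \<open>C\<^sup>r\<^sub>K(M, F)\<close> is continuous iff \<open>(a, z) \<mapsto> \<phi> a (\<kappa>\<inverse> z)\<close> is, for
  every chart \<open>\<kappa>\<close>, of class \<open>C\<^sup>r\<close> in \<open>z\<close> with difference quotients that are jointly continuous in \<open>(a, z)\<close>: a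
  jointly continuous map induces a continuous map into a compact-open topology, and conversely
  evaluation is continuous since the ground field, hence each \<open>V\<^sup>[\<^sup>i\<^sup>]\<close>, is locally compact. Thus the
  calculus with parameters yields the vector space structure, and it yields continuity of
  the candidates for the iterated difference quotients of \<open>f\<^sub>*\<close>, which are computed
  pointwise: \<open>f\<^sub>*\<^sup>[\<^sup>j\<^sup>](T)(x) = f(x, \<cdot>)\<^sup>[\<^sup>j\<^sup>](T(x))\<close>. In charts, these are compositions of
  \<open>f\<^sup>[\<^sup>j\<^sup>]\<close>, which is of class \<open>C\<^sup>r\<close>, with evaluation maps.
\<close>

text \<open>Two fields act at once: the j quotients in \<gamma> are taken over \<open>TK\<close>,
  the i quotients in a chart of \<open>M\<close> over \<open>TF\<close>. For j \<le> k and i \<le>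
  r, class C^(r+k) pays for both, since g^[j] is C^i whenever g is C^(j+i), and a C^i map over
  \<open>TK\<close> is C^i over \<open>TF\<close>. Two obstacles shape the rest. The chain rule for
  higher quotients has no manageable closed form; hence C^n is defined through lifts that simply
  compose, and closed formulas for higher quotients of composites are used only along affine maps:
  point evaluations, slices y \<mapsto> (z, y), insertion of a parameter. Moreover \<sigma> may map
  a chart domain of \<open>M\<close> into several charts of \<open>Mt\<close>, so C^n has to be
  local, although g^[1] compares values at the possibly distant points x and x + t y; here t = 0 and
  t \<noteq> 0 are treated separately. The condition f(x, 0) = 0 off \<open>K\<close> is what keeps
  the values of all candidate quotients supported in \<open>K\<close>.\<close>

lemma continuous_map_comp:
  "continuous_map Y Z g \<Longrightarrow> continuous_map X Y f \<Longrightarrow> continuous_map X Z (\<lambda>x. g (f x))"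
  using continuous_map_compose[of X Y f Z g] by (simp add: o_def)

lemma continuous_map_comp2:
  assumes "continuous_map (prod_topology Y Y') Z (\<lambda>(a, b). g a b)"
    and "continuous_map X Y f" "continuous_map X Y' f'"
  shows "continuous_map X Z (\<lambda>x. g (f x) (f' x))"
  using continuous_map_comp[OF assms(1), of X "\<lambda>x. (f x, f' x)"] assms(2,3)
  by (simp add: continuous_map_pairedI)

lemma continuous_map_topspaceD: "continuous_map X Y f \<Longrightarrow> x \<in> topspace X \<Longrightarrow> f x \<in> topspace Y"
  by (auto simp: continuous_map_def)

section \<open>Towers over spaces with lines\<close>

text \<open>
  The only structure of the domain and codomain that enters the calculus is the topology
  together with the lines \<open>(x, y, t) \<mapsto> x + t y\<close>, here an arbitrary function \<open>l\<close>. This makes it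
  possible to treat towers as spaces in their own right, and to treat parameters by means
  of the constant lines \<open>l x y t = x\<close>.
\<close>

fun tline :: "('a \<Rightarrow> 'a \<Rightarrow> 'k::field \<Rightarrow> 'a) \<Rightarrow> ('a, 'k) tower \<Rightarrow> ('a, 'k) tower \<Rightarrow> 'k \<Rightarrow> ('a, 'k) tower"
where
  "tline l (Pt x) (Pt y) t = Pt (l x y t)"
| "tline l (Tr x x' a) (Tr y y' b) t = Tr (tline l x y t) (tline l x' y' t) (a + t * b)"

definition vline :: "('k, 'e::plus) tvs \<Rightarrow> 'e \<Rightarrow> 'e \<Rightarrow> 'k \<Rightarrow> 'e" where
  "vline E x y t = x + scal E t y"

definition sline :: "'k::field \<Rightarrow> 'k \<Rightarrow> 'k \<Rightarrow> 'k" where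
  "sline x y t = x + t * y"

definition cline :: "'a \<Rightarrow> 'a \<Rightarrow> 'k \<Rightarrow> 'a" where
  "cline x y t = x"

definition pline ::
  "('a \<Rightarrow> 'a \<Rightarrow> 'k \<Rightarrow> 'a) \<Rightarrow> ('b \<Rightarrow> 'b \<Rightarrow> 'k \<Rightarrow> 'b) \<Rightarrow> 'a \<times> 'b \<Rightarrow> 'a \<times> 'b \<Rightarrow> 'k \<Rightarrow> 'a \<times> 'b" where
  "pline l l' x y t = (l (fst x) (fst y) t, l' (snd x) (snd y) t)"

lemma pline_simp [simp]: "pline l l' (x, x') (y, y') t = (l x y t, l' x' y' t)"
  by (simp add: pline_def)

text \<open>On towers of different levels both functions equal \<open>undefined\<close>, so the
  equation holds for all arguments and can serve as a rewrite rule.\<close>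

lemma tower_line_conv: "tower_line E x y t = tline (vline E) x y t"
proof (induction E x y t rule: tower_line.induct)
  case ("3_1" E x x' a y t)
  have "tower_line E (Tr x x' a) (Pt y) t = undefined"
    by (rule tower_line.elims[of E "Tr x x' a" "Pt y" t, OF refl]) (simp_all only: tower.distinct)
  moreover have "tline (vline E) (Tr x x' a) (Pt y) t = undefined"
    by (rule tline.elims[of "vline E" "Tr x x' a" "Pt y" t, OF refl]) (simp_all only: tower.distinct)
  ultimately show ?case by simp
next
  case ("3_2" E x y y' a t)
  have "tower_line E (Pt x) (Tr y y' a) t = undefined"
    by (rule tower_line.elims[of E "Pt x" "Tr y y' a" t, OF refl]) (simp_all only: tower.distinct)
  moreover have "tline (vline E) (Pt x) (Tr y y' a) t = undefined"
    by (rule tline.elims[of "vline E" "Pt x" "Tr y y' a" t, OF refl]) (simp_all only: tower.distinct)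
  ultimately show ?case by simp
qed (simp_all add: vline_def)

lemma vline_prod_tvs: "vline (prod_tvs E F) = pline (vline E) (vline F)"
  by (auto simp: fun_eq_iff vline_def pline_def prod_tvs_def)

section \<open>Topologies on the levels of the tower\<close>

definition pts :: "'a topology \<Rightarrow> ('a, 'k) tower topology" where
  "pts T = pullback_topology {z. is_Pt z} pt T"

text \<open>A single tower step, applicable to every topology on towers. Inductions on the order of
  differentiability generalise over the topology and move one step up.\<close>

definition up :: "'k topology \<Rightarrow> ('a, 'k) tower topology \<Rightarrow> ('a, 'k) tower topology" where
  "up S T = pullback_topology {z. \<not> is_Pt z} (\<lambda>z. (base z, dir z, par z))
     (prod_topology T (prod_topology T S))"

lemma tower_topology_conv [simp]:
  "tower_topology S T 0 = pts T" "tower_topology S T (Suc j) = up S (tower_topology S T j)"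
  by (simp_all add: pts_def up_def)

declare tower_topology.simps [simp del]

lemma topspace_pts [simp]: "topspace (pts T) = Pt ` topspace T"
  by (auto simp: pts_def topspace_pullback_topology is_Pt_def image_iff)

lemma topspace_up: "topspace (up S T) = {Tr x y t | x y t. x \<in> topspace T \<and> y \<in> topspace T \<and> t \<in> topspace S}"
proof -
  have "z \<in> topspace (up S T) \<longleftrightarrow>
      z \<in> {Tr x y t | x y t. x \<in> topspace T \<and> y \<in> topspace T \<and> t \<in> topspace S}" for z
    by (cases z) (auto simp: up_def topspace_pullback_topology)
  then show ?thesis by blast
qed

lemma Tr_in_topspace_up [simp]:
  "Tr x y t \<in> topspace (up S T) \<longleftrightarrow> x \<in> topspace T \<and> y \<in> topspace T \<and> t \<in> topspace S"
  by (auto simp: topspace_up)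

lemma Pt_notin_topspace_up [simp]: "Pt x \<notin> topspace (up S T)"
  by (auto simp: topspace_up)

lemma topspace_upE:
  assumes "w \<in> topspace (up S T)"
  obtains x y t where "w = Tr x y t" "x \<in> topspace T" "y \<in> topspace T" "t \<in> topspace S"
  using assms by (auto simp: topspace_up)

lemma continuous_map_pt: "continuous_map (pts T) T pt"
  unfolding pts_def
  using continuous_map_pullback[of T T "\<lambda>x. x" "{z. is_Pt z}" pt] by (simp add: o_def)

lemma continuous_map_Pt:
  "continuous_map X (pts T) (\<lambda>x. Pt (g x)) \<longleftrightarrow> continuous_map X T g"
proof
  assume "continuous_map X T g"
  then show "continuous_map X (pts T) (\<lambda>x. Pt (g x))"
    unfolding pts_def by (intro continuous_map_pullback') (auto simp: o_def)
next
  assume "continuous_map X (pts T) (\<lambda>x. Pt (g x))"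
  from continuous_map_comp[OF continuous_map_pt this] show "continuous_map X T g" by simp
qed

lemma continuous_map_up_tuple:
  "continuous_map (up S T) (prod_topology T (prod_topology T S)) (\<lambda>z. (base z, dir z, par z))"
  unfolding up_def
  using continuous_map_pullback[OF continuous_map_id, of "{z. \<not> is_Pt z}" "\<lambda>z. (base z, dir z, par z)"]
  by (simp add: o_def)

lemma continuous_map_base: "continuous_map (up S T) T base"
  and continuous_map_dir: "continuous_map (up S T) T dir"
  and continuous_map_par: "continuous_map (up S T) S par"
  using continuous_map_up_tuple[of S T] by (auto simp: continuous_map_pairwise o_def)

lemma continuous_map_Tr:
  assumes "continuous_map X T a" "continuous_map X T b" "continuous_map X S c"
  shows "continuous_map X (up S T) (\<lambda>x. Tr (a x) (b x) (c x))"
  unfolding up_def using assms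
  by (intro continuous_map_pullback') (auto simp: o_def continuous_map_pairwise)

lemma openin_continuous_map_preimage_in:
  assumes "continuous_map X Y f" "openin Y W"
  shows "openin X {x \<in> topspace X. f x \<in> W}"
  using assms by (simp add: continuous_map_def)

lemma openin_pts_image: "openin (pts T) (Pt ` U :: ('a, 'k) tower set) \<longleftrightarrow> openin T U"
proof
  let ?P = "Pt ` U :: ('a, 'k) tower set"
  assume "openin (pts T) ?P"
  then obtain W where W: "openin T W" "?P = pt -` W \<inter> {z. is_Pt z}"
    unfolding pts_def openin_pullback_topology by blast
  have "x \<in> U \<longleftrightarrow> x \<in> W" for x
  proof -
    have "x \<in> U \<longleftrightarrow> Pt x \<in> ?P" by auto
    also have "\<dots> \<longleftrightarrow> x \<in> W" unfolding W(2) by simp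
    finally show ?thesis .
  qed
  then have "U = W" by blast
  with W(1) show "openin T U" by simp
next
  assume "openin T U"
  moreover have "(Pt ` U :: ('a, 'k) tower set) = pt -` U \<inter> {z. is_Pt z}"
    by (auto simp: is_Pt_def image_iff)
  ultimately show "openin (pts T) (Pt ` U :: ('a, 'k) tower set)"
    unfolding pts_def openin_pullback_topology by blast
qed

section \<open>The calculus\<close>

text \<open>This is V^[1] for a set V of towers and arbitrary lines.\<close>

definition updom :: "'k topology \<Rightarrow> ('a \<Rightarrow> 'a \<Rightarrow> 'k::field \<Rightarrow> 'a) \<Rightarrow> ('a, 'k) tower topology \<Rightarrow>
    ('a, 'k) tower set \<Rightarrow> ('a, 'k) tower set" where
  "updom S l T V = {Tr x y t | x y t. x \<in> V \<and> y \<in> topspace T \<and> t \<in> topspace S \<and> tline l x y t \<in> V}"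

lemma Tr_in_updom [simp]: "Tr x y t \<in> updom S l T V \<longleftrightarrow>
    x \<in> V \<and> y \<in> topspace T \<and> t \<in> topspace S \<and> tline l x y t \<in> V"
  by (auto simp: updom_def)

lemma updom_subset: "V \<subseteq> topspace T \<Longrightarrow> updom S l T V \<subseteq> topspace (up S T)"
  by (auto simp: updom_def topspace_up)

lemma updom_mono: "V \<subseteq> W \<Longrightarrow> updom S l T V \<subseteq> updom S l T W"
  by (auto simp: updom_def)

lemma updomE:
  assumes "w \<in> updom S l T V"
  obtains x y t where "w = Tr x y t" "x \<in> V" "y \<in> topspace T" "t \<in> topspace S" "tline l x y t \<in> V"
  using assms by (auto simp: updom_def)

lemma tower_dom_conv [simp]:
  "tower_dom S E U 0 = Pt ` U"
  "tower_dom S E U (Suc j) = updom S (vline E) (tower_topology S (topo E) j) (tower_dom S E U j)"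
  by (simp_all add: updom_def tower_line_conv)

declare tower_dom.simps [simp del]

text \<open>\<open>d\<close> is the difference quotient in multiplied-out form, g x + t d = g (x + t
  y). It involves neither subtraction nor division, so the codomain may itself be a space of towers.
  At t = 0 the equation does not constrain \<open>d\<close> in a vector space; there the value is
  pinned down by continuity.\<close>

definition is_lift :: "'k topology \<Rightarrow> ('a \<Rightarrow> 'a \<Rightarrow> 'k::field \<Rightarrow> 'a) \<Rightarrow> ('b \<Rightarrow> 'b \<Rightarrow> 'k \<Rightarrow> 'b) \<Rightarrow>
    ('a, 'k) tower topology \<Rightarrow> ('a, 'k) tower set \<Rightarrow>
    (('a, 'k) tower \<Rightarrow> ('b, 'k) tower) \<Rightarrow> (('a, 'k) tower \<Rightarrow> ('b, 'k) tower) \<Rightarrow> bool" where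
  "is_lift S l l' T V g h \<longleftrightarrow> (\<forall>x y t. Tr x y t \<in> updom S l T V \<longrightarrow>
     (\<exists>d. h (Tr x y t) = Tr (g x) d t \<and> tline l' (g x) d t = g (tline l x y t)))"

text \<open>
  A map \<open>g\<close> is of class \<open>C\<^sup>n\<^sup>+\<^sup>1\<close> iff \<open>(x, y, t) \<mapsto> (g x, g\<^sup>[\<^sup>1\<^sup>](x, y, t), t)\<close> is of class \<open>C\<^sup>n\<close>. In contrast
  to \<open>g\<^sup>[\<^sup>1\<^sup>]\<close>, this map depends functorially on \<open>g\<close>.
\<close>

primrec Cn :: "'k topology \<Rightarrow> ('a \<Rightarrow> 'a \<Rightarrow> 'k::field \<Rightarrow> 'a) \<Rightarrow> ('b \<Rightarrow> 'b \<Rightarrow> 'k \<Rightarrow> 'b) \<Rightarrow> nat \<Rightarrow>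
    ('a, 'k) tower topology \<Rightarrow> ('a, 'k) tower set \<Rightarrow> ('b, 'k) tower topology \<Rightarrow>
    (('a, 'k) tower \<Rightarrow> ('b, 'k) tower) \<Rightarrow> bool" where
  "Cn S l l' 0 T V T' g \<longleftrightarrow> continuous_map (subtopology T V) T' g"
| "Cn S l l' (Suc n) T V T' g \<longleftrightarrow> continuous_map (subtopology T V) T' g \<and>
     (\<exists>h. is_lift S l l' T V g h \<and> Cn S l l' n (up S T) (updom S l T V) (up S T') h)"

lemma Cn_continuous: "Cn S l l' n T V T' g \<Longrightarrow> continuous_map (subtopology T V) T' g"
  by (cases n) auto

lemma Cn_topspaceD: "Cn S l l' n T V T' g \<Longrightarrow> V \<subseteq> topspace T \<Longrightarrow> x \<in> V \<Longrightarrow> g x \<in> topspace T'"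
  using Cn_continuous continuous_map_topspaceD[of "subtopology T V" T' g x]
  by fastforce

lemma Cn_Suc_imp: "Cn S l l' (Suc n) T V T' g \<Longrightarrow> Cn S l l' n T V T' g"
proof (induction n arbitrary: T V T' g)
  case (Suc n)
  then obtain h where "is_lift S l l' T V g h" "Cn S l l' (Suc n) (up S T) (updom S l T V) (up S T') h"
    unfolding Cn.simps(2)[of S l l' "Suc n"] by auto
  with Suc.IH[of "up S T" "updom S l T V" "up S T'" h] Cn_continuous[OF Suc.prems]
  show ?case unfolding Cn.simps(2)[of S l l' n] by blast
qed simp

lemma Cn_subset: "Cn S l l' n T V T' g \<Longrightarrow> W \<subseteq> V \<Longrightarrow> Cn S l l' n T W T' g"
proof (induction n arbitrary: T V W T' g)
  case 0
  then show ?case by (auto intro: continuous_map_from_subtopology_mono)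
next
  case (Suc n)
  then obtain h where h: "is_lift S l l' T V g h" "Cn S l l' n (up S T) (updom S l T V) (up S T') h"
    by auto
  have "is_lift S l l' T W g h"
    using h(1) Suc.prems(2) unfolding is_lift_def updom_def by blast
  with Suc h(2) updom_mono[OF Suc.prems(2)] show ?case
    by (auto intro: continuous_map_from_subtopology_mono)
qed

lemma Cn_cong:
  assumes "Cn S l l' n T V T' g" and eq: "\<And>x. x \<in> V \<Longrightarrow> g x = g' x"
  shows "Cn S l l' n T V T' g'"
proof -
  have c: "continuous_map (subtopology T V) T' g'"
    using Cn_continuous[OF assms(1)] eq by (auto intro: continuous_map_eq)
  show ?thesis
  proof (cases n)
    case 0
    then show ?thesis using c by simp
  next
    case (Suc m)
    have "is_lift S l l' T V g' h" if "is_lift S l l' T V g h" for h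
      using that eq unfolding is_lift_def by auto
    then show ?thesis using c assms(1) Suc by auto
  qed
qed

text \<open>Chain rule. If f' lifts f and g' lifts g, then g' o f' lifts g o f, and the induction
  hypothesis applies to the lifts directly. The point to check is \<open>mem\<close>: f' maps V^[1]
  into W^[1].\<close>

lemma Cn_comp:
  assumes "Cn S l l' n T V T' f" "Cn S l' l'' n T' W T'' g" "\<And>x. x \<in> V \<Longrightarrow> f x \<in> W"
    and "V \<subseteq> topspace T"
  shows "Cn S l l'' n T V T'' (\<lambda>x. g (f x))"
  using assms
proof (induction n arbitrary: T V T' W T'' f g)
  case 0
  then show ?case
    using continuous_map_comp[of "subtopology T' W" T'' g "subtopology T V" f]
    by (auto simp: continuous_map_in_subtopology)
next
  case (Suc n)
  obtain f' where f': "is_lift S l l' T V f f'" "Cn S l l' n (up S T) (updom S l T V) (up S T') f'"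
    using Suc.prems(1) by auto
  obtain g' where g': "is_lift S l' l'' T' W g g'" "Cn S l' l'' n (up S T') (updom S l' T' W) (up S T'') g'"
    using Suc.prems(2) by auto
  have sub: "updom S l T V \<subseteq> topspace (up S T)"
    using Suc.prems(4) updom_subset by blast
  have mem: "f' w \<in> updom S l' T' W" if w: "w \<in> updom S l T V" for w
  proof -
    from w obtain x y t where xyt: "w = Tr x y t" "x \<in> V" "tline l x y t \<in> V" by (rule updomE)
    obtain d where d: "f' w = Tr (f x) d t" "tline l' (f x) d t = f (tline l x y t)"
      using f'(1) w xyt unfolding is_lift_def by blast
    have "f' w \<in> topspace (up S T')" using Cn_topspaceD[OF f'(2) sub w] .
    then show ?thesis using d xyt Suc.prems(3) by auto
  qed
  have "is_lift S l l'' T V (\<lambda>x. g (f x)) (\<lambda>x. g' (f' x))"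
    unfolding is_lift_def
  proof (intro allI impI)
    fix x y t assume w: "Tr x y t \<in> updom S l T V"
    obtain d where d: "f' (Tr x y t) = Tr (f x) d t" "tline l' (f x) d t = f (tline l x y t)"
      using f'(1) w unfolding is_lift_def by blast
    then show "\<exists>d. g' (f' (Tr x y t)) = Tr (g (f x)) d t \<and>
        tline l'' (g (f x)) d t = g (f (tline l x y t))"
      using g'(1) mem[OF w] unfolding is_lift_def by (metis)
  qed
  moreover have "Cn S l l'' n (up S T) (updom S l T V) (up S T'') (\<lambda>x. g' (f' x))"
    using Suc.IH[OF f'(2) g'(2) mem sub] .
  moreover have "continuous_map (subtopology T V) T'' (\<lambda>x. g (f x))"
    using continuous_map_comp[of "subtopology T' W" T'' g "subtopology T V" f] Suc.prems
    by (auto simp: continuous_map_in_subtopology)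
  ultimately show ?case by auto
qed

text \<open>The lift applies \<phi> to both entries of the triple and keeps the scalar, so it
  commutes with lines again and the induction continues at every order.\<close>

lemma Cn_linear:
  assumes "continuous_map T T' \<phi>" "V \<subseteq> topspace T"
    and "\<And>x y t. x \<in> topspace T \<Longrightarrow> y \<in> topspace T \<Longrightarrow> t \<in> topspace S \<Longrightarrow>
           \<phi> (tline l x y t) = tline l' (\<phi> x) (\<phi> y) t"
  shows "Cn S l l' n T V T' \<phi>"
  using assms
proof (induction n arbitrary: T V T' \<phi>)
  case 0
  then show ?case by (auto intro: continuous_map_from_subtopology)
next
  case (Suc n)
  define \<psi> where "\<psi> w = Tr (\<phi> (base w)) (\<phi> (dir w)) (par w)" for w
  have c: "continuous_map (up S T) (up S T') \<psi>"
    unfolding \<psi>_def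
    by (intro continuous_map_Tr continuous_map_comp[OF Suc.prems(1)] continuous_map_base
        continuous_map_dir continuous_map_par)
  have "Cn S l l' n (up S T) (updom S l T V) (up S T') \<psi>"
  proof (rule Suc.IH[OF c updom_subset[OF Suc.prems(2)]])
    fix x y t assume "x \<in> topspace (up S T)" "y \<in> topspace (up S T)" "t \<in> topspace S"
    then show "\<psi> (tline l x y t) = tline l' (\<psi> x) (\<psi> y) t"
      by (elim topspace_upE) (auto simp: \<psi>_def Suc.prems(3))
  qed
  moreover have "is_lift S l l' T V \<phi> \<psi>"
    using Suc.prems(2,3) unfolding is_lift_def \<psi>_def by auto
  ultimately show ?case
    using Suc.prems(1) by (auto intro: continuous_map_from_subtopology)
qed

lemma Cn_base: "V \<subseteq> topspace (up S' T) \<Longrightarrow> Cn S l l n (up S' T) V T base"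
  by (rule Cn_linear[OF continuous_map_base]) (auto simp: topspace_up)

lemma Cn_dir: "V \<subseteq> topspace (up S' T) \<Longrightarrow> Cn S l l n (up S' T) V T dir"
  by (rule Cn_linear[OF continuous_map_dir]) (auto simp: topspace_up)

lemma Cn_par: "V \<subseteq> topspace (up S' T) \<Longrightarrow> Cn S l sline n (up S' T) V (pts S') (\<lambda>w. Pt (par w))"
  by (rule Cn_linear) (auto simp: topspace_up continuous_map_Pt continuous_map_par sline_def)

text \<open>The lift of a triple has the triple as base and the triple of the three directions as
  direction, so it is a triple of triples and the induction hypothesis is used for both layers. The
  field \<open>K\<close> of the new tower level is kept apart from \<open>S\<close> because towers
  over \<open>TK\<close> later occur as values of maps that are differentiated over
  \<open>TF\<close>.\<close>

lemma Cn_Tr: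
  assumes "Cn S l l' n T V T' a" "Cn S l l' n T V T' b" "Cn S l sline n T V (pts K) (\<lambda>w. Pt (p w))"
    and "V \<subseteq> topspace T"
  shows "Cn S l l' n T V (up K T') (\<lambda>w. Tr (a w) (b w) (p w))"
  using assms
proof (induction n arbitrary: K T V T' a b p)
  case 0
  then show ?case by (auto intro!: continuous_map_Tr simp: continuous_map_Pt)
next
  case (Suc n)
  let ?V = "updom S l T V"
  obtain a' where a': "is_lift S l l' T V a a'" "Cn S l l' n (up S T) ?V (up S T') a'"
    using Suc.prems(1) by auto
  obtain b' where b': "is_lift S l l' T V b b'" "Cn S l l' n (up S T) ?V (up S T') b'"
    using Suc.prems(2) by auto
  obtain p' where p': "is_lift S l sline T V (\<lambda>w. Pt (p w)) p'"
      "Cn S l sline n (up S T) ?V (up S (pts K)) p'"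
    using Suc.prems(3) by auto
  have sub: "?V \<subseteq> topspace (up S T)"
    using Suc.prems(4) updom_subset by blast
  have bV: "base w \<in> V" if "w \<in> ?V" for w using that by (auto elim: updomE)
  have base: "Cn S l l n (up S T) ?V T base" and par: "Cn S l sline n (up S T) ?V (pts S) (\<lambda>w. Pt (par w))"
    using Cn_base Cn_par sub by blast+
  have dira: "Cn S l l' n (up S T) ?V T' (\<lambda>w. dir (a' w))"
    by (rule Cn_comp[OF a'(2) Cn_dir Cn_topspaceD[OF a'(2) sub] sub]) auto
  have dirb: "Cn S l l' n (up S T) ?V T' (\<lambda>w. dir (b' w))"
    by (rule Cn_comp[OF b'(2) Cn_dir Cn_topspaceD[OF b'(2) sub] sub]) auto
  have dirp: "Cn S l sline n (up S T) ?V (pts K) (\<lambda>w. Pt (pt (dir (p' w))))"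
  proof -
    have "Cn S l sline n (up S T) ?V (pts K) (\<lambda>w. dir (p' w))"
      by (rule Cn_comp[OF p'(2) Cn_dir Cn_topspaceD[OF p'(2) sub] sub]) auto
    then show ?thesis
      by (rule Cn_cong) (use Cn_topspaceD[OF p'(2) sub] in \<open>fastforce elim!: topspace_upE\<close>)
  qed
  have *: "Cn S l l' n (up S T) ?V (up K T') (\<lambda>w. Tr (a (base w)) (b (base w)) (p (base w)))"
    by (intro Suc.IH Cn_comp[OF base Cn_Suc_imp[OF Suc.prems(1)] bV sub]
      Cn_comp[OF base Cn_Suc_imp[OF Suc.prems(2)] bV sub]
      Cn_comp[OF base Cn_Suc_imp[OF Suc.prems(3)] bV sub] sub)
  have "Cn S l l' n (up S T) ?V (up S (up K T'))
     (\<lambda>w. Tr (Tr (a (base w)) (b (base w)) (p (base w))) (Tr (dir (a' w)) (dir (b' w)) (pt (dir (p' w)))) (par w))"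
    by (intro Suc.IH * par sub dira dirb dirp)
  moreover have "is_lift S l l' T V (\<lambda>w. Tr (a w) (b w) (p w))
     (\<lambda>w. Tr (Tr (a (base w)) (b (base w)) (p (base w))) (Tr (dir (a' w)) (dir (b' w)) (pt (dir (p' w)))) (par w))"
    unfolding is_lift_def
  proof (intro allI impI)
    fix x y t assume w: "Tr x y t \<in> ?V"
    obtain d where d: "a' (Tr x y t) = Tr (a x) d t" "tline l' (a x) d t = a (tline l x y t)"
      using a'(1) w unfolding is_lift_def by blast
    obtain e where e: "b' (Tr x y t) = Tr (b x) e t" "tline l' (b x) e t = b (tline l x y t)"
      using b'(1) w unfolding is_lift_def by blast
    obtain q where q: "p' (Tr x y t) = Tr (Pt (p x)) q t" "tline sline (Pt (p x)) q t = Pt (p (tline l x y t))"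
      using p'(1) w unfolding is_lift_def by blast
    have "p' (Tr x y t) \<in> topspace (up S (pts K))" using Cn_topspaceD[OF p'(2) sub w] .
    with q obtain q0 where "q = Pt q0" by auto
    with q d e show "\<exists>d. Tr (Tr (a (base (Tr x y t))) (b (base (Tr x y t))) (p (base (Tr x y t))))
              (Tr (dir (a' (Tr x y t))) (dir (b' (Tr x y t))) (pt (dir (p' (Tr x y t))))) (par (Tr x y t)) =
             Tr (Tr (a x) (b x) (p x)) d t \<and>
             tline l' (Tr (a x) (b x) (p x)) d t =
             Tr (a (tline l x y t)) (b (tline l x y t)) (p (tline l x y t))"
      by (auto simp: sline_def)
  qed
  moreover have "continuous_map (subtopology T V) (up K T') (\<lambda>w. Tr (a w) (b w) (p w))"
    using Suc.prems(1-3)[THEN Cn_continuous] by (auto intro!: continuous_map_Tr simp: continuous_map_Pt)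
  ultimately show ?case by auto
qed

section \<open>Topological vector spaces\<close>

context topological_field
begin

lemma add_closed: "a \<in> topspace T \<Longrightarrow> b \<in> topspace T \<Longrightarrow> a + b \<in> topspace T"
  using continuous_map_topspaceD[OF continuous_add, of "(a, b)"] by simp

lemma mult_closed: "a \<in> topspace T \<Longrightarrow> b \<in> topspace T \<Longrightarrow> a * b \<in> topspace T"
  using continuous_map_topspaceD[OF continuous_mult, of "(a, b)"] by simp

lemma uminus_closed: "a \<in> topspace T \<Longrightarrow> - a \<in> topspace T"
  using continuous_map_topspaceD[OF continuous_uminus, of a] by simp

lemma inverse_closed: "a \<in> topspace T \<Longrightarrow> inverse a \<in> topspace T"
  using continuous_map_topspaceD[OF continuous_inverse, of a]
  by (cases "a = 0") (simp_all add: zero_closed)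

text \<open>Translations are continuous, so an open {0} would make every singleton open.\<close>

lemma zero_not_isolated:
  assumes "openin T W" "0 \<in> W"
  shows "\<exists>t\<in>W. t \<noteq> 0"
proof (rule ccontr)
  assume "\<not> (\<exists>t\<in>W. t \<noteq> 0)"
  with assms have 0: "openin T {0}" by (metis empty_iff insertI1 subsetI subset_antisym subset_singletonD)
  have "openin T {a}" if "a \<in> topspace T" for a
  proof -
    have "continuous_map T T (\<lambda>b. b + - a)"
      by (rule continuous_map_comp2[OF continuous_add]) (use that uminus_closed in auto)
    from openin_continuous_map_preimage_in[OF this 0]
    show ?thesis using that by (simp add: Collect_conv_if cong: conj_cong)
  qed
  then have "T = discrete_topology (topspace T)"
    by (metis discrete_topology_unique)
  with non_discrete show False by simp
qed

end

definition kvs :: "'k::field topology \<Rightarrow> ('k, 'k) tvs" where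
  "kvs K = \<lparr>scal = (*), topo = K\<rparr>"

lemma kvs_simps [simp]: "scal (kvs K) = (*)" "topo (kvs K) = K" "vline (kvs K) = sline"
  by (auto simp: kvs_def vline_def sline_def fun_eq_iff)

lemma tvs_kvs: "topological_field K \<Longrightarrow> topological_vector_space K (kvs K)"
  unfolding topological_vector_space_def topological_vector_space_axioms_def
  by (simp add: topological_field.Hausdorff topological_field.zero_closed
    topological_field.continuous_add topological_field.continuous_mult algebra_simps)

context topological_vector_space
begin

lemma plus_closed: "x \<in> topspace (topo E) \<Longrightarrow> y \<in> topspace (topo E) \<Longrightarrow> x + y \<in> topspace (topo E)"
  using continuous_map_topspaceD[OF continuous_plus, of "(x, y)"] by simp

lemma scal_closed: "a \<in> topspace S \<Longrightarrow> x \<in> topspace (topo E) \<Longrightarrow> scal E a x \<in> topspace (topo E)"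
  using continuous_map_topspaceD[OF continuous_scal, of "(a, x)"] by simp

lemma scal_zero_left: "x \<in> topspace (topo E) \<Longrightarrow> scal E 0 x = 0"
  using scal_add_left[of 0 0 x] zero_closed by simp

lemma scal_zero_right: "a \<in> topspace S \<Longrightarrow> scal E a 0 = 0"
  using scal_add_right[of a 0 0] zero_mem by simp

lemma scal_minus_one: "x \<in> topspace (topo E) \<Longrightarrow> scal E (- 1) x = - x"
  using scal_add_left[of 1 "- 1" x] scal_zero_left[of x] scal_one[of x] one_closed uminus_closed[of 1]
  by (simp add: eq_neg_iff_add_eq_0 add.commute)

lemma neg_closed: "x \<in> topspace (topo E) \<Longrightarrow> - x \<in> topspace (topo E)"
  using scal_closed[of "- 1" x] scal_minus_one uminus_closed[OF one_closed] by simp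

lemma minus_closed: "x \<in> topspace (topo E) \<Longrightarrow> y \<in> topspace (topo E) \<Longrightarrow> x - y \<in> topspace (topo E)"
  using plus_closed[of x "- y"] neg_closed by simp

lemma scal_minus_right: "a \<in> topspace S \<Longrightarrow> x \<in> topspace (topo E) \<Longrightarrow> y \<in> topspace (topo E) \<Longrightarrow>
    scal E a (x - y) = scal E a x - scal E a y"
  using scal_add_right[of a "x - y" y] minus_closed by (simp add: eq_diff_eq)

lemma scal_inverse_cancel: "a \<in> topspace S \<Longrightarrow> a \<noteq> 0 \<Longrightarrow> x \<in> topspace (topo E) \<Longrightarrow>
    scal E a (scal E (inverse a) x) = x" "a \<in> topspace S \<Longrightarrow> a \<noteq> 0 \<Longrightarrow> x \<in> topspace (topo E) \<Longrightarrow>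
    scal E (inverse a) (scal E a x) = x"
  using scal_scal[of a "inverse a" x] scal_scal[of "inverse a" a x] inverse_closed scal_one by auto

lemma continuous_map_plus:
  "continuous_map X (topo E) f \<Longrightarrow> continuous_map X (topo E) g \<Longrightarrow> continuous_map X (topo E) (\<lambda>x. f x + g x)"
  by (rule continuous_map_comp2[OF continuous_plus])

lemma continuous_map_scal:
  "continuous_map X S f \<Longrightarrow> continuous_map X (topo E) g \<Longrightarrow> continuous_map X (topo E) (\<lambda>x. scal E (f x) (g x))"
  by (rule continuous_map_comp2[OF continuous_scal])

lemma continuous_map_minus:
  assumes "continuous_map X (topo E) f" "continuous_map X (topo E) g"
  shows "continuous_map X (topo E) (\<lambda>x. f x - g x)"
proof -
  have "continuous_map X (topo E) (\<lambda>x. f x + scal E (- 1) (g x))"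
    by (intro continuous_map_plus continuous_map_scal assms)
      (use uminus_closed[OF one_closed] in auto)
  then show ?thesis
    by (rule continuous_map_eq) (simp add: scal_minus_one continuous_map_topspaceD[OF assms(2)])
qed

end

lemma tvs_restrict:
  assumes "extends TK TF" "topological_vector_space TK E"
  shows "topological_vector_space TF E"
proof -
  interpret E: topological_vector_space TK E by fact
  from assms(1) have TF: "topological_field TF" and sub: "topspace TF \<subseteq> topspace TK"
    and c: "continuous_map TF TK (\<lambda>a. a)" unfolding extends_def by auto
  have "continuous_map (prod_topology TF (topo E)) (topo E) (\<lambda>z. scal E (fst z) (snd z))"
    by (intro E.continuous_map_scal continuous_map_comp[OF c] continuous_map_fst continuous_map_snd)
  then have "continuous_map (prod_topology TF (topo E)) (topo E) (\<lambda>(a, x). scal E a x)"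
    by (simp add: case_prod_unfold)
  then show ?thesis
    using TF sub E.topological_vector_space_axioms
    unfolding topological_vector_space_def topological_vector_space_axioms_def by (auto simp: subset_iff)
qed

lemma extends_refl: "topological_field S \<Longrightarrow> extends S S"
  by (simp add: extends_def)

lemma tvs_prod_tvs:
  assumes "topological_vector_space S E" "topological_vector_space S F"
  shows "topological_vector_space S (prod_tvs E F)"
proof -
  interpret E: topological_vector_space S E by fact
  interpret F: topological_vector_space S F by fact
  have 1: "continuous_map (prod_topology (prod_topology (topo E) (topo F)) (prod_topology (topo E) (topo F)))
     (prod_topology (topo E) (topo F)) (\<lambda>z. (fst (fst z) + fst (snd z), snd (fst z) + snd (snd z)))"
    by (intro continuous_map_pairedI E.continuous_map_plus F.continuous_map_plus
        continuous_map_comp[OF continuous_map_fst continuous_map_fst] continuous_map_comp[OF continuous_map_snd continuous_map_fst]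
        continuous_map_comp[OF continuous_map_fst continuous_map_snd] continuous_map_comp[OF continuous_map_snd continuous_map_snd])
  have 2: "continuous_map (prod_topology S (prod_topology (topo E) (topo F)))
     (prod_topology (topo E) (topo F)) (\<lambda>z. (scal E (fst z) (fst (snd z)), scal F (fst z) (snd (snd z))))"
    by (intro continuous_map_pairedI E.continuous_map_scal F.continuous_map_scal
        continuous_map_fst continuous_map_snd
        continuous_map_comp[OF continuous_map_fst continuous_map_snd] continuous_map_comp[OF continuous_map_snd continuous_map_snd])
  show ?thesis
    unfolding topological_vector_space_def topological_vector_space_axioms_def prod_tvs_def
    using E.topological_field_axioms 1 2
    by (auto simp: Hausdorff_space_prod_topology E.Hausdorff_space F.Hausdorff_space E.zero_mem F.zero_mem
      zero_prod_def plus_prod_def case_prod_unfold E.scal_add_right F.scal_add_right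
      E.scal_add_left F.scal_add_left E.scal_scal F.scal_scal E.scal_one F.scal_one)
qed

section \<open>Maps with values at level zero\<close>

definition CL :: "'k topology \<Rightarrow> ('a \<Rightarrow> 'a \<Rightarrow> 'k::field \<Rightarrow> 'a) \<Rightarrow> nat \<Rightarrow> ('a, 'k) tower topology \<Rightarrow>
    ('a, 'k) tower set \<Rightarrow> ('b \<Rightarrow> 'b \<Rightarrow> 'k \<Rightarrow> 'b) \<Rightarrow> 'b topology \<Rightarrow> (('a, 'k) tower \<Rightarrow> 'b) \<Rightarrow> bool" where
  "CL S l n T V l' T' g \<longleftrightarrow> Cn S l l' n T V (pts T') (\<lambda>w. Pt (g w))"

lemma CL_0: "CL S l 0 T V l' T' g \<longleftrightarrow> continuous_map (subtopology T V) T' g"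
  by (simp add: CL_def continuous_map_Pt)

lemma CL_continuous: "CL S l n T V l' T' g \<Longrightarrow> continuous_map (subtopology T V) T' g"
  using Cn_continuous[of S l l' n T V "pts T'" "\<lambda>w. Pt (g w)"] by (simp add: CL_def continuous_map_Pt)

lemma CL_topspaceD: "CL S l n T V l' T' g \<Longrightarrow> V \<subseteq> topspace T \<Longrightarrow> x \<in> V \<Longrightarrow> g x \<in> topspace T'"
  using Cn_topspaceD[of S l l' n T V "pts T'" "\<lambda>w. Pt (g w)" x] by (auto simp: CL_def)

lemma CL_Suc_imp: "CL S l (Suc n) T V l' T' g \<Longrightarrow> CL S l n T V l' T' g"
  unfolding CL_def by (rule Cn_Suc_imp)

lemma CL_subset: "CL S l n T V l' T' g \<Longrightarrow> W \<subseteq> V \<Longrightarrow> CL S l n T W l' T' g"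
  unfolding CL_def by (rule Cn_subset)

lemma CL_cong: "CL S l n T V l' T' g \<Longrightarrow> (\<And>x. x \<in> V \<Longrightarrow> g x = g' x) \<Longrightarrow> CL S l n T V l' T' g'"
  using Cn_cong[of S l l' n T V "pts T'" "\<lambda>w. Pt (g w)" "\<lambda>w. Pt (g' w)"] by (simp add: CL_def)

lemma CL_comp:
  assumes "Cn S l l' n T V T' f" "CL S l' n T' W l'' T'' g" "\<And>x. x \<in> V \<Longrightarrow> f x \<in> W"
    and "V \<subseteq> topspace T"
  shows "CL S l n T V l'' T'' (\<lambda>x. g (f x))"
  using assms unfolding CL_def by (rule Cn_comp)

text \<open>The lift is rebuilt as (g x, h (x, y, t), t). Since \<open>g\<close> occurs as its first
  entry, C^n is required of \<open>g\<close> as well as of its quotient \<open>h\<close>.\<close>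

lemma CL_SucI:
  assumes "CL S l n T V l' T' g" "CL S l n (up S T) (updom S l T V) l' T' h" "V \<subseteq> topspace T"
    and "\<And>x y t. Tr x y t \<in> updom S l T V \<Longrightarrow> l' (g x) (h (Tr x y t)) t = g (tline l x y t)"
  shows "CL S l (Suc n) T V l' T' g"
proof -
  let ?V = "updom S l T V"
  have sub: "?V \<subseteq> topspace (up S T)" using assms(3) by (rule updom_subset)
  have bV: "base w \<in> V" if "w \<in> ?V" for w using that by (auto elim: updomE)
  have base: "Cn S l l n (up S T) ?V T base" and par: "Cn S l sline n (up S T) ?V (pts S) (\<lambda>w. Pt (par w))"
    using Cn_base Cn_par sub by blast+
  have "Cn S l l' n (up S T) ?V (up S (pts T')) (\<lambda>w. Tr (Pt (g (base w))) (Pt (h w)) (par w))"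
    by (rule Cn_Tr) (use CL_comp[OF base assms(1) bV sub] assms(2) par sub in \<open>auto simp: CL_def\<close>)
  moreover have "is_lift S l l' T V (\<lambda>w. Pt (g w)) (\<lambda>w. Tr (Pt (g (base w))) (Pt (h w)) (par w))"
    using assms(4) unfolding is_lift_def by auto
  ultimately show ?thesis
    using CL_continuous[OF assms(1)] by (auto simp: CL_def continuous_map_Pt)
qed

lemma CL_SucE:
  assumes "CL S l (Suc n) T V l' T' g" "V \<subseteq> topspace T"
  obtains h where "CL S l n (up S T) (updom S l T V) l' T' h"
    and "\<And>x y t. Tr x y t \<in> updom S l T V \<Longrightarrow> l' (g x) (h (Tr x y t)) t = g (tline l x y t)"
proof -
  let ?V = "updom S l T V"
  have sub: "?V \<subseteq> topspace (up S T)" using assms(2) by (rule updom_subset)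
  from assms(1) obtain h where h: "is_lift S l l' T V (\<lambda>w. Pt (g w)) h"
      "Cn S l l' n (up S T) ?V (up S (pts T')) h"
    by (auto simp: CL_def)
  have "Cn S l l' n (up S T) ?V (pts T') (\<lambda>w. dir (h w))"
    by (rule Cn_comp[OF h(2) Cn_dir Cn_topspaceD[OF h(2) sub] sub]) auto
  then have "CL S l n (up S T) ?V l' T' (\<lambda>w. pt (dir (h w)))"
    unfolding CL_def
    by (rule Cn_cong) (use Cn_topspaceD[OF h(2) sub] in \<open>fastforce elim!: topspace_upE\<close>)
  moreover have "l' (g x) (pt (dir (h (Tr x y t)))) t = g (tline l x y t)" if w: "Tr x y t \<in> ?V" for x y t
  proof -
    obtain d where d: "h (Tr x y t) = Tr (Pt (g x)) d t" "tline l' (Pt (g x)) d t = Pt (g (tline l x y t))"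
      using h(1) w unfolding is_lift_def by blast
    moreover have "h (Tr x y t) \<in> topspace (up S (pts T'))" using Cn_topspaceD[OF h(2) sub w] .
    ultimately show ?thesis by auto
  qed
  ultimately show ?thesis using that by blast
qed

lemma CL_linear:
  assumes "CL S l n T V l' T' g" "continuous_map T' T'' \<phi>" "V \<subseteq> topspace T"
    and "\<And>x y t. x \<in> topspace T' \<Longrightarrow> y \<in> topspace T' \<Longrightarrow> t \<in> topspace S \<Longrightarrow> \<phi> (l' x y t) = l'' (\<phi> x) (\<phi> y) t"
  shows "CL S l n T V l'' T'' (\<lambda>w. \<phi> (g w))"
proof -
  have "Cn S l' l'' n (pts T') (topspace (pts T')) (pts T'') (\<lambda>w. Pt (\<phi> (pt w)))"
    by (rule Cn_linear) (auto simp: continuous_map_Pt assms(4) intro: continuous_map_comp[OF assms(2) continuous_map_pt])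
  from Cn_comp[OF assms(1)[unfolded CL_def] this _ assms(3)] show ?thesis
    using CL_topspaceD[OF assms(1,3)] by (simp add: CL_def)
qed

lemma CL_pair:
  assumes "CL S l n T V l' T' f" "CL S l n T V l'' T'' g" "V \<subseteq> topspace T"
  shows "CL S l n T V (pline l' l'') (prod_topology T' T'') (\<lambda>w. (f w, g w))"
  using assms
proof (induction n arbitrary: T V f g)
  case 0
  then show ?case by (simp add: CL_0 continuous_map_pairedI)
next
  case (Suc n)
  note sub = updom_subset[OF Suc.prems(3)]
  obtain h where h: "CL S l n (up S T) (updom S l T V) l' T' h"
    "\<And>x y t. Tr x y t \<in> updom S l T V \<Longrightarrow> l' (f x) (h (Tr x y t)) t = f (tline l x y t)"
    using CL_SucE[OF Suc.prems(1,3)] by metis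
  obtain k where k: "CL S l n (up S T) (updom S l T V) l'' T'' k"
    "\<And>x y t. Tr x y t \<in> updom S l T V \<Longrightarrow> l'' (g x) (k (Tr x y t)) t = g (tline l x y t)"
    using CL_SucE[OF Suc.prems(2,3)] by metis
  show ?case
    by (rule CL_SucI[OF Suc.IH[OF Suc.prems(1,2)[THEN CL_Suc_imp] Suc.prems(3)] Suc.IH[OF h(1) k(1) sub] Suc.prems(3)])
      (simp add: h(2) k(2) del: Tr_in_updom)
qed

text \<open>\<open>z\<close> plays the part of the zero direction, u + t z = u, so the constant map
  \<open>z\<close> is a difference quotient of \<open>g\<close>. Besides constants this covers
  functions of a parameter alone, which do not change along constant lines.\<close>

lemma CL_locally_const:
  assumes "continuous_map (subtopology T V) T' g" "V \<subseteq> topspace T" "z \<in> topspace T'"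
    and "\<And>x y t. Tr x y t \<in> updom S l T V \<Longrightarrow> g (tline l x y t) = g x"
    and "\<And>u t. u \<in> topspace T' \<Longrightarrow> t \<in> topspace S \<Longrightarrow> l' u z t = u"
  shows "CL S l n T V l' T' g"
  using assms(1,2,4)
proof (induction n arbitrary: T V g)
  case 0
  then show ?case by (simp add: CL_0)
next
  case (Suc n)
  show ?case
  proof (rule CL_SucI[OF _ _ Suc.prems(2)])
    show "CL S l n T V l' T' g" using Suc by blast
    show "CL S l n (up S T) (updom S l T V) l' T' (\<lambda>_. z)"
      by (rule Suc.IH) (use assms(3) updom_subset[OF Suc.prems(2)] in auto)
    fix x y t assume w: "Tr x y t \<in> updom S l T V"
    have "g x \<in> topspace T'"
      using w Suc.prems(2) continuous_map_topspaceD[OF Suc.prems(1), of x] by auto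
    then show "l' (g x) z t = g (tline l x y t)" using w Suc.prems(3) assms(5) by simp
  qed
qed

lemma CL_par: "V \<subseteq> topspace (up S' T) \<Longrightarrow> CL S l n (up S' T) V sline S' par"
  unfolding CL_def by (rule Cn_par)

abbreviation CV :: "'k topology \<Rightarrow> ('a \<Rightarrow> 'a \<Rightarrow> 'k::field \<Rightarrow> 'a) \<Rightarrow> nat \<Rightarrow> ('a, 'k) tower topology \<Rightarrow>
    ('a, 'k) tower set \<Rightarrow> ('k, 'e::ab_group_add) tvs \<Rightarrow> (('a, 'k) tower \<Rightarrow> 'e) \<Rightarrow> bool" where
  "CV S l n T V F \<equiv> CL S l n T V (vline F) (topo F)"

lemma CV_add:
  assumes "topological_vector_space S F" "CV S l n T V F f" "CV S l n T V F g" "V \<subseteq> topspace T"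
  shows "CV S l n T V F (\<lambda>w. f w + g w)"
proof -
  interpret F: topological_vector_space S F by fact
  have "CV S l n T V F (\<lambda>w. case (f w, g w) of (x, y) \<Rightarrow> x + y)"
    by (rule CL_linear[OF CL_pair[OF assms(2-4)] F.continuous_plus assms(4)])
      (auto simp: vline_def F.scal_add_right)
  then show ?thesis by simp
qed

lemma CV_minus:
  assumes "topological_vector_space S F" "CV S l n T V F f" "CV S l n T V F g" "V \<subseteq> topspace T"
  shows "CV S l n T V F (\<lambda>w. f w - g w)"
proof -
  interpret F: topological_vector_space S F by fact
  have c: "continuous_map (prod_topology (topo F) (topo F)) (topo F) (\<lambda>z. fst z - snd z)"
    by (intro F.continuous_map_minus continuous_map_fst continuous_map_snd)
  have "CV S l n T V F (\<lambda>w. fst (f w, g w) - snd (f w, g w))"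
    by (rule CL_linear[OF CL_pair[OF assms(2-4)] c assms(4)])
      (auto simp: vline_def F.scal_minus_right)
  then show ?thesis by simp
qed

lemma CV_const:
  assumes "topological_vector_space S F" "c \<in> topspace (topo F)" "V \<subseteq> topspace T"
  shows "CV S l n T V F (\<lambda>_. c)"
proof -
  interpret F: topological_vector_space S F by fact
  show ?thesis
    by (rule CL_locally_const[where z=0]) (auto simp: assms F.zero_mem vline_def F.scal_zero_right)
qed

section \<open>Lines as maps\<close>

abbreviation line_map :: "('a \<Rightarrow> 'a \<Rightarrow> 'k::field \<Rightarrow> 'a) \<Rightarrow> ('a, 'k) tower \<Rightarrow> ('a, 'k) tower" where
  "line_map l w \<equiv> tline l (base w) (dir w) (par w)"

text \<open>
  The third condition says that \<open>x' + t' y + t y' + s t' y'\<close> is the difference quotient of the map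
  \<open>(x, y, t) \<mapsto> x + t y\<close>. It is phrased in terms of lines only.
\<close>

definition good :: "'k topology \<Rightarrow> ('a \<Rightarrow> 'a \<Rightarrow> 'k::field \<Rightarrow> 'a) \<Rightarrow> ('a, 'k) tower topology \<Rightarrow> bool" where
  "good S l T \<longleftrightarrow> continuous_map (up S T) T (line_map l) \<and>
     (\<forall>x\<in>topspace T. \<forall>y\<in>topspace T. tline l x y 0 = x) \<and>
     (\<forall>x\<in>topspace T. \<forall>y\<in>topspace T. \<forall>x'\<in>topspace T. \<forall>y'\<in>topspace T.
      \<forall>t\<in>topspace S. \<forall>t'\<in>topspace S. \<forall>s\<in>topspace S.
        tline l (tline l x y t) (tline l (tline l x' y' t) (tline l y y' s) t') s =
        tline l (tline l x x' s) (tline l y y' s) (t + s * t'))"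

lemma good_continuous: "good S l T \<Longrightarrow> continuous_map (up S T) T (line_map l)"
  by (simp add: good_def)

lemma good_zero: "good S l T \<Longrightarrow> x \<in> topspace T \<Longrightarrow> y \<in> topspace T \<Longrightarrow> tline l x y 0 = x"
  by (simp add: good_def)

lemma good_identity: "good S l T \<Longrightarrow> x \<in> topspace T \<Longrightarrow> y \<in> topspace T \<Longrightarrow> x' \<in> topspace T \<Longrightarrow>
    y' \<in> topspace T \<Longrightarrow> t \<in> topspace S \<Longrightarrow> t' \<in> topspace S \<Longrightarrow> s \<in> topspace S \<Longrightarrow>
    tline l (tline l x y t) (tline l (tline l x' y' t) (tline l y y' s) t') s =
        tline l (tline l x x' s) (tline l y y' s) (t + s * t')"
  by (simp add: good_def)

lemma good_continuous_map:
  assumes "good S l T" "continuous_map X T a" "continuous_map X T b" "continuous_map X S c"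
  shows "continuous_map X T (\<lambda>x. tline l (a x) (b x) (c x))"
  using continuous_map_comp[OF good_continuous[OF assms(1)] continuous_map_Tr[OF assms(2-4)]] by simp

lemmas continuous_map_up_up =
  continuous_map_comp[OF continuous_map_base continuous_map_base]
  continuous_map_comp[OF continuous_map_dir continuous_map_base]
  continuous_map_comp[OF continuous_map_par continuous_map_base]
  continuous_map_comp[OF continuous_map_base continuous_map_dir]
  continuous_map_comp[OF continuous_map_dir continuous_map_dir]
  continuous_map_comp[OF continuous_map_par continuous_map_dir]

text \<open>Keeps the hypothesis alive in inductions that climb the tower. For the scalar entries
  the identity is a computation in the field.\<close>

lemma good_up:
  assumes "topological_field S" and g: "good S l T"
  shows "good S l (up S T)"
proof -
  interpret S: topological_field S by fact
  let ?X = "up S (up S T)"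
  have c: "continuous_map ?X S (\<lambda>w. par (base w) + par w * par (dir w))"
    by (intro continuous_map_comp2[OF S.continuous_add] continuous_map_comp2[OF S.continuous_mult]
        continuous_map_up_up continuous_map_par)
  have "continuous_map ?X (up S T) (\<lambda>w. Tr (tline l (base (base w)) (base (dir w)) (par w))
     (tline l (dir (base w)) (dir (dir w)) (par w)) (par (base w) + par w * par (dir w)))"
    by (intro continuous_map_Tr good_continuous_map[OF g] c
        continuous_map_up_up continuous_map_par)
  then have "continuous_map ?X (up S T) (line_map l)"
    by (rule continuous_map_eq) (auto simp: topspace_up)
  then show ?thesis
    unfolding good_def
    by (auto simp: topspace_up good_zero[OF g] good_identity[OF g] algebra_simps)
qed

lemma good_ptsI:
  assumes "continuous_map (prod_topology T (prod_topology T S)) T (\<lambda>z. l (fst z) (fst (snd z)) (snd (snd z)))"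
    and "\<And>x y. x \<in> topspace T \<Longrightarrow> y \<in> topspace T \<Longrightarrow> l x y 0 = x"
    and "\<And>x y x' y' t t' s. x \<in> topspace T \<Longrightarrow> y \<in> topspace T \<Longrightarrow> x' \<in> topspace T \<Longrightarrow> y' \<in> topspace T \<Longrightarrow>
      t \<in> topspace S \<Longrightarrow> t' \<in> topspace S \<Longrightarrow> s \<in> topspace S \<Longrightarrow>
      l (l x y t) (l (l x' y' t) (l y y' s) t') s = l (l x x' s) (l y y' s) (t + s * t')"
  shows "good S l (pts T)"
proof -
  have "continuous_map (up S (pts T)) (prod_topology T (prod_topology T S)) (\<lambda>w. (pt (base w), pt (dir w), par w))"
    by (intro continuous_map_pairedI continuous_map_comp[OF continuous_map_pt]
        continuous_map_base continuous_map_dir continuous_map_par)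
  from continuous_map_comp[OF assms(1) this]
  have "continuous_map (up S (pts T)) (pts T) (\<lambda>w. Pt (l (pt (base w)) (pt (dir w)) (par w)))"
    by (simp add: continuous_map_Pt)
  then have "continuous_map (up S (pts T)) (pts T) (line_map l)"
    by (rule continuous_map_eq) (auto simp: topspace_up)
  then show ?thesis
    unfolding good_def using assms(2,3) by auto
qed

lemma (in topological_vector_space) vline_identity:
  assumes "x \<in> topspace (topo E)" "y \<in> topspace (topo E)" "x' \<in> topspace (topo E)" "y' \<in> topspace (topo E)"
    and "t \<in> topspace S" "t' \<in> topspace S" "s \<in> topspace S"
  shows "vline E (vline E x y t) (vline E (vline E x' y' t) (vline E y y' s) t') s =
    vline E (vline E x x' s) (vline E y y' s) (t + s * t')"
  using assms
  by (simp add: vline_def scal_add_right scal_add_left scal_scal scal_closed plus_closed add_closed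
      mult_closed algebra_simps)

lemma (in topological_vector_space) continuous_map_vline:
  assumes "continuous_map X (topo E) f" "continuous_map X (topo E) g" "continuous_map X S c"
  shows "continuous_map X (topo E) (\<lambda>x. vline E (f x) (g x) (c x))"
  unfolding vline_def using assms by (intro continuous_map_plus continuous_map_scal)

lemma (in topological_vector_space) good_vline: "good S (vline E) (pts (topo E))"
proof (rule good_ptsI[OF _ _ vline_identity])
  show "continuous_map (prod_topology (topo E) (prod_topology (topo E) S)) (topo E)
     (\<lambda>z. vline E (fst z) (fst (snd z)) (snd (snd z)))"
    by (intro continuous_map_vline continuous_map_fst continuous_map_comp[OF continuous_map_fst continuous_map_snd]
        continuous_map_comp[OF continuous_map_snd continuous_map_snd])
qed (auto simp: vline_def scal_zero_left)

text \<open>Constant lines satisfy the conditions trivially, so the parameter space \<open>A\<close>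
  may be any topological space, without algebraic structure.\<close>

lemma (in topological_vector_space) good_param: "good S (pline cline (vline E)) (pts (prod_topology A (topo E)))"
proof (rule good_ptsI)
  let ?X = "prod_topology (prod_topology A (topo E)) (prod_topology (prod_topology A (topo E)) S)"
  show "continuous_map ?X (prod_topology A (topo E))
     (\<lambda>z. pline cline (vline E) (fst z) (fst (snd z)) (snd (snd z)))"
    unfolding pline_def cline_def
    by (intro continuous_map_pairedI continuous_map_vline continuous_map_comp[OF continuous_map_fst continuous_map_fst]
        continuous_map_comp[OF continuous_map_snd continuous_map_fst]
        continuous_map_comp[OF continuous_map_snd continuous_map_comp[OF continuous_map_fst continuous_map_snd]]
        continuous_map_comp[OF continuous_map_snd continuous_map_snd])
qed (auto simp: vline_identity cline_def, auto simp: vline_def scal_zero_left)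

text \<open>The third condition of \<open>good\<close> exhibits a lift of the line map that is again
  built from lines, which makes an induction on the order possible. The rule is needed to
  differentiate x \<mapsto> g (x + t y), as in the product rule.\<close>

lemma Cn_line:
  assumes "topological_field S" "good S l T" "V \<subseteq> topspace (up S T)"
  shows "Cn S l l n (up S T) V T (line_map l)"
proof -
  have "Cn S l l n (up S T) (topspace (up S T)) T (line_map l)"
    using assms(2)
  proof (induction n arbitrary: T)
    case 0
    then show ?case using good_continuous by auto
  next
    case (Suc n)
    note g = Suc.prems
    let ?X = "up S T" let ?Y = "up S (up S T)" let ?V = "updom S l (up S T) (topspace (up S T))"
    have sub: "?V \<subseteq> topspace ?Y" by (simp add: updom_subset)
    have base: "Cn S l l n ?Y ?V ?X base" and dir: "Cn S l l n ?Y ?V ?X dir"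
      and par: "Cn S l sline n ?Y ?V (pts S) (\<lambda>w. Pt (par w))"
      by (rule Cn_base[OF sub] Cn_dir[OF sub] Cn_par[OF sub])+
    have bm: "base w \<in> topspace ?X" and dm: "dir w \<in> topspace ?X" if "w \<in> ?V" for w
      using subsetD[OF sub that] by (auto elim!: topspace_upE)
    have bb: "Cn S l l n ?Y ?V T (\<lambda>w. base (base w))"
      by (rule Cn_comp[OF base Cn_base[OF order_refl] bm sub])
    have db: "Cn S l l n ?Y ?V T (\<lambda>w. dir (base w))"
      by (rule Cn_comp[OF base Cn_dir[OF order_refl] bm sub])
    have bd: "Cn S l l n ?Y ?V T (\<lambda>w. base (dir w))"
      by (rule Cn_comp[OF dir Cn_base[OF order_refl] dm sub])
    have dd: "Cn S l l n ?Y ?V T (\<lambda>w. dir (dir w))"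
      by (rule Cn_comp[OF dir Cn_dir[OF order_refl] dm sub])
    have pb: "Cn S l sline n ?Y ?V (pts S) (\<lambda>w. Pt (par (base w)))"
      by (rule Cn_comp[OF base Cn_par[OF order_refl] bm sub])
    have pd: "Cn S l sline n ?Y ?V (pts S) (\<lambda>w. Pt (par (dir w)))"
      by (rule Cn_comp[OF dir Cn_par[OF order_refl] dm sub])
    have comb: "Cn S l l n ?Y ?V T (\<lambda>w. tline l (a w) (b w) (c w))"
      if "Cn S l l n ?Y ?V T a" "Cn S l l n ?Y ?V T b" "Cn S l sline n ?Y ?V (pts S) (\<lambda>w. Pt (c w))" for a b c
    proof -
      note tr = Cn_Tr[OF that sub]
      have "Cn S l l n ?Y ?V T (\<lambda>w. line_map l (Tr (a w) (b w) (c w)))"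
        by (rule Cn_comp[OF tr Suc.IH[OF g] Cn_topspaceD[OF tr sub] sub])
      then show ?thesis by simp
    qed
    \<comment> \<open>For w = ((x, y, t), (x', y', t'), s) the direction is x' + t y' + t' (y + s
      y').\<close>
    let ?h = "\<lambda>w. Tr (tline l (base (base w)) (dir (base w)) (par (base w)))
         (tline l (tline l (base (dir w)) (dir (dir w)) (par (base w)))
            (tline l (dir (base w)) (dir (dir w)) (par w)) (par (dir w))) (par w)"
    have "Cn S l l n ?Y ?V ?X ?h"
      by (intro Cn_Tr comb bb db bd dd pb pd par sub)
    moreover have "is_lift S l l ?X (topspace ?X) (line_map l) ?h"
      unfolding is_lift_def
      by (auto simp: topspace_up good_identity[OF g])
    ultimately show ?case using good_continuous[OF g] by auto
  qed
  then show ?thesis using Cn_subset assms(3) by blast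
qed

lemma CL_base:
  assumes "CL S l n T V l' T' g" "V \<subseteq> topspace T"
  shows "CL S l n (up S T) (updom S l T V) l' T' (\<lambda>w. g (base w))"
  by (rule CL_comp[OF Cn_base assms(1) _ updom_subset]) (use assms(2) updom_subset[OF assms(2)] in \<open>auto elim: updomE\<close>)

lemma CL_line:
  assumes "topological_field S" "good S l T" "CL S l n T V l' T' g" "V \<subseteq> topspace T"
  shows "CL S l n (up S T) (updom S l T V) l' T' (\<lambda>w. g (line_map l w))"
  by (rule CL_comp[OF Cn_line assms(3) _ updom_subset]) (use assms updom_subset[OF assms(4)] in \<open>auto elim: updomE\<close>)

text \<open>Product rule in the form (p f)^[1] = p(x + t y) f^[1] + p^[1] f(x). Evaluating
  \<open>p\<close> at the end of the line absorbs the term t p^[1] f^[1]. The factor takes values in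
  the larger field \<open>K\<close> while differentiation is over \<open>S\<close>; this is what the
  \<open>TK\<close>-scalar multiplication on the function spaces calls for.\<close>

lemma CV_scal:
  assumes "extends K S" "topological_vector_space K F" "good S l T"
    "CL S l n T V sline K p" "CV S l n T V F f" "V \<subseteq> topspace T"
  shows "CV S l n T V F (\<lambda>w. scal F (p w) (f w))"
  using assms(3-6)
proof (induction n arbitrary: T V p f)
  case 0
  interpret F: topological_vector_space K F by fact
  show ?case using 0 by (simp add: CL_0 F.continuous_map_scal)
next
  case (Suc n)
  interpret F: topological_vector_space K F by fact
  have FS: "topological_vector_space S F" using assms(1,2) by (rule tvs_restrict)
  have S: "topological_field S" and SK: "topspace S \<subseteq> topspace K" using assms(1) by (auto simp: extends_def)
  note sub = updom_subset[OF Suc.prems(4)]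
  let ?V = "updom S l T V"
  obtain q where q: "CL S l n (up S T) ?V sline K q"
    "\<And>x y t. Tr x y t \<in> ?V \<Longrightarrow> sline (p x) (q (Tr x y t)) t = p (tline l x y t)"
    using CL_SucE[OF Suc.prems(2,4)] by metis
  obtain h where h: "CV S l n (up S T) ?V F h"
    "\<And>x y t. Tr x y t \<in> ?V \<Longrightarrow> vline F (f x) (h (Tr x y t)) t = f (tline l x y t)"
    using CL_SucE[OF Suc.prems(3,4)] by metis
  note p = CL_Suc_imp[OF Suc.prems(2)] and f = CL_Suc_imp[OF Suc.prems(3)]
  note gu = good_up[OF S Suc.prems(1)]
  have "CV S l n (up S T) ?V F (\<lambda>w. scal F (p (line_map l w)) (h w) + scal F (q w) (f (base w)))"
    by (intro CV_add[OF FS] Suc.IH[OF gu] CL_line[OF S Suc.prems(1) p] CL_base[OF f] h(1) q(1) sub Suc.prems(4))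
  then show ?case
  proof (rule CL_SucI[OF Suc.IH[OF Suc.prems(1) p f Suc.prems(4)] _ Suc.prems(4)])
    fix x y t assume w: "Tr x y t \<in> ?V"
    have mem: "p x \<in> topspace K" "f x \<in> topspace (topo F)" "q (Tr x y t) \<in> topspace K"
        "h (Tr x y t) \<in> topspace (topo F)" "t \<in> topspace K"
      using CL_topspaceD[OF p Suc.prems(4), of x] CL_topspaceD[OF f Suc.prems(4), of x]
        CL_topspaceD[OF q(1) sub w] CL_topspaceD[OF h(1) sub w] w SK by auto
    show "vline F (scal F (p x) (f x)) (scal F (p (line_map l (Tr x y t))) (h (Tr x y t)) +
        scal F (q (Tr x y t)) (f (base (Tr x y t)))) t = scal F (p (tline l x y t)) (f (tline l x y t))"
      using mem q(2)[OF w, symmetric] h(2)[OF w, symmetric]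
      by (simp add: vline_def sline_def F.scal_add_right F.scal_add_left F.scal_scal F.scal_closed
          F.plus_closed F.add_closed F.mult_closed algebra_simps)
  qed
qed

text \<open>The quotient of 1/p is - p^[1] / (p(x) p(x + t y)), which is of class C^n by the product
  rule and the induction hypothesis.\<close>

lemma CL_inverse:
  assumes "topological_field S" "good S l T" "CL S l n T V sline S p" "V \<subseteq> topspace T"
    and "\<And>w. w \<in> V \<Longrightarrow> p w \<noteq> 0"
  shows "CL S l n T V sline S (\<lambda>w. inverse (p w))"
  using assms(2-5)
proof (induction n arbitrary: T V p)
  case 0
  interpret S: topological_field S by fact
  have "continuous_map (subtopology T V) (subtopology S (topspace S - {0})) p"
    using 0 continuous_map_topspaceD[of "subtopology T V" S p] by (auto simp: CL_0 continuous_map_in_subtopology)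
  then show ?case using continuous_map_comp[OF S.continuous_inverse] by (simp add: CL_0)
next
  case (Suc n)
  interpret S: topological_field S by fact
  have S: "topological_vector_space S (kvs S)" "extends S S"
    using assms(1) by (auto intro: tvs_kvs extends_refl)
  note sub = updom_subset[OF Suc.prems(3)]
  let ?V = "updom S l T V"
  obtain q where q: "CL S l n (up S T) ?V sline S q"
    "\<And>x y t. Tr x y t \<in> ?V \<Longrightarrow> sline (p x) (q (Tr x y t)) t = p (tline l x y t)"
    using CL_SucE[OF Suc.prems(2,3)] by metis
  note p = CL_Suc_imp[OF Suc.prems(2)]
  note gu = good_up[OF assms(1) Suc.prems(1)]
  have mult: "CL S l n (up S T) ?V sline S (\<lambda>w. a w * b w)"
    if "CL S l n (up S T) ?V sline S a" "CL S l n (up S T) ?V sline S b" for a b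
    using CV_scal[OF S(2,1) gu that(1) _ sub, of b] that(2) by simp
  have m1: "CL S l n (up S T) ?V sline S (\<lambda>w. - 1)"
    using CV_const[OF S(1) _ sub, of "- 1" l n] S.uminus_closed[OF S.one_closed] by simp
  have ne: "p (base w) \<noteq> 0" "p (line_map l w) \<noteq> 0" if "w \<in> ?V" for w
    using that Suc.prems(4) by (auto elim!: updomE)
  have "CL S l n (up S T) ?V sline S (\<lambda>w. - 1 * (q w * (inverse (p (base w)) * inverse (p (line_map l w)))))"
    by (intro mult m1 q(1) Suc.IH[OF gu] CL_base CL_line[OF assms(1) Suc.prems(1)] p sub Suc.prems(3) ne)
  then show ?case
  proof (rule CL_SucI[rotated])
    show "CL S l n T V sline S (\<lambda>w. inverse (p w))"
      by (rule Suc.IH[OF Suc.prems(1) p Suc.prems(3,4)])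
    show "V \<subseteq> topspace T" by fact
    fix x y t assume w: "Tr x y t \<in> ?V"
    let ?a = "p x" and ?b = "p (tline l x y t)" and ?q = "q (Tr x y t)"
    have nz: "?a \<noteq> 0" "?b \<noteq> 0" using w Suc.prems(4) by auto
    have "inverse ?a + t * (- 1 * (?q * (inverse ?a * inverse ?b))) = (?b - t * ?q) * (inverse ?a * inverse ?b)"
      using nz by (simp add: field_simps)
    also have "?b - t * ?q = ?a" using q(2)[OF w] by (simp add: sline_def algebra_simps)
    also have "?a * (inverse ?a * inverse ?b) = inverse ?b" using nz by simp
    finally show "sline (inverse ?a) (- 1 * (?q * (inverse (p (base (Tr x y t))) *
        inverse (p (line_map l (Tr x y t)))))) t = inverse ?b"
      by (simp add: sline_def)
  qed
qed

section \<open>Uniqueness of difference quotients and locality\<close>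

lemma openin_updom:
  assumes "good S l T" "openin T V"
  shows "openin (up S T) (updom S l T V)"
proof -
  have "updom S l T V = {w \<in> topspace (up S T). base w \<in> V} \<inter> {w \<in> topspace (up S T). line_map l w \<in> V}"
    using openin_subset[OF assms(2)] by (auto simp: topspace_up updom_def)
  then show ?thesis
    using assms openin_continuous_map_preimage_in[OF continuous_map_base assms(2)]
      openin_continuous_map_preimage_in[OF good_continuous assms(2)] by auto
qed

text \<open>Only t = 0 is in question. As 0 is not isolated in the field, each neighbourhood of (x,
  y, 0) contains points (x, y, s) with s \<noteq> 0, where the two maps agree; a Hausdorff target
  then forces equality.\<close>

lemma difference_quotient_unique:
  assumes S: "topological_field S" and "good S l T" "openin T V" "Hausdorff_space Y"
    and c: "continuous_map (subtopology (up S T) (updom S l T V)) Y h"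
      "continuous_map (subtopology (up S T) (updom S l T V)) Y k"
    and eq: "\<And>x y t. Tr x y t \<in> updom S l T V \<Longrightarrow> t \<noteq> 0 \<Longrightarrow> h (Tr x y t) = k (Tr x y t)"
    and w: "w \<in> updom S l T V"
  shows "h w = k w"
proof (rule ccontr)
  assume ne: "h w \<noteq> k w"
  interpret S: topological_field S by fact
  let ?V = "updom S l T V"
  let ?X = "subtopology (up S T) ?V"
  have op: "openin (up S T) ?V" using assms(2,3) by (rule openin_updom)
  then have X: "topspace ?X = ?V" by (simp add: inf.absorb2 openin_subset)
  obtain x y t where xyt: "w = Tr x y t" "x \<in> topspace T" "y \<in> topspace T"
    using w openin_subset[OF assms(3)] by (auto elim!: updomE)
  with ne eq w have "t = 0" by blast
  have "h w \<in> topspace Y" "k w \<in> topspace Y"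
    using c[THEN continuous_map_topspaceD, of w] w X by auto
  with ne assms(4) obtain A B where AB: "openin Y A" "openin Y B" "h w \<in> A" "k w \<in> B" "A \<inter> B = {}"
    unfolding Hausdorff_space_def disjnt_def by metis
  let ?N = "{z \<in> topspace ?X. h z \<in> A} \<inter> {z \<in> topspace ?X. k z \<in> B}"
  have "openin ?X ?N"
    by (intro openin_Int openin_continuous_map_preimage_in[OF c(1) AB(1)] openin_continuous_map_preimage_in[OF c(2) AB(2)])
  then have N: "openin (up S T) ?N" using op by (rule openin_trans_full)
  have "continuous_map S (up S T) (\<lambda>t. Tr x y t)"
    by (rule continuous_map_Tr) (use xyt in auto)
  from openin_continuous_map_preimage_in[OF this N]
  have "openin S {t \<in> topspace S. Tr x y t \<in> ?N}" .
  moreover have "0 \<in> {t \<in> topspace S. Tr x y t \<in> ?N}"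
    using w xyt(1) \<open>t = 0\<close> AB S.zero_closed X by auto
  ultimately obtain s where s: "s \<noteq> 0" "Tr x y s \<in> ?N"
    using S.zero_not_isolated by blast
  then have "h (Tr x y s) = k (Tr x y s)" using eq X by blast
  with s(2) AB(5) show False by auto
qed

lemma continuous_map_local:
  assumes "\<And>x. x \<in> V \<Longrightarrow> \<exists>W. openin T W \<and> x \<in> W \<and> W \<subseteq> V \<and> continuous_map (subtopology T W) Y g"
  shows "continuous_map (subtopology T V) Y g"
  unfolding continuous_map_def
proof (intro conjI allI impI funcsetI)
  fix x assume "x \<in> topspace (subtopology T V)"
  then obtain W where "openin T W" "x \<in> W" "W \<subseteq> V" "continuous_map (subtopology T W) Y g" "x \<in> topspace T"
    using assms[of x] by auto
  then show "g x \<in> topspace Y" using continuous_map_topspaceD[of "subtopology T W" Y g x] by simp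
next
  fix O' assume O': "openin Y O'"
  show "openin (subtopology T V) {x \<in> topspace (subtopology T V). g x \<in> O'}"
  proof (subst openin_subopen, intro ballI)
    fix x assume x: "x \<in> {x \<in> topspace (subtopology T V). g x \<in> O'}"
    then obtain W where W: "openin T W" "x \<in> W" "W \<subseteq> V" "continuous_map (subtopology T W) Y g"
      using assms[of x] by auto
    let ?N = "{z \<in> topspace (subtopology T W). g z \<in> O'}"
    have "openin T ?N"
      using openin_continuous_map_preimage_in[OF W(4) O'] W(1) by (rule openin_trans_full)
    then have "openin (subtopology T V) (?N \<inter> V)" by (auto simp: openin_subtopology)
    moreover have "x \<in> ?N \<inter> V" "?N \<inter> V \<subseteq> {x \<in> topspace (subtopology T V). g x \<in> O'}"
      using x W by auto
    ultimately show "\<exists>N. openin (subtopology T V) N \<and> x \<in> N \<and> N \<subseteq> {x \<in> topspace (subtopology T V). g x \<in> O'}"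
      by blast
  qed
qed

text \<open>V^[1] is not covered by the sets W^[1] of small W, because x and x + t y may be far
  apart. At t = 0, however, the line does not leave x, so (x, y, 0) lies in the domain over any
  neighbourhood of x and a local quotient is available; where t \<noteq> 0 the quotient is explicit
  and C^n by the rules for products and inverses.\<close>

lemma CV_local:
  assumes S: "topological_field S" and F: "topological_vector_space S F" and "good S l T"
    and "\<And>x. x \<in> V \<Longrightarrow> \<exists>W. openin T W \<and> x \<in> W \<and> W \<subseteq> V \<and> CV S l n T W F g"
  shows "CV S l n T V F g"
  using assms(3,4)
proof (induction n arbitrary: T V g)
  case 0
  then show ?case by (simp add: CL_0 continuous_map_local)
next
  case (Suc n)
  interpret F: topological_vector_space S F by fact
  have gT: "good S l T" by (rule Suc.prems)
  have gu: "good S l (up S T)" by (rule good_up[OF S gT])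
  define Q where "Q x W h \<longleftrightarrow> openin T W \<and> x \<in> W \<and> W \<subseteq> V \<and> CV S l n T W F g \<and> CV S l n (up S T) (updom S l T W) F h \<and>
      (\<forall>x y t. Tr x y t \<in> updom S l T W \<longrightarrow> vline F (g x) (h (Tr x y t)) t = g (tline l x y t))" for x W h
  have "\<exists>W h. Q x W h" if "x \<in> V" for x
    unfolding Q_def
  proof -
    from Suc.prems(2)[OF that] obtain W where W: "openin T W" "x \<in> W" "W \<subseteq> V" "CV S l (Suc n) T W F g" by blast
    obtain h where "CV S l n (up S T) (updom S l T W) F h"
      "\<And>x y t. Tr x y t \<in> updom S l T W \<Longrightarrow> vline F (g x) (h (Tr x y t)) t = g (tline l x y t)"
      using CL_SucE[OF W(4) openin_subset[OF W(1)]] by metis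
    with CL_Suc_imp[OF W(4)] W
    show "\<exists>W h. openin T W \<and> x \<in> W \<and> W \<subseteq> V \<and> CV S l n T W F g \<and> CV S l n (up S T) (updom S l T W) F h \<and>
      (\<forall>x y t. Tr x y t \<in> updom S l T W \<longrightarrow> vline F (g x) (h (Tr x y t)) t = g (tline l x y t))"
      by (intro exI[of _ W] exI[of _ h]) (simp del: Tr_in_updom)
  qed
  then obtain W h where "\<And>x. x \<in> V \<Longrightarrow> Q x (W x) (h x)" by metis
  then have W: "\<And>x. x \<in> V \<Longrightarrow> openin T (W x)" "\<And>x. x \<in> V \<Longrightarrow> x \<in> W x" "\<And>x. x \<in> V \<Longrightarrow> W x \<subseteq> V"
    "\<And>x. x \<in> V \<Longrightarrow> CV S l n T (W x) F g" "\<And>x. x \<in> V \<Longrightarrow> CV S l n (up S T) (updom S l T (W x)) F (h x)"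
    "\<And>z x y t. z \<in> V \<Longrightarrow> Tr x y t \<in> updom S l T (W z) \<Longrightarrow> vline F (g x) (h z (Tr x y t)) t = g (tline l x y t)"
    unfolding Q_def by blast+
  have opV: "openin T V" using W(1-3) by (subst openin_subopen) blast
  have VT: "V \<subseteq> topspace T" by (rule openin_subset[OF opV])
  note sub = updom_subset[OF VT]
  let ?V = "updom S l T V"
  have g: "CV S l n T V F g"
  proof (rule Suc.IH[OF gT])
    fix x assume "x \<in> V"
    with W(1-4) show "\<exists>W. openin T W \<and> x \<in> W \<and> W \<subseteq> V \<and> CV S l n T W F g"
      by (intro exI[of _ "W x"]) simp
  qed
  have gmem: "g x \<in> topspace (topo F)" if "x \<in> V" for x using CL_topspaceD[OF g VT that] .
  define q where "q w = scal F (inverse (par w)) (g (line_map l w) - g (base w))" for w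
  \<comment> \<open>Local quotients are consulted only at t = 0, over the neighbourhood chosen for
    the base point. \<open>kh\<close> shows that the choice is immaterial.\<close>
  define k where "k w = (if par w \<noteq> 0 then q w else h (base w) w)" for w
  have hmem: "h z w \<in> topspace (topo F)" if "z \<in> V" "w \<in> updom S l T (W z)" for z w
    using CL_topspaceD[OF W(5)[OF that(1)] updom_subset that(2)] openin_subset[OF W(1)[OF that(1)]] by blast
  have hq: "h z (Tr x y t) = q (Tr x y t)" if "z \<in> V" "Tr x y t \<in> updom S l T (W z)" "t \<noteq> 0" for x y z t
  proof -
    have "g (tline l x y t) - g x = scal F t (h z (Tr x y t))"
      using W(6)[OF that(1,2)] by (simp add: vline_def algebra_simps)
    then show ?thesis using F.scal_inverse_cancel(2)[OF _ that(3) hmem[OF that(1,2)]] that(2) by (simp add: q_def)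
  qed
  have kh: "k w = h z w" if z: "z \<in> V" and w: "w \<in> updom S l T (W z)" for z w
  proof -
    obtain x y t where xyt: "w = Tr x y t" "x \<in> W z" "tline l x y t \<in> W z" "y \<in> topspace T" "t \<in> topspace S"
      using w by (rule updomE)
    show ?thesis
    proof (cases "t = 0")
      case False
      then show ?thesis using hq[OF z w[unfolded xyt(1)]] xyt(1) by (simp add: k_def)
    next
      case True
      have x: "x \<in> V" using xyt z W(3) by blast
      \<comment> \<open>At t = 0 both ends of the line are x, so w lies in the domain over the
        intersection. There the two local quotients are continuous and given by the same formula for
        nonzero scalars.\<close>
      let ?O = "W z \<inter> W x"
      have O: "openin T ?O" using W(1) z x by auto
      have wO: "w \<in> updom S l T ?O"
        using xyt True x z W(2) good_zero[OF gT] VT by (auto simp: subset_iff)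
      have s: "updom S l T ?O \<subseteq> updom S l T (W z)" "updom S l T ?O \<subseteq> updom S l T (W x)"
        by (simp_all add: updom_mono)
      have "h z w = h x w"
      proof (rule difference_quotient_unique[OF S gT O F.Hausdorff_space _ _ _ wO])
        show "continuous_map (subtopology (up S T) (updom S l T ?O)) (topo F) (h z)"
          using CL_continuous[OF CL_subset[OF W(5)[OF z] s(1)]] .
        show "continuous_map (subtopology (up S T) (updom S l T ?O)) (topo F) (h x)"
          using CL_continuous[OF CL_subset[OF W(5)[OF x] s(2)]] .
        show "h z (Tr x' y' t') = h x (Tr x' y' t')" if "Tr x' y' t' \<in> updom S l T ?O" "t' \<noteq> 0" for x' y' t'
          using hq[OF z subsetD[OF s(1) that(1)] that(2)] hq[OF x subsetD[OF s(2) that(1)] that(2)] by simp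
      qed
      then show ?thesis using xyt(1) True by (simp add: k_def)
    qed
  qed
  have "CV S l n (up S T) ?V F k"
  proof (rule Suc.IH[OF gu])
    fix w assume w: "w \<in> ?V"
    then obtain x y t where xyt: "w = Tr x y t" "x \<in> V" "tline l x y t \<in> V" "y \<in> topspace T" "t \<in> topspace S"
      by (rule updomE)
    show "\<exists>N. openin (up S T) N \<and> w \<in> N \<and> N \<subseteq> ?V \<and> CV S l n (up S T) N F k"
    proof (cases "t = 0")
      case True
      have "w \<in> updom S l T (W x)"
        using xyt True W(2)[OF xyt(2)] good_zero[OF gT] VT by auto
      moreover have "CV S l n (up S T) (updom S l T (W x)) F k"
        using W(5)[OF xyt(2)] by (rule CL_cong) (simp add: kh[OF xyt(2)])
      ultimately show ?thesis
        using openin_updom[OF gT W(1)[OF xyt(2)]] updom_mono[OF W(3)[OF xyt(2)]] by blast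
    next
      case False
      \<comment> \<open>The points with nonzero scalar form an open set since {0} is closed in the
        Hausdorff field.\<close>
      let ?N = "?V \<inter> {w \<in> topspace (up S T). par w \<in> topspace S - {0}}"
      have "openin S (topspace S - {0})"
        by (metis F.Hausdorff F.zero_closed closedin_Hausdorff_singleton closedin_def)
      then have op: "openin (up S T) ?N"
        by (intro openin_Int openin_updom[OF gT opV] openin_continuous_map_preimage_in[OF continuous_map_par])
      have wN: "w \<in> ?N" using w xyt False VT by auto
      have N: "?N \<subseteq> topspace (up S T)" "?N \<subseteq> ?V" by auto
      have "CV S l n (up S T) ?N F q"
        unfolding q_def
      proof (intro CV_scal[OF extends_refl[OF S] F gu] CL_inverse[OF S gu] CL_par CV_minus[OF F] N)
        show "CV S l n (up S T) ?N F (\<lambda>w. g (line_map l w))"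
          using CL_subset[OF CL_line[OF S gT g VT] N(2)] .
        show "CV S l n (up S T) ?N F (\<lambda>w. g (base w))"
          using CL_subset[OF CL_base[OF g VT] N(2)] .
      qed auto
      then have "CV S l n (up S T) ?N F k" by (rule CL_cong) (simp add: k_def)
      then show ?thesis using op wN N by blast
    qed
  qed
  then show ?case
  proof (rule CL_SucI[OF g _ VT])
    fix x y t assume w: "Tr x y t \<in> ?V"
    then have x: "x \<in> V" "tline l x y t \<in> V" by auto
    show "vline F (g x) (k (Tr x y t)) t = g (tline l x y t)"
    proof (cases "t = 0")
      case True
      have "Tr x y t \<in> updom S l T (W x)"
        using w True W(2)[OF x(1)] good_zero[OF gT] VT by auto
      then show ?thesis using kh[OF x(1)] W(6)[OF x(1)] by (simp del: Tr_in_updom)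
    next
      case False
      then show ?thesis
        using w by (simp add: k_def q_def vline_def F.scal_inverse_cancel F.minus_closed gmem)
    qed
  qed
qed

section \<open>Change of the ground field\<close>

text \<open>The lift over \<open>TK\<close> also serves over \<open>TF\<close>, but its scalar entry
  must become continuous for the topology of \<open>TF\<close>, which may be finer than the induced
  one. That entry is just the scalar of the argument, so the lift is reassembled with
  \<open>par w\<close> taken from the domain.\<close>

lemma Cn_restrict_scalars:
  assumes "extends TK TF" "Cn TK l l' n T V T' g" "V \<subseteq> topspace T"
  shows "Cn TF l l' n T V T' g"
  using assms(2,3)
proof (induction n arbitrary: T V T' g)
  case 0
  then show ?case by simp
next
  case (Suc n)
  have c: "continuous_map TF TK (\<lambda>a. a)" and s: "topspace TF \<subseteq> topspace TK"
    using assms(1) by (auto simp: extends_def)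
  let ?V = "updom TF l T V"
  obtain h where h: "is_lift TK l l' T V g h" "Cn TK l l' n (up TK T) (updom TK l T V) (up TK T') h"
    using Suc.prems(1) by auto
  have VV: "?V \<subseteq> updom TK l T V" using s by (auto simp: updom_def)
  note sub = updom_subset[OF Suc.prems(2)]
  have lift: "is_lift TF l l' T V g h"
    using h(1) VV unfolding is_lift_def by blast
  have "continuous_map (up TF T) (up TK T) (\<lambda>w. Tr (base w) (dir w) (par w))"
    by (intro continuous_map_Tr continuous_map_base continuous_map_dir continuous_map_comp[OF c continuous_map_par])
  then have "continuous_map (up TF T) (up TK T) (\<lambda>w. w)"
    by (rule continuous_map_eq) (auto simp: topspace_up)
  then have "Cn TF l l n (up TF T) ?V (up TK T) (\<lambda>w. w)"
    by (rule Cn_linear) (auto simp: sub)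
  from Cn_comp[OF this Suc.IH[OF h(2) sub]] VV sub
  have hF: "Cn TF l l' n (up TF T) ?V (up TK T') h" by blast
  have mem: "h w \<in> topspace (up TK T')" if "w \<in> ?V" for w
    by (rule Cn_topspaceD[OF hF sub that])
  have "Cn TF l l' n (up TF T) ?V (up TF T') (\<lambda>w. Tr (base (h w)) (dir (h w)) (par w))"
    by (intro Cn_Tr Cn_comp[OF hF Cn_base[OF order_refl] mem sub] Cn_comp[OF hF Cn_dir[OF order_refl] mem sub] Cn_par sub)
  moreover have "Tr (base (h w)) (dir (h w)) (par w) = h w" if "w \<in> ?V" for w
  proof -
    obtain x y t where xyt: "w = Tr x y t" using \<open>w \<in> ?V\<close> by (rule updomE)
    with that lift obtain d where "h w = Tr (g x) d t" unfolding is_lift_def by blast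
    then show ?thesis using xyt by simp
  qed
  ultimately have "Cn TF l l' n (up TF T) ?V (up TF T') h" by (rule Cn_cong)
  with lift Suc.prems(1) show ?case by auto
qed

section \<open>Sequences of iterated difference quotients\<close>

text \<open>Starting at an arbitrary topology on towers makes it possible to shift a sequence of
  quotients by one level, see \<open>ups_shift\<close> and \<open>tdom_shift\<close>.\<close>

primrec ups :: "'k topology \<Rightarrow> ('a, 'k) tower topology \<Rightarrow> nat \<Rightarrow> ('a, 'k) tower topology" where
  "ups S T 0 = T"
| "ups S T (Suc i) = up S (ups S T i)"

primrec tdom :: "'k topology \<Rightarrow> ('a \<Rightarrow> 'a \<Rightarrow> 'k::field \<Rightarrow> 'a) \<Rightarrow> ('a, 'k) tower topology \<Rightarrow>
    ('a, 'k) tower set \<Rightarrow> nat \<Rightarrow> ('a, 'k) tower set" where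
  "tdom S l T V 0 = V"
| "tdom S l T V (Suc i) = updom S l (ups S T i) (tdom S l T V i)"

lemma tower_topology_ups: "tower_topology S T i = ups S (pts T) i"
  by (induction i) simp_all

lemma tower_dom_tdom: "tower_dom S E U i = tdom S (vline E) (pts (topo E)) (Pt ` U) i"
  by (induction i) (simp_all add: tower_topology_ups)

lemma ups_shift: "ups S (up S T) i = up S (ups S T i)"
  by (induction i) simp_all

lemma tdom_shift: "tdom S l (up S T) (updom S l T V) i = updom S l (ups S T i) (tdom S l T V i)"
  by (induction i) (simp_all add: ups_shift)

lemma tdom_subset: "V \<subseteq> topspace T \<Longrightarrow> tdom S l T V i \<subseteq> topspace (ups S T i)"
  by (induction i) (simp_all add: updom_subset)

lemma good_ups: "topological_field S \<Longrightarrow> good S l T \<Longrightarrow> good S l (ups S T i)"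
  by (induction i) (simp_all add: good_up)

lemma openin_tdom:
  "topological_field S \<Longrightarrow> good S l T \<Longrightarrow> openin T V \<Longrightarrow> openin (ups S T i) (tdom S l T V i)"
  by (induction i) (simp_all add: openin_updom good_ups)

text \<open>\<open>H i\<close> is g^[i] for g = \<open>H 0\<close>, with the quotient multiplied out
  and without a normalisation off the domain. Concrete candidates are verified in this form and then
  identified with \<open>iter_quotient\<close> by \<open>dq_seq_Ck_nat\<close>.\<close>

definition dq_seq :: "'k topology \<Rightarrow> ('a \<Rightarrow> 'a \<Rightarrow> 'k::field \<Rightarrow> 'a) \<Rightarrow> ('a, 'k) tower topology \<Rightarrow>
    ('a, 'k) tower set \<Rightarrow> ('k, 'f::ab_group_add) tvs \<Rightarrow> nat \<Rightarrow> (nat \<Rightarrow> ('a, 'k) tower \<Rightarrow> 'f) \<Rightarrow> bool" where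
  "dq_seq S l T V F n H \<longleftrightarrow>
     (\<forall>i\<le>n. continuous_map (subtopology (ups S T i) (tdom S l T V i)) (topo F) (H i)) \<and>
     (\<forall>i<n. \<forall>x y t. Tr x y t \<in> tdom S l T V (Suc i) \<longrightarrow>
        vline F (H i x) (H (Suc i) (Tr x y t)) t = H i (tline l x y t))"

lemma dq_seq_mono: "dq_seq S l T V F n H \<Longrightarrow> m \<le> n \<Longrightarrow> dq_seq S l T V F m H"
  by (simp add: dq_seq_def)

text \<open>The tail of the sequence from i on consists of the quotients of \<open>H i\<close>. With
  i = 0 this gives the class of g itself; with i > 0 it trades i of the n orders for taking
  g^[i].\<close>

lemma dq_seq_CV:
  assumes "dq_seq S l T V F n H" "V \<subseteq> topspace T"
  shows "i + m \<le> n \<Longrightarrow> CV S l m (ups S T i) (tdom S l T V i) F (H i)"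
proof (induction m arbitrary: i)
  case 0
  then show ?case using assms(1) by (simp add: dq_seq_def CL_0)
next
  case (Suc m)
  show ?case
  proof (rule CL_SucI)
    show "CV S l m (ups S T i) (tdom S l T V i) F (H i)"
      "CV S l m (up S (ups S T i)) (updom S l (ups S T i) (tdom S l T V i)) F (H (Suc i))"
      using Suc.IH[of i] Suc.IH[of "Suc i"] Suc.prems by simp_all
    show "tdom S l T V i \<subseteq> topspace (ups S T i)" by (rule tdom_subset[OF assms(2)])
  qed (use assms(1) Suc.prems in \<open>auto simp: dq_seq_def\<close>)
qed

text \<open>The sequence of the quotient, one level up, is prefixed with \<open>g\<close>; the shift
  lemmas match the indices.\<close>

lemma CV_dq_seq:
  assumes "CV S l n T V F g" "V \<subseteq> topspace T"
  obtains H where "H 0 = g" "dq_seq S l T V F n H"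
proof -
  have "\<exists>H. H 0 = g \<and> dq_seq S l T V F n H" using assms
  proof (induction n arbitrary: T V g)
    case 0
    then show ?case by (intro exI[of _ "\<lambda>_. g"]) (simp add: dq_seq_def CL_0)
  next
    case (Suc n)
    obtain h where h: "CV S l n (up S T) (updom S l T V) F h"
      "\<And>x y t. Tr x y t \<in> updom S l T V \<Longrightarrow> vline F (g x) (h (Tr x y t)) t = g (tline l x y t)"
      using CL_SucE[OF Suc.prems] by metis
    obtain H where H: "H 0 = h" "dq_seq S l (up S T) (updom S l T V) F n H"
      using Suc.IH[OF h(1) updom_subset[OF Suc.prems(2)]] by blast
    have "continuous_map (subtopology (ups S T i) (tdom S l T V i)) (topo F) (case_nat g H i)" if "i \<le> Suc n" for i
      using that CL_continuous[OF Suc.prems(1)] H(2)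
      by (cases i) (auto simp: dq_seq_def ups_shift tdom_shift)
    moreover have "vline F (case_nat g H i x) (case_nat g H (Suc i) (Tr x y t)) t = case_nat g H i (tline l x y t)"
      if "i < Suc n" "Tr x y t \<in> tdom S l T V (Suc i)" for i x y t
      using that h(2) H by (cases i) (auto simp: dq_seq_def ups_shift tdom_shift)
    ultimately show ?case by (intro exI[of _ "case_nat g H"]) (auto simp: dq_seq_def)
  qed
  then show ?thesis using that by blast
qed

lemma is_difference_quotient_unique:
  assumes "topological_vector_space S E" "topological_vector_space S F" "openin (topo E) U"
    and "is_difference_quotient S E U F j g h" "is_difference_quotient S E U F j g k"
  shows "h = k"
proof
  fix w
  interpret E: topological_vector_space S E by fact
  interpret F: topological_vector_space S F by fact
  show "h w = k w"
  proof (cases "w \<in> tower_dom S E U (Suc j)")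
    case True
    show ?thesis
    proof (rule difference_quotient_unique[OF E.topological_field_axioms _ _ F.Hausdorff_space])
      show "good S (vline E) (tower_topology S (topo E) j)"
        using good_ups E.good_vline E.topological_field_axioms by (simp add: tower_topology_ups)
      show "openin (tower_topology S (topo E) j) (tower_dom S E U j)"
        unfolding tower_topology_ups tower_dom_tdom
        by (rule openin_tdom[OF E.topological_field_axioms E.good_vline]) (simp add: openin_pts_image assms(3))
      show "w \<in> updom S (vline E) (tower_topology S (topo E) j) (tower_dom S E U j)" using True by simp
    qed (use assms(4,5) in \<open>auto simp: is_difference_quotient_def\<close>)
  next
    case False
    then show ?thesis using assms(4,5) by (auto simp: is_difference_quotient_def zero_off_def)
  qed
qed

lemma iter_quotient_Suc_eq:
  assumes "topological_vector_space S E" "topological_vector_space S F" "openin (topo E) U"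
    and "is_difference_quotient S E U F j (iter_quotient S E U F f j) h"
  shows "iter_quotient S E U F f (Suc j) = h"
  unfolding iter_quotient.simps
proof (rule the_equality)
  show "k = h" if "is_difference_quotient S E U F j (iter_quotient S E U F f j) k" for k
    by (rule is_difference_quotient_unique[OF assms(1-3) that assms(4)])
qed (rule assms(4))

lemma zero_off_iter_quotient:
  assumes "topological_vector_space S E" "topological_vector_space S F" "openin (topo E) U"
    and "Ck_nat S E U F j f"
  shows "zero_off (tower_dom S E U j) (iter_quotient S E U F f j)"
proof (cases j)
  case (Suc n)
  then obtain h where h: "is_difference_quotient S E U F n (iter_quotient S E U F f n) h"
    using assms(4) by auto
  then show ?thesis
    unfolding Suc iter_quotient_Suc_eq[OF assms(1-3) h] by (simp add: is_difference_quotient_def)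
qed (simp add: zero_off_def)

text \<open>For t \<noteq> 0 the defining equation is multiplied by t. At t = 0, where that equation
  is silent, the multiplied-out form reduces to g x + 0 = g x.\<close>

lemma Ck_nat_dq_seq:
  assumes "topological_vector_space S E" "topological_vector_space S F" "openin (topo E) U"
  shows "Ck_nat S E U F n f \<Longrightarrow> dq_seq S (vline E) (pts (topo E)) (Pt ` U) F n (iter_quotient S E U F f)"
proof (induction n)
  case 0
  interpret E: topological_vector_space S E by fact
  have UE: "U \<subseteq> topspace (topo E)" by (rule openin_subset[OF assms(3)])
  have "continuous_map (subtopology (pts (topo E)) (Pt ` U)) (subtopology (topo E) U) pt"
    using UE continuous_map_from_subtopology[OF continuous_map_pt]
    by (auto simp: continuous_map_in_subtopology)
  from continuous_map_comp[OF _ this, of "topo F" f] 0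
  have "continuous_map (subtopology (pts (topo E)) (Pt ` U)) (topo F) (\<lambda>w. f (pt w))" by simp
  then have "continuous_map (subtopology (pts (topo E)) (Pt ` U)) (topo F) (iter_quotient S E U F f 0)"
    by (rule continuous_map_eq) auto
  then show ?case by (simp add: dq_seq_def del: iter_quotient.simps)
next
  case (Suc n)
  interpret E: topological_vector_space S E by fact
  interpret F: topological_vector_space S F by fact
  let ?q = "iter_quotient S E U F f"
  have UE: "Pt ` U \<subseteq> topspace (pts (topo E))" using openin_subset[OF assms(3)] by auto
  have IH: "dq_seq S (vline E) (pts (topo E)) (Pt ` U) F n ?q" using Suc by simp
  obtain h where h: "is_difference_quotient S E U F n (?q n) h"
    using Suc.prems by auto
  note iq = iter_quotient_Suc_eq[OF assms h]
  have c: "continuous_map (tower_dom_topology S E U (Suc n)) (topo F) (?q (Suc n))"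
    unfolding iq using h by (simp add: is_difference_quotient_def)
  have mem: "?q n x \<in> topspace (topo F)" if "x \<in> tower_dom S E U n" for x
    using CL_topspaceD[OF dq_seq_CV[OF IH UE, of n 0] tdom_subset[OF UE]] that by (simp add: tower_dom_tdom)
  have "vline F (?q n x) (?q (Suc n) (Tr x y t)) t = ?q n (tline (vline E) x y t)"
    if w: "Tr x y t \<in> tower_dom S E U (Suc n)" for x y t
  proof (cases "t = 0")
    case True
    have hm: "?q (Suc n) (Tr x y t) \<in> topspace (topo F)"
    proof (rule continuous_map_topspaceD[OF c])
      have "Tr x y t \<in> topspace (tower_topology S (topo E) (Suc n))"
        using w tdom_subset[OF UE, of S "vline E" "Suc n"] unfolding tower_dom_tdom tower_topology_ups by blast
      then show "Tr x y t \<in> topspace (tower_dom_topology S E U (Suc n))"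
        using w unfolding topspace_subtopology by blast
    qed
    have "x \<in> topspace (ups S (pts (topo E)) n)" "y \<in> topspace (ups S (pts (topo E)) n)"
      using w tdom_subset[OF UE, of S "vline E" n] by (auto simp: tower_dom_tdom tower_topology_ups)
    then have "tline (vline E) x y 0 = x"
      by (rule good_zero[OF good_ups[OF E.topological_field_axioms E.good_vline]])
    then show ?thesis using True by (simp add: vline_def F.scal_zero_left[OF hm[unfolded True]] del: iter_quotient.simps)
  next
    case False
    have "?q (Suc n) (Tr x y t) = scal F (inverse t) (?q n (tline (vline E) x y t) - ?q n x)"
      unfolding iq using h w False by (auto simp: is_difference_quotient_def tower_line_conv)
    then show ?thesis
      using w False mem
      by (simp add: vline_def F.scal_inverse_cancel F.minus_closed del: iter_quotient.simps)
  qed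
  with IH c show ?case
    unfolding dq_seq_def tower_dom_tdom tower_topology_ups
    by (auto simp: less_Suc_eq le_Suc_eq simp del: iter_quotient.simps tdom.simps ups.simps)
qed

text \<open>The means of computing quotients: each continuous candidate satisfying the
  multiplied-out equation equals, on the domain, the quotient selected by \<open>THE\<close>, by
  uniqueness.\<close>

lemma dq_seq_Ck_nat:
  assumes "topological_vector_space S E" "topological_vector_space S F" "openin (topo E) U"
    and "\<And>x. x \<in> U \<Longrightarrow> H 0 (Pt x) = f x"
  shows "dq_seq S (vline E) (pts (topo E)) (Pt ` U) F n H \<Longrightarrow> Ck_nat S E U F n f \<and>
    (\<forall>i\<le>n. \<forall>w\<in>tower_dom S E U i. iter_quotient S E U F f i w = H i w)"
proof (induction n)
  case 0
  have "continuous_map (subtopology (topo E) U) (subtopology (pts (topo E)) (Pt ` U)) Pt"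
    using openin_subset[OF assms(3)] continuous_map_from_subtopology
    by (auto simp: continuous_map_in_subtopology continuous_map_Pt)
  from continuous_map_comp[OF _ this, of "topo F" "H 0"] 0
  have "continuous_map (subtopology (topo E) U) (topo F) (\<lambda>x. H 0 (Pt x))" by (simp add: dq_seq_def)
  then have "continuous_map (subtopology (topo E) U) (topo F) f"
    by (rule continuous_map_eq) (simp add: assms(4))
  then show ?case using assms(4) by auto
next
  case (Suc n)
  interpret F: topological_vector_space S F by fact
  let ?q = "iter_quotient S E U F f"
  have UE: "Pt ` U \<subseteq> topspace (pts (topo E))" using openin_subset[OF assms(3)] by auto
  have IH: "Ck_nat S E U F n f" "\<And>i w. i \<le> n \<Longrightarrow> w \<in> tower_dom S E U i \<Longrightarrow> ?q i w = H i w"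
    using Suc.IH dq_seq_mono[OF Suc.prems, of n] by auto
  define h where "h w = (if w \<in> tower_dom S E U (Suc n) then H (Suc n) w else 0)" for w
  have mem: "H (Suc n) w \<in> topspace (topo F)" if "w \<in> tower_dom S E U (Suc n)" for w
    using CL_topspaceD[OF dq_seq_CV[OF Suc.prems UE, of "Suc n" 0] tdom_subset[OF UE]] that
    by (simp add: tower_dom_tdom del: tdom.simps ups.simps)
  have "is_difference_quotient S E U F n (?q n) h"
    unfolding is_difference_quotient_def
  proof (intro conjI allI impI)
    have "continuous_map (tower_dom_topology S E U (Suc n)) (topo F) (H (Suc n))"
      using Suc.prems unfolding dq_seq_def tower_topology_ups tower_dom_tdom by blast
    then show "continuous_map (tower_dom_topology S E U (Suc n)) (topo F) h"
      by (rule continuous_map_eq) (auto simp: h_def)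
    show "zero_off (tower_dom S E U (Suc n)) h" by (simp add: zero_off_def h_def)
    fix x y t assume w: "Tr x y t \<in> tower_dom S E U (Suc n) \<and> t \<noteq> 0"
    then have "x \<in> tower_dom S E U n" "tline (vline E) x y t \<in> tower_dom S E U n" by auto
    then have q: "?q n x = H n x" "?q n (tline (vline E) x y t) = H n (tline (vline E) x y t)"
      using IH(2) by auto
    have "H n (tline (vline E) x y t) - H n x = scal F t (H (Suc n) (Tr x y t))"
      using Suc.prems w unfolding dq_seq_def tower_topology_ups tower_dom_tdom
      by (metis add_diff_cancel_left' lessI vline_def)
    moreover have "t \<in> topspace S" using w by simp
    ultimately show "h (Tr x y t) = scal F (inverse t) (?q n (tower_line E x y t) - ?q n x)"
      using w mem F.scal_inverse_cancel(2)[of t "H (Suc n) (Tr x y t)"]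
      by (simp add: q h_def tower_line_conv del: tower_dom_conv)
  qed
  moreover from iter_quotient_Suc_eq[OF assms(1-3) this] have "?q (Suc n) = h" .
  ultimately show ?case
    using IH by (auto simp: le_Suc_eq h_def simp del: iter_quotient.simps tower_dom_conv)
qed

text \<open>Makes the rules for lines available for the notion of class that occurs in the
  statement, and conversely.\<close>

lemma Ck_nat_iff_CV:
  assumes "topological_vector_space S E" "topological_vector_space S F" "openin (topo E) U"
  shows "Ck_nat S E U F n f \<longleftrightarrow> CV S (vline E) n (pts (topo E)) (Pt ` U) F (\<lambda>w. f (pt w))"
proof
  have UE: "Pt ` U \<subseteq> topspace (pts (topo E))" using openin_subset[OF assms(3)] by auto
  {
    assume "Ck_nat S E U F n f"
    from dq_seq_CV[OF Ck_nat_dq_seq[OF assms this] UE, of 0 n]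
    have "CV S (vline E) n (pts (topo E)) (Pt ` U) F (iter_quotient S E U F f 0)" by simp
    then show "CV S (vline E) n (pts (topo E)) (Pt ` U) F (\<lambda>w. f (pt w))" by (rule CL_cong) auto
  next
    assume "CV S (vline E) n (pts (topo E)) (Pt ` U) F (\<lambda>w. f (pt w))"
    from CV_dq_seq[OF this UE] obtain H where "H 0 = (\<lambda>w. f (pt w))"
      "dq_seq S (vline E) (pts (topo E)) (Pt ` U) F n H" by blast
    with dq_seq_Ck_nat[OF assms, of H f n] show "Ck_nat S E U F n f" by simp
  }
qed

section \<open>Affine maps\<close>

primrec tmap :: "('a \<Rightarrow> 'b) \<Rightarrow> ('a, 'k) tower \<Rightarrow> ('b, 'k) tower" where
  "tmap \<phi> (Pt x) = Pt (\<phi> x)"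
| "tmap \<phi> (Tr x y t) = Tr (tmap \<phi> x) (tmap \<phi> y) t"

text \<open>From \<alpha> (x + t y) = \<alpha> x + t \<phi> y: only the innermost base entry sees
  \<alpha>, every direction sees the linear part \<phi>.\<close>

primrec tmap_aff :: "('a \<Rightarrow> 'b) \<Rightarrow> ('a \<Rightarrow> 'b) \<Rightarrow> ('a, 'k) tower \<Rightarrow> ('b, 'k) tower" where
  "tmap_aff \<alpha> \<phi> (Pt x) = Pt (\<alpha> x)"
| "tmap_aff \<alpha> \<phi> (Tr x y t) = Tr (tmap_aff \<alpha> \<phi> x) (tmap \<phi> y) t"

text \<open>\<open>\<phi>\<close> is the linear part of the affine map \<open>\<alpha>\<close>.\<close>

definition affine_on :: "'k topology \<Rightarrow> ('a \<Rightarrow> 'a \<Rightarrow> 'k \<Rightarrow> 'a) \<Rightarrow> 'a topology \<Rightarrow>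
    ('b \<Rightarrow> 'b \<Rightarrow> 'k \<Rightarrow> 'b) \<Rightarrow> 'b topology \<Rightarrow> ('a \<Rightarrow> 'b) \<Rightarrow> ('a \<Rightarrow> 'b) \<Rightarrow> bool" where
  "affine_on S l T l' T' \<alpha> \<phi> \<longleftrightarrow> continuous_map T T' \<alpha> \<and> continuous_map T T' \<phi> \<and>
     (\<forall>x\<in>topspace T. \<forall>y\<in>topspace T. \<forall>t\<in>topspace S.
        l' (\<alpha> x) (\<phi> y) t = \<alpha> (l x y t) \<and> l' (\<phi> x) (\<phi> y) t = \<phi> (l x y t))"

lemma affine_onD:
  assumes "affine_on S l T l' T' \<alpha> \<phi>"
  shows "continuous_map T T' \<alpha>" "continuous_map T T' \<phi>"
    "\<And>x y t. x \<in> topspace T \<Longrightarrow> y \<in> topspace T \<Longrightarrow> t \<in> topspace S \<Longrightarrow> l' (\<alpha> x) (\<phi> y) t = \<alpha> (l x y t)"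
    "\<And>x y t. x \<in> topspace T \<Longrightarrow> y \<in> topspace T \<Longrightarrow> t \<in> topspace S \<Longrightarrow> l' (\<phi> x) (\<phi> y) t = \<phi> (l x y t)"
  using assms by (auto simp: affine_on_def)

lemma tmap_tline:
  assumes "affine_on S l T l' T' \<alpha> \<phi>"
  shows "v \<in> topspace (ups S (pts T) i) \<Longrightarrow> w \<in> topspace (ups S (pts T) i) \<Longrightarrow> t \<in> topspace S \<Longrightarrow>
    tline l' (tmap \<phi> v) (tmap \<phi> w) t = tmap \<phi> (tline l v w t)"
proof (induction i arbitrary: v w t)
  case 0
  then show ?case using affine_onD(4)[OF assms] by auto
next
  case (Suc i)
  then show ?case by (auto elim!: topspace_upE)
qed

lemma tmap_aff_tline:
  assumes "affine_on S l T l' T' \<alpha> \<phi>"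
  shows "v \<in> topspace (ups S (pts T) i) \<Longrightarrow> w \<in> topspace (ups S (pts T) i) \<Longrightarrow> t \<in> topspace S \<Longrightarrow>
    tline l' (tmap_aff \<alpha> \<phi> v) (tmap \<phi> w) t = tmap_aff \<alpha> \<phi> (tline l v w t)"
proof (induction i arbitrary: v w t)
  case 0
  then show ?case using affine_onD(3)[OF assms] by auto
next
  case (Suc i)
  then show ?case by (auto elim!: topspace_upE simp: tmap_tline[OF assms])
qed

lemma continuous_map_tmap:
  assumes "continuous_map T T' \<phi>"
  shows "continuous_map (ups S (pts T) i) (ups S (pts T') i) (tmap \<phi>)"
proof (induction i)
  case 0
  have "continuous_map (pts T) (pts T') (\<lambda>w. Pt (\<phi> (pt w)))"
    by (simp add: continuous_map_Pt continuous_map_comp[OF assms continuous_map_pt])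
  then show ?case unfolding ups.simps by (rule continuous_map_eq) auto
next
  case (Suc i)
  let ?X = "ups S (pts T) i"
  have "continuous_map (up S ?X) (up S (ups S (pts T') i)) (\<lambda>w. Tr (tmap \<phi> (base w)) (tmap \<phi> (dir w)) (par w))"
    by (intro continuous_map_Tr continuous_map_comp[OF Suc] continuous_map_base continuous_map_dir continuous_map_par)
  then show ?case unfolding ups.simps by (rule continuous_map_eq) (auto elim!: topspace_upE)
qed

lemma continuous_map_tmap_aff:
  assumes "continuous_map T T' \<alpha>" "continuous_map T T' \<phi>"
  shows "continuous_map (ups S (pts T) i) (ups S (pts T') i) (tmap_aff \<alpha> \<phi>)"
proof (induction i)
  case 0
  have "continuous_map (pts T) (pts T') (\<lambda>w. Pt (\<alpha> (pt w)))"
    by (simp add: continuous_map_Pt continuous_map_comp[OF assms(1) continuous_map_pt])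
  then show ?case unfolding ups.simps by (rule continuous_map_eq) auto
next
  case (Suc i)
  let ?X = "ups S (pts T) i"
  have "continuous_map (up S ?X) (up S (ups S (pts T') i)) (\<lambda>w. Tr (tmap_aff \<alpha> \<phi> (base w)) (tmap \<phi> (dir w)) (par w))"
    by (intro continuous_map_Tr continuous_map_comp[OF Suc] continuous_map_comp[OF continuous_map_tmap[OF assms(2)]]
        continuous_map_base continuous_map_dir continuous_map_par)
  then show ?case unfolding ups.simps by (rule continuous_map_eq) (auto elim!: topspace_upE)
qed

lemma tmap_topspace: "continuous_map T T' \<phi> \<Longrightarrow> w \<in> topspace (ups S (pts T) i) \<Longrightarrow>
    tmap \<phi> w \<in> topspace (ups S (pts T') i)"
  using continuous_map_topspaceD[OF continuous_map_tmap] .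

lemma tmap_aff_tdom:
  assumes "affine_on S l T l' T' \<alpha> \<phi>" "V \<subseteq> topspace T" "\<alpha> ` V \<subseteq> V'"
  shows "w \<in> tdom S l (pts T) (Pt ` V) i \<Longrightarrow> tmap_aff \<alpha> \<phi> w \<in> tdom S l' (pts T') (Pt ` V') i"
proof (induction i arbitrary: w)
  case 0
  then show ?case using assms(3) by auto
next
  case (Suc i)
  have V: "Pt ` V \<subseteq> topspace (pts T)" using assms(2) by auto
  obtain x y t where xyt: "w = Tr x y t" "x \<in> tdom S l (pts T) (Pt ` V) i" "y \<in> topspace (ups S (pts T) i)"
    "t \<in> topspace S" "tline l x y t \<in> tdom S l (pts T) (Pt ` V) i"
    using Suc.prems by (auto elim: updomE)
  then show ?case
    using Suc.IH[OF xyt(2)] Suc.IH[OF xyt(5)] tmap_topspace[OF affine_onD(2)[OF assms(1)] xyt(3)]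
      tmap_aff_tline[OF assms(1) subsetD[OF tdom_subset[OF V] xyt(2)] xyt(3,4)]
    by simp
qed

text \<open>Along an affine map the chain rule has the closed form (f o \<alpha>)^[i] = f^[i] o
  \<open>tmap_aff \<alpha> \<phi>\<close>. It transports concrete quotients, whereas
  \<open>Cn_comp\<close> only yields existence.\<close>

lemma dq_seq_affine:
  assumes "affine_on S l T l' T' \<alpha> \<phi>" "V \<subseteq> topspace T" "\<alpha> ` V \<subseteq> V'"
    and H: "dq_seq S l' (pts T') (Pt ` V') F n H"
  shows "dq_seq S l (pts T) (Pt ` V) F n (\<lambda>i w. H i (tmap_aff \<alpha> \<phi> w))"
  unfolding dq_seq_def
proof (intro conjI allI impI)
  fix i assume "i \<le> n"
  have "continuous_map (subtopology (ups S (pts T) i) (tdom S l (pts T) (Pt ` V) i))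
      (subtopology (ups S (pts T') i) (tdom S l' (pts T') (Pt ` V') i)) (tmap_aff \<alpha> \<phi>)"
    using continuous_map_from_subtopology[OF continuous_map_tmap_aff[OF affine_onD(1,2)[OF assms(1)]]]
      tmap_aff_tdom[OF assms(1-3)]
    by (auto simp: continuous_map_in_subtopology)
  with H \<open>i \<le> n\<close> show "continuous_map (subtopology (ups S (pts T) i) (tdom S l (pts T) (Pt ` V) i)) (topo F)
      (\<lambda>w. H i (tmap_aff \<alpha> \<phi> w))"
    by (auto simp: dq_seq_def intro: continuous_map_comp)
next
  fix i x y t assume i: "i < n" and w: "Tr x y t \<in> tdom S l (pts T) (Pt ` V) (Suc i)"
  have V: "Pt ` V \<subseteq> topspace (pts T)" using assms(2) by auto
  have x: "x \<in> topspace (ups S (pts T) i)" "y \<in> topspace (ups S (pts T) i)" "t \<in> topspace S"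
    using w tdom_subset[OF V] by auto
  show "vline F (H i (tmap_aff \<alpha> \<phi> x)) (H (Suc i) (tmap_aff \<alpha> \<phi> (Tr x y t))) t = H i (tmap_aff \<alpha> \<phi> (tline l x y t))"
    using H i tmap_aff_tdom[OF assms(1-3) w] tmap_aff_tline[OF assms(1) x]
    unfolding dq_seq_def by (simp del: tdom.simps)
qed

section \<open>Dependence on parameters\<close>

text \<open>With constant lines on \<open>A\<close> a line moves only the
  \<open>Z\<close>-component, so all quotients are quotients in z, while continuity is required
  jointly. \<open>param_CV_D\<close> and \<open>param_CV_I\<close> translate this into statements
  about each \<phi> a.\<close>

definition param_CV :: "'k::field topology \<Rightarrow> ('k, 'z::ab_group_add) tvs \<Rightarrow> 'z set \<Rightarrow> ('k, 'e::ab_group_add) tvs \<Rightarrow>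
    nat \<Rightarrow> 'a topology \<Rightarrow> ('a \<Rightarrow> 'z \<Rightarrow> 'e) \<Rightarrow> bool" where
  "param_CV S Z V E n A \<phi> \<longleftrightarrow> CV S (pline cline (vline Z)) n (pts (prod_topology A (topo Z)))
     (Pt ` (topspace A \<times> V)) E (\<lambda>w. \<phi> (fst (pt w)) (snd (pt w)))"

text \<open>In a tower over \<open>A\<close> x \<open>Z\<close> the directions carry entries in
  \<open>A\<close> as well, which constant lines ignore. The parameter that counts is the one at the
  root.\<close>

primrec root_pt :: "('a, 'k) tower \<Rightarrow> 'a" where
  "root_pt (Pt x) = x"
| "root_pt (Tr x y t) = root_pt x"

lemma continuous_map_root_pt: "continuous_map (ups S (pts T) i) T root_pt"
proof (induction i)
  case 0
  from continuous_map_pt show ?case unfolding ups.simps by (rule continuous_map_eq) auto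
next
  case (Suc i)
  from continuous_map_comp[OF this continuous_map_base]
  show ?case unfolding ups.simps by (rule continuous_map_eq) (auto elim!: topspace_upE)
qed

lemma root_pt_tline:
  "v \<in> topspace (ups S (pts (prod_topology A T)) i) \<Longrightarrow> w \<in> topspace (ups S (pts (prod_topology A T)) i) \<Longrightarrow>
    fst (root_pt (tline (pline cline l) v w t)) = fst (root_pt v)"
proof (induction i arbitrary: v w t)
  case 0
  then show ?case by (auto simp: pline_def cline_def)
next
  case (Suc i)
  then show ?case by (auto elim!: topspace_upE)
qed

lemma continuous_map_tmap_Pair:
  "continuous_map (prod_topology A (ups S (pts T) i)) (ups S (pts (prod_topology A T)) i) (\<lambda>(a, w). tmap (Pair a) w)"
proof (induction i)
  case 0
  have "continuous_map (prod_topology A (pts T)) (pts (prod_topology A T)) (\<lambda>z. Pt (fst z, pt (snd z)))"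
    by (simp add: continuous_map_Pt continuous_map_pairedI continuous_map_fst continuous_map_comp[OF continuous_map_pt continuous_map_snd])
  then show ?case unfolding ups.simps by (rule continuous_map_eq) auto
next
  case (Suc i)
  let ?X = "ups S (pts T) i"
  have 1: "continuous_map (prod_topology A (up S ?X)) (ups S (pts (prod_topology A T)) i) (\<lambda>z. tmap (Pair (fst z)) (f (snd z)))"
    if "continuous_map (up S ?X) ?X f" for f
    using continuous_map_comp2[OF Suc continuous_map_fst continuous_map_comp[OF that continuous_map_snd]] .
  have "continuous_map (prod_topology A (up S ?X)) (up S (ups S (pts (prod_topology A T)) i))
     (\<lambda>z. Tr (tmap (Pair (fst z)) (base (snd z))) (tmap (Pair (fst z)) (dir (snd z))) (par (snd z)))"
    by (intro continuous_map_Tr 1 continuous_map_base continuous_map_dir continuous_map_comp[OF continuous_map_par continuous_map_snd])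
  then show ?case unfolding ups.simps by (rule continuous_map_eq) (auto elim!: topspace_upE)
qed

lemma tmap_aff_same: "tmap_aff \<phi> \<phi> = tmap \<phi>"
proof
  show "tmap_aff \<phi> \<phi> w = tmap \<phi> w" for w by (induction w) auto
qed

lemma affine_on_Pair: "a \<in> topspace A \<Longrightarrow> affine_on S l T (pline cline l) (prod_topology A T) (Pair a) (Pair a)"
  by (auto simp: affine_on_def pline_def cline_def continuous_map_pairedI)

lemma affine_on_snd: "affine_on S (pline l' l) (prod_topology A T) l T snd snd"
  by (auto simp: affine_on_def pline_def continuous_map_snd)

text \<open>z \<mapsto> (a, z) is affine for these lines, with itself as linear part. Hence the
  quotients of \<phi> a are those of the joint map at towers all of whose points have the parameter
  a, and they inherit joint continuity.\<close>

lemma param_CV_D: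
  assumes "topological_vector_space S Z" "topological_vector_space S E" "openin (topo Z) V"
    and "param_CV S Z V E n A \<phi>"
  shows "a \<in> topspace A \<Longrightarrow> Ck_nat S Z V E n (\<phi> a)"
    and "i \<le> n \<Longrightarrow> continuous_map (prod_topology A (tower_dom_topology S Z V i)) (topo E)
           (\<lambda>(a, v). iter_quotient S Z V E (\<phi> a) i v)"
proof -
  have V: "V \<subseteq> topspace (topo Z)" by (rule openin_subset[OF assms(3)])
  have sub: "Pt ` (topspace A \<times> V) \<subseteq> topspace (pts (prod_topology A (topo Z)))" using V by auto
  obtain H where H: "H 0 = (\<lambda>w. \<phi> (fst (pt w)) (snd (pt w)))"
    "dq_seq S (pline cline (vline Z)) (pts (prod_topology A (topo Z))) (Pt ` (topspace A \<times> V)) E n H"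
    using CV_dq_seq[OF assms(4)[unfolded param_CV_def] sub] by blast
  have *: "Ck_nat S Z V E n (\<phi> a) \<and>
      (\<forall>i\<le>n. \<forall>w\<in>tower_dom S Z V i. iter_quotient S Z V E (\<phi> a) i w = H i (tmap (Pair a) w))"
    if a: "a \<in> topspace A" for a
  proof -
    have "dq_seq S (vline Z) (pts (topo Z)) (Pt ` V) E n (\<lambda>i w. H i (tmap_aff (Pair a) (Pair a) w))"
      by (rule dq_seq_affine[OF affine_on_Pair[OF a] V _ H(2)]) (use a in auto)
    then have "dq_seq S (vline Z) (pts (topo Z)) (Pt ` V) E n (\<lambda>i w. H i (tmap (Pair a) w))"
      by (simp add: tmap_aff_same)
    then show ?thesis
      using dq_seq_Ck_nat[OF assms(1-3), of "\<lambda>i w. H i (tmap (Pair a) w)" "\<phi> a" n] H(1) by simp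
  qed
  then show "a \<in> topspace A \<Longrightarrow> Ck_nat S Z V E n (\<phi> a)" by blast
  show "continuous_map (prod_topology A (tower_dom_topology S Z V i)) (topo E)
           (\<lambda>(a, v). iter_quotient S Z V E (\<phi> a) i v)" if i: "i \<le> n"
  proof -
    let ?X = "prod_topology A (tower_dom_topology S Z V i)"
    let ?Y = "ups S (pts (prod_topology A (topo Z))) i"
    let ?D = "tdom S (pline cline (vline Z)) (pts (prod_topology A (topo Z))) (Pt ` (topspace A \<times> V)) i"
    have VZ: "Pt ` V \<subseteq> topspace (pts (topo Z))" using V by auto
    have X: "topspace ?X = topspace A \<times> tower_dom S Z V i"
      using tdom_subset[OF VZ] by (auto simp: tower_topology_ups tower_dom_tdom)
    have "continuous_map ?X ?Y (\<lambda>z. tmap (Pair (fst z)) (snd z))"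
      using continuous_map_tmap_Pair[of A S "topo Z" i]
      by (auto simp: case_prod_unfold tower_topology_ups prod_topology_subtopology intro: continuous_map_from_subtopology)
    moreover have "tmap (Pair a) w \<in> ?D" if "a \<in> topspace A" "w \<in> tower_dom S Z V i" for a w
      using tmap_aff_tdom[OF affine_on_Pair[OF that(1)] V, of "topspace A \<times> V" w S "vline Z" i] that
      by (auto simp: tmap_aff_same tower_dom_tdom)
    ultimately have "continuous_map ?X (subtopology ?Y ?D) (\<lambda>z. tmap (Pair (fst z)) (snd z))"
      using X by (auto simp: continuous_map_in_subtopology)
    moreover have "continuous_map (subtopology ?Y ?D) (topo E) (H i)"
      using H(2) i by (auto simp: dq_seq_def)
    ultimately have "continuous_map ?X (topo E) (\<lambda>z. H i (tmap (Pair (fst z)) (snd z)))"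
      by (rule continuous_map_comp[rotated])
    then show ?thesis
      by (rule continuous_map_eq) (use X * i in auto)
  qed
qed

lemma param_CV_I:
  assumes Z: "topological_vector_space S Z" and E: "topological_vector_space S E" and V: "openin (topo Z) V"
    and C: "\<And>a. a \<in> topspace A \<Longrightarrow> Ck_nat S Z V E n (\<phi> a)"
    and c: "\<And>i. i \<le> n \<Longrightarrow> continuous_map (prod_topology A (tower_dom_topology S Z V i)) (topo E)
           (\<lambda>(a, v). iter_quotient S Z V E (\<phi> a) i v)"
  shows "param_CV S Z V E n A \<phi>"
proof -
  let ?T = "pts (prod_topology A (topo Z))" and ?l = "pline cline (vline Z)" and ?V = "Pt ` (topspace A \<times> V)"
  \<comment> \<open>The parameter is frozen at the root and the \<open>Z\<close>-entries form the
    tower at which the quotient of \<phi> is taken; by \<open>root_pt_tline\<close> the parameter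
    stays the same along lines.\<close>
  let ?H = "\<lambda>i w. iter_quotient S Z V E (\<phi> (fst (root_pt w))) i (tmap snd w)"
  have VZ: "V \<subseteq> topspace (topo Z)" by (rule openin_subset[OF V])
  have sub: "?V \<subseteq> topspace ?T" using VZ by auto
  have dom: "tmap snd w \<in> tower_dom S Z V i" if "w \<in> tdom S ?l ?T ?V i" for w i
  proof -
    have "tmap_aff snd snd w \<in> tdom S (vline Z) (pts (topo Z)) (Pt ` V) i"
      by (rule tmap_aff_tdom[OF affine_on_snd _ _ that]) (use VZ in auto)
    then show ?thesis by (simp add: tmap_aff_same tower_dom_tdom)
  qed
  have mem: "w \<in> topspace (ups S ?T i)" if "w \<in> tdom S ?l ?T ?V i" for w i
    using tdom_subset[OF sub] that by blast
  have rt: "fst (root_pt w) \<in> topspace A" if "w \<in> tdom S ?l ?T ?V i" for w i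
    using continuous_map_topspaceD[OF continuous_map_root_pt mem[OF that]] by auto
  have "dq_seq S ?l ?T ?V E n ?H"
    unfolding dq_seq_def
  proof (intro conjI allI impI)
    fix i assume i: "i \<le> n"
    have "continuous_map (subtopology (ups S ?T i) (tdom S ?l ?T ?V i))
        (prod_topology A (tower_dom_topology S Z V i)) (\<lambda>w. (fst (root_pt w), tmap snd w))"
    proof (rule continuous_map_pairedI)
      show "continuous_map (subtopology (ups S ?T i) (tdom S ?l ?T ?V i)) A (\<lambda>w. fst (root_pt w))"
        by (intro continuous_map_from_subtopology continuous_map_comp[OF continuous_map_fst continuous_map_root_pt])
      have "continuous_map (subtopology (ups S ?T i) (tdom S ?l ?T ?V i)) (tower_topology S (topo Z) i) (tmap snd)"
        unfolding tower_topology_ups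
        by (intro continuous_map_from_subtopology continuous_map_tmap continuous_map_snd)
      then show "continuous_map (subtopology (ups S ?T i) (tdom S ?l ?T ?V i)) (tower_dom_topology S Z V i) (tmap snd)"
        using dom by (auto simp: continuous_map_in_subtopology)
    qed
    from continuous_map_comp[OF c[OF i] this]
    show "continuous_map (subtopology (ups S ?T i) (tdom S ?l ?T ?V i)) (topo E) (?H i)" by simp
  next
    fix i x y t assume i: "i < n" and w: "Tr x y t \<in> tdom S ?l ?T ?V (Suc i)"
    then have xyt: "x \<in> tdom S ?l ?T ?V i" "y \<in> topspace (ups S ?T i)" "t \<in> topspace S"
      "tline ?l x y t \<in> tdom S ?l ?T ?V i" by auto
    let ?a = "fst (root_pt x)"
    have tl: "tline (vline Z) (tmap snd x) (tmap snd y) t = tmap snd (tline ?l x y t)"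
      by (rule tmap_tline[OF affine_on_snd mem[OF xyt(1)] xyt(2,3)])
    have "Tr (tmap snd x) (tmap snd y) t \<in> tower_dom S Z V (Suc i)" using dom[OF w] by simp
    with Ck_nat_dq_seq[OF Z E V C[OF rt[OF xyt(1)]]] i
    have "vline E (iter_quotient S Z V E (\<phi> ?a) i (tmap snd x))
       (iter_quotient S Z V E (\<phi> ?a) (Suc i) (Tr (tmap snd x) (tmap snd y) t)) t =
       iter_quotient S Z V E (\<phi> ?a) i (tmap snd (tline ?l x y t))"
      unfolding dq_seq_def tower_dom_tdom tl[symmetric] by blast
    then show "vline E (?H i x) (?H (Suc i) (Tr x y t)) t = ?H i (tline ?l x y t)"
      by (simp add: root_pt_tline[OF mem[OF xyt(1)] xyt(2)] del: iter_quotient.simps)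
  qed
  from dq_seq_CV[OF this sub, of 0 n] have "CV S ?l n ?T ?V E (?H 0)" by simp
  then show ?thesis unfolding param_CV_def by (rule CL_cong) auto
qed

lemma Cn_reparametrise:
  assumes "continuous_map A' A q" "V \<subseteq> topspace T"
  shows "Cn S (pline cline l) (pline cline l) n (pts (prod_topology A' T)) (Pt ` (topspace A' \<times> V))
    (pts (prod_topology A T)) (\<lambda>w. Pt (q (fst (pt w)), snd (pt w)))"
proof (rule Cn_linear)
  show "continuous_map (pts (prod_topology A' T)) (pts (prod_topology A T)) (\<lambda>w. Pt (q (fst (pt w)), snd (pt w)))"
    unfolding continuous_map_Pt
    by (intro continuous_map_pairedI continuous_map_comp[OF assms(1)]
      continuous_map_comp[OF continuous_map_fst continuous_map_pt] continuous_map_comp[OF continuous_map_snd continuous_map_pt])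
qed (use assms(2) in \<open>auto simp: pline_def cline_def\<close>)

lemma param_CV_reparametrise:
  assumes "continuous_map A' A q" "param_CV S Z V E n A \<phi>" "V \<subseteq> topspace (topo Z)"
  shows "param_CV S Z V E n A' (\<lambda>a. \<phi> (q a))"
proof -
  note c = CL_comp[where g = "\<lambda>w. \<phi> (fst (pt w)) (snd (pt w))" and f = "\<lambda>w. Pt (q (fst (pt w)), snd (pt w))",
      OF Cn_reparametrise[OF assms(1,3)] assms(2)[unfolded param_CV_def], unfolded tower.sel fst_conv snd_conv]
  show ?thesis
    unfolding param_CV_def
    by (rule c) (use assms(3) continuous_map_topspaceD[OF assms(1)] in auto)
qed

section \<open>Initial and compact-open topologies\<close>

lemma topspace_initial_topology [simp]: "topspace (initial_topology X I f T) = X"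
  by (auto simp: initial_topology_def topology_generated_by_topspace)

lemma continuous_map_into_initial_topology:
  assumes "\<And>x. x \<in> topspace A \<Longrightarrow> \<phi> x \<in> X" "\<And>i. i \<in> I \<Longrightarrow> continuous_map A (T i) (\<lambda>x. f i (\<phi> x))"
  shows "continuous_map A (initial_topology X I f T) \<phi>"
  unfolding initial_topology_def
proof (rule continuous_on_generated_topo)
  fix U assume "U \<in> insert X {{x \<in> X. f i x \<in> W} | i W. i \<in> I \<and> openin (T i) W}"
  then consider "U = X" | i W where "U = {x \<in> X. f i x \<in> W}" "i \<in> I" "openin (T i) W" by auto
  then show "openin A (\<phi> -` U \<inter> topspace A)"
  proof cases
    case 1
    then have "\<phi> -` U \<inter> topspace A = topspace A" using assms(1) by auto
    then show ?thesis by simp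
  next
    case 2
    then have "\<phi> -` U \<inter> topspace A = {x \<in> topspace A. f i (\<phi> x) \<in> W}" using assms(1) by auto
    then show ?thesis using openin_continuous_map_preimage_in[OF assms(2)[OF 2(2)] 2(3)] by simp
  qed
qed (use assms(1) in auto)

lemma continuous_map_initial_topology:
  assumes "i \<in> I" "\<And>x. x \<in> X \<Longrightarrow> f i x \<in> topspace (T i)"
  shows "continuous_map (initial_topology X I f T) (T i) (f i)"
  unfolding continuous_map_def
proof (intro conjI allI impI)
  fix W assume "openin (T i) W"
  then have "{x \<in> X. f i x \<in> W} \<in> insert X {{x \<in> X. f i x \<in> W} | i W. i \<in> I \<and> openin (T i) W}"
    using assms(1) by auto
  from topology_generated_by_Basis[OF this]
  show "openin (initial_topology X I f T) {x \<in> topspace (initial_topology X I f T). f i x \<in> W}"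
    by (simp add: initial_topology_def[symmetric])
qed (use assms(2) in auto)

lemma topspace_compact_open [simp]:
  "topspace (compact_open_topology X Y) = {f. continuous_map X Y f \<and> zero_off (topspace X) f}"
proof -
  have "{f. continuous_map X Y f \<and> zero_off (topspace X) f} \<in>
    {{f. continuous_map X Y f \<and> zero_off (topspace X) f \<and> f ` C \<subseteq> W} | C W. compactin X C \<and> openin Y W}"
    by (auto intro!: exI[of _ "{}"])
  then show ?thesis by (auto simp: compact_open_topology_def topology_generated_by_topspace)
qed

text \<open>The tube lemma turns g a (C) \<subseteq> W, for compact C, into the same inclusion for
  all parameters near a.\<close>

lemma continuous_map_into_compact_open:
  assumes "\<And>a. a \<in> topspace A \<Longrightarrow> zero_off (topspace X) (g a)"
    and c: "continuous_map (prod_topology A X) Y (\<lambda>(a, x). g a x)"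
  shows "continuous_map A (compact_open_topology X Y) g"
proof -
  have mem: "continuous_map X Y (g a)" if "a \<in> topspace A" for a
  proof -
    have "continuous_map X (prod_topology A X) (Pair a)" using that by (simp add: continuous_map_pairedI)
    from continuous_map_comp[OF c this] show ?thesis by simp
  qed
  show ?thesis
    unfolding compact_open_topology_def
  proof (rule continuous_on_generated_topo)
    let ?B = "{{f. continuous_map X Y f \<and> zero_off (topspace X) f \<and> f ` C \<subseteq> W} | C W. compactin X C \<and> openin Y W}"
    have "\<Union> ?B = topspace (compact_open_topology X Y)"
      by (simp add: compact_open_topology_def topology_generated_by_topspace)
    then show "g ` topspace A \<subseteq> \<Union> ?B" using assms(1) mem by auto
    fix U assume "U \<in> ?B"
    then obtain C W where U: "U = {f. continuous_map X Y f \<and> zero_off (topspace X) f \<and> f ` C \<subseteq> W}"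
      and C: "compactin X C" and W: "openin Y W" by blast
    have CX: "C \<subseteq> topspace X" using C by (rule compactin_subset_topspace)
    let ?N = "{z \<in> topspace (prod_topology A X). (\<lambda>(a, x). g a x) z \<in> W}"
    have N: "openin (prod_topology A X) ?N" by (rule openin_continuous_map_preimage_in[OF c W])
    show "openin A (g -` U \<inter> topspace A)"
    proof (subst openin_subopen, intro ballI)
      fix a assume a: "a \<in> g -` U \<inter> topspace A"
      then have "{a} \<times> C \<subseteq> ?N" using CX U by auto
      then obtain O1 O2 where O12: "openin A O1" "a \<in> O1" "C \<subseteq> O2" "O1 \<times> O2 \<subseteq> ?N"
        using tube_lemma_right[OF N C, of a] a by auto
      have "O1 \<subseteq> g -` U \<inter> topspace A"
      proof
        fix b assume b: "b \<in> O1"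
        then have "b \<in> topspace A" using openin_subset[OF O12(1)] by blast
        moreover have "g b x \<in> W" if "x \<in> C" for x
        proof -
          have "(b, x) \<in> ?N" using b that O12(3,4) by blast
          then show ?thesis by simp
        qed
        ultimately show "b \<in> g -` U \<inter> topspace A" using assms(1) mem unfolding U by auto
      qed
      then show "\<exists>T. openin A T \<and> a \<in> T \<and> T \<subseteq> g -` U \<inter> topspace A" using O12 by blast
    qed
  qed
qed

text \<open>If f x lies in W, some compact neighbourhood C of x is mapped into W by f; then all maps
  sending C into W, paired with the points in the interior of C, have their values in W.\<close>

lemma continuous_map_compact_open_eval:
  assumes "locally_compact_space X" "Hausdorff_space X"
  shows "continuous_map (prod_topology (compact_open_topology X Y) X) Y (\<lambda>(f, x). f x)"
  unfolding continuous_map_def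
proof (intro conjI allI impI)
  let ?P = "prod_topology (compact_open_topology X Y) X"
  show "(\<lambda>(f, x). f x) \<in> topspace ?P \<rightarrow> topspace Y"
    by (auto dest: continuous_map_topspaceD)
  fix W assume W: "openin Y W"
  show "openin ?P {z \<in> topspace ?P. (\<lambda>(f, x). f x) z \<in> W}"
  proof (subst openin_subopen, intro ballI)
    fix z assume "z \<in> {z \<in> topspace ?P. (\<lambda>(f, x). f x) z \<in> W}"
    then obtain f x where z: "z = (f, x)" "continuous_map X Y f" "zero_off (topspace X) f" "x \<in> topspace X" "f x \<in> W"
      by auto
    have "openin X {x \<in> topspace X. f x \<in> W}" by (rule openin_continuous_map_preimage_in[OF z(2) W])
    moreover have "neighbourhood_base_of (compactin X) X"
      using locally_compact_space_neighbourhood_base assms by blast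
    ultimately obtain O' C where OC: "openin X O'" "compactin X C" "x \<in> O'" "O' \<subseteq> C" "C \<subseteq> {x \<in> topspace X. f x \<in> W}"
      using z(4,5) unfolding neighbourhood_base_of by (metis (mono_tags, lifting) mem_Collect_eq)
    let ?N = "{f. continuous_map X Y f \<and> zero_off (topspace X) f \<and> f ` C \<subseteq> W}"
    have "openin (compact_open_topology X Y) ?N"
      unfolding compact_open_topology_def by (rule topology_generated_by_Basis) (use OC W in auto)
    then have "openin ?P (?N \<times> O')" using OC by (simp add: openin_prod_Times_iff)
    moreover have "z \<in> ?N \<times> O'" using z OC by auto
    moreover have "?N \<times> O' \<subseteq> {z \<in> topspace ?P. (\<lambda>(f, x). f x) z \<in> W}"
      using OC(4) openin_subset[OF OC(1)] by (auto dest: subsetD simp: image_subset_iff)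
    ultimately show "\<exists>T. openin ?P T \<and> z \<in> T \<and> T \<subseteq> {z \<in> topspace ?P. (\<lambda>(f, x). f x) z \<in> W}"
      by blast
  qed
qed

section \<open>Local compactness of the iterated domains\<close>

lemma pts_homeomorphic: "T homeomorphic_space (pts T :: ('a, 'k) tower topology)"
  unfolding homeomorphic_space_def
  by (rule exI[of _ Pt], rule exI[of _ pt])
    (auto simp: homeomorphic_maps_def continuous_map_pt continuous_map_Pt)

lemma up_homeomorphic: "prod_topology T (prod_topology T S) homeomorphic_space up S T"
proof -
  let ?P = "prod_topology T (prod_topology T S)"
  have "continuous_map ?P (up S T) (\<lambda>z. Tr (fst z) (fst (snd z)) (snd (snd z)))"
    by (intro continuous_map_Tr continuous_map_fst continuous_map_comp[OF continuous_map_fst continuous_map_snd]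
        continuous_map_comp[OF continuous_map_snd continuous_map_snd])
  then show ?thesis
    unfolding homeomorphic_space_def
    by (intro exI[of _ "\<lambda>z. Tr (fst z) (fst (snd z)) (snd (snd z))"] exI[of _ "\<lambda>z. (base z, dir z, par z)"])
      (auto simp: homeomorphic_maps_def continuous_map_up_tuple elim!: topspace_upE)
qed

lemma ups_locally_compact:
  assumes "locally_compact_space S" "Hausdorff_space S" "locally_compact_space T" "Hausdorff_space T"
  shows "locally_compact_space (ups S (pts T) i) \<and> Hausdorff_space (ups S (pts T) i)"
proof (induction i)
  case 0
  then show ?case
    using homeomorphic_locally_compact_space[OF pts_homeomorphic[of T]] homeomorphic_Hausdorff_space[OF pts_homeomorphic[of T]] assms
    by auto
next
  case (Suc i)
  let ?X = "ups S (pts T) i"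
  have "locally_compact_space (prod_topology ?X (prod_topology ?X S))" "Hausdorff_space (prod_topology ?X (prod_topology ?X S))"
    using Suc assms by (auto simp: locally_compact_space_prod_topology Hausdorff_space_prod_topology)
  then show ?case
    using homeomorphic_locally_compact_space[OF up_homeomorphic[of ?X S]] homeomorphic_Hausdorff_space[OF up_homeomorphic[of ?X S]]
    by auto
qed

lemma finite_dimensional_locally_compact:
  assumes "finite_dimensional_tvs S Z" "locally_compact_space S"
  shows "locally_compact_space (topo Z)"
proof -
  from assms(1) obtain d b where h: "homeomorphic_map (product_topology (\<lambda>_. S) {..<d::nat}) (topo Z)
      (\<lambda>c. \<Sum>i<d. scal Z (c i) (b i))"
    by (auto simp: finite_dimensional_tvs_def)
  then have "product_topology (\<lambda>_. S) {..<d} homeomorphic_space topo Z"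
    using homeomorphic_map_imp_homeomorphic_space by blast
  moreover have "locally_compact_space (product_topology (\<lambda>_. S) {..<d})"
    using assms(2) by (simp add: locally_compact_space_product_topology)
  ultimately show ?thesis by (rule homeomorphic_locally_compact_spaceD[rotated])
qed

lemma tower_dom_locally_compact:
  assumes "locally_compact_space S" "finite_dimensional_tvs S Z" "openin (topo Z) V"
  shows "locally_compact_space (tower_dom_topology S Z V i)" "Hausdorff_space (tower_dom_topology S Z V i)"
proof -
  interpret Z: topological_vector_space S Z using assms(2) by (simp add: finite_dimensional_tvs_def)
  have *: "locally_compact_space (tower_topology S (topo Z) i)" "Hausdorff_space (tower_topology S (topo Z) i)"
    using ups_locally_compact[OF assms(1) Z.Hausdorff finite_dimensional_locally_compact[OF assms(2,1)] Z.Hausdorff_space]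
    by (auto simp: tower_topology_ups)
  have "openin (tower_topology S (topo Z) i) (tower_dom S Z V i)"
    unfolding tower_topology_ups tower_dom_tdom
    by (rule openin_tdom[OF Z.topological_field_axioms Z.good_vline]) (simp add: openin_pts_image assms(3))
  then show "locally_compact_space (tower_dom_topology S Z V i)" "Hausdorff_space (tower_dom_topology S Z V i)"
    using * by (auto intro: locally_compact_space_open_subset Hausdorff_space_subtopology)
qed

section \<open>Spaces of compactly supported maps\<close>

lemma iter_quotient_cong:
  assumes "\<And>x. x \<in> U \<Longrightarrow> f x = g x"
  shows "iter_quotient S E U F f j = iter_quotient S E U F g j"
proof (induction j)
  case 0
  then show ?case using assms by (auto simp: fun_eq_iff)
qed simp

lemma Ck_nat_cong:
  assumes "\<And>x. x \<in> U \<Longrightarrow> f x = g x" "Ck_nat S E U F n f"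
  shows "Ck_nat S E U F n g"
  using assms(2)
proof (induction n)
  case 0
  then show ?case using assms(1) by (auto intro: continuous_map_eq)
next
  case (Suc n)
  have "iter_quotient S E U F f n = iter_quotient S E U F g n"
    by (rule iter_quotient_cong) (rule assms(1))
  with Suc show ?case by simp
qed

lemma is_chartD:
  assumes "is_chart T TZ (U, \<kappa>)"
  shows "openin T U" "openin TZ (\<kappa> ` U)" "inj_on \<kappa> U" "U \<subseteq> topspace T"
    "continuous_map (subtopology T U) (subtopology TZ (\<kappa> ` U)) \<kappa>"
proof -
  show *: "openin T U" "openin TZ (\<kappa> ` U)" using assms by (auto simp: is_chart_def)
  then show U: "U \<subseteq> topspace T" by (simp add: openin_subset)
  have h: "homeomorphic_map (subtopology T U) (subtopology TZ (\<kappa> ` U)) \<kappa>"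
    using assms by (auto simp: is_chart_def)
  show "inj_on \<kappa> U"
    using homeomorphic_imp_injective_map[OF h] U by (simp add: inf.absorb2)
  show "continuous_map (subtopology T U) (subtopology TZ (\<kappa> ` U)) \<kappa>"
    using homeomorphic_imp_continuous_map[OF h] .
qed

lemma (in manifold) chart_in_atlas: "c \<in> atlas M \<Longrightarrow> is_chart (mtop M) (topo Z) c"
  using maximal by (auto simp: maximal_atlas_def)

lemma (in manifold) charts_compatible: "c \<in> atlas M \<Longrightarrow> c' \<in> atlas M \<Longrightarrow> compatible S r Z c c'"
  using maximal by (auto simp: maximal_atlas_def)

lemma (in manifold) obtain_chart:
  assumes "x \<in> topspace (mtop M)"
  obtains U \<kappa> where "(U, \<kappa>) \<in> atlas M" "x \<in> U"
  using assms covering by fastforce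

lemma param_CV_add:
  assumes "topological_vector_space S Z" "topological_vector_space S E" "openin (topo Z) V"
    "param_CV S Z V E n A \<phi>" "param_CV S Z V E n A \<psi>"
  shows "param_CV S Z V E n A (\<lambda>a z. \<phi> a z + \<psi> a z)"
  using assms(4,5) openin_subset[OF assms(3)] unfolding param_CV_def by (intro CV_add[OF assms(2)]) auto

text \<open>The scalar depends on the parameter alone, so it is constant along lines and the product
  rule applies.\<close>

lemma param_CV_scal:
  assumes ext: "extends K S" and Z: "topological_vector_space S Z" and E: "topological_vector_space K E"
    and V: "openin (topo Z) V" and "param_CV S Z V E n A \<phi>" "continuous_map A K p"
  shows "param_CV S Z V E n A (\<lambda>a z. scal E (p a) (\<phi> a z))"
  unfolding param_CV_def
proof (rule CV_scal[OF ext E])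
  interpret Z: topological_vector_space S Z by fact
  have "topological_field K" using ext by (simp add: extends_def)
  then interpret K: topological_vector_space S "kvs K" using tvs_restrict[OF ext tvs_kvs] by blast
  show "good S (pline cline (vline Z)) (pts (prod_topology A (topo Z)))" by (rule Z.good_param)
  show sub: "Pt ` (topspace A \<times> V) \<subseteq> topspace (pts (prod_topology A (topo Z)))"
    using openin_subset[OF V] by auto
  have "CV S (pline cline (vline Z)) n (pts (prod_topology A (topo Z))) (Pt ` (topspace A \<times> V)) (kvs K) (\<lambda>w. p (fst (pt w)))"
  proof (rule CL_locally_const[OF _ sub])
    show "continuous_map (subtopology (pts (prod_topology A (topo Z))) (Pt ` (topspace A \<times> V))) (topo (kvs K)) (\<lambda>w. p (fst (pt w)))"
      using continuous_map_comp[OF assms(6) continuous_map_comp[OF continuous_map_fst continuous_map_pt]]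
      by (auto intro: continuous_map_from_subtopology)
    show "0 \<in> topspace (topo (kvs K))" by (rule K.zero_mem)
  qed (auto simp: pline_def cline_def sline_def)
  then show "CL S (pline cline (vline Z)) n (pts (prod_topology A (topo Z))) (Pt ` (topspace A \<times> V)) sline K (\<lambda>w. p (fst (pt w)))"
    by simp
qed (use assms(5) in \<open>simp add: param_CV_def\<close>)

section \<open>The function space as a topological vector space over the larger field\<close>

locale compact_support =
  fixes TF TK :: "'k::field topology" and Z :: "('k, 'z::ab_group_add) tvs" and M :: "('m, 'z) mfd"
    and K :: "'m set" and r :: enat
  assumes locally_compact: "locally_compact_space TF" and ext: "extends TK TF"
    and finite_dimensional: "finite_dimensional_tvs TF Z" and manifold_M: "manifold TF Z r M"
    and compact_K: "compactin (mtop M) K"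
begin

sublocale M: manifold TF Z r M by (rule manifold_M)

sublocale TK: topological_field TK using ext by (simp add: extends_def)

abbreviation C where "C E \<equiv> CrK TF Z M K E r"

lemma Z: "topological_vector_space TF Z" ..

lemma K_subset: "K \<subseteq> topspace (mtop M)"
  by (rule compactin_subset_topspace[OF compact_K])

text \<open>\<open>K\<close> is closed, being compact in a Hausdorff space, so the support condition
  can be tested pointwise.\<close>

lemma zero_off_K_iff:
  "zero_off (topspace (mtop M)) \<gamma> \<and> supp (mtop M) \<gamma> \<subseteq> K \<longleftrightarrow> zero_off K \<gamma>"
proof
  assume *: "zero_off (topspace (mtop M)) \<gamma> \<and> supp (mtop M) \<gamma> \<subseteq> K"
  have "{x \<in> topspace (mtop M). \<gamma> x \<noteq> 0} \<subseteq> supp (mtop M) \<gamma>"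
    unfolding supp_def by (rule closure_of_subset) auto
  with * show "zero_off K \<gamma>" by (auto simp: zero_off_def)
next
  assume *: "zero_off K \<gamma>"
  have "closedin (mtop M) K" using M.Hausdorff_mtop compact_K by (rule compactin_imp_closedin)
  then have "supp (mtop M) \<gamma> \<subseteq> K"
    unfolding supp_def by (intro closure_of_minimal) (use * in \<open>auto simp: zero_off_def\<close>)
  with * K_subset show "zero_off (topspace (mtop M)) \<gamma> \<and> supp (mtop M) \<gamma> \<subseteq> K"
    by (auto simp: zero_off_def)
qed

lemma topspace_C: "topspace (topo (C E)) = {\<gamma>. Ck_mfd_to_tvs TF Z M E r \<gamma> \<and> zero_off K \<gamma>}"
  using zero_off_K_iff by (auto simp: CrK_def Cr_mfd_topology_def)

text \<open>Does not mention the topology of the function space, hence can be checked by the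
  calculus with parameters. For maps vanishing off \<open>K\<close>,
  \<open>plot_imp_continuous_map\<close> and \<open>continuous_map_imp_plot\<close> show that it
  amounts to continuity into \<open>C E\<close>.\<close>

definition plot :: "('k, 'e::ab_group_add) tvs \<Rightarrow> 'a topology \<Rightarrow> ('a \<Rightarrow> 'm \<Rightarrow> 'e) \<Rightarrow> bool" where
  "plot E A \<phi> \<longleftrightarrow> (\<forall>U \<kappa> i. (U, \<kappa>) \<in> atlas M \<longrightarrow> enat i \<le> r \<longrightarrow>
     param_CV TF Z (\<kappa> ` U) E i A (\<lambda>a z. \<phi> a (inv_into U \<kappa> z)))"

lemma local_rep_eq: "z \<in> \<kappa> ` U \<Longrightarrow> local_rep (U, \<kappa>) \<gamma> z = \<gamma> (inv_into U \<kappa> z)"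
  by (simp add: local_rep_def)

lemma plot_Ck_mfd:
  assumes E: "topological_vector_space TF E" and "plot E A \<phi>" "a \<in> topspace A"
  shows "Ck_mfd_to_tvs TF Z M E r (\<phi> a)"
proof -
  have Ck: "Ck_nat TF Z (\<kappa> ` U) E i (\<phi> a \<circ> inv_into U \<kappa>)" if "(U, \<kappa>) \<in> atlas M" "enat i \<le> r" for U \<kappa> i
    using param_CV_D(1)[OF Z E is_chartD(2)[OF M.chart_in_atlas[OF that(1)]], of i A "\<lambda>a z. \<phi> a (inv_into U \<kappa> z)"]
      assms(2,3) that by (auto simp: plot_def o_def)
  have "continuous_map (subtopology (mtop M) (topspace (mtop M))) (topo E) (\<phi> a)"
  proof (rule continuous_map_local)
    fix x assume "x \<in> topspace (mtop M)"
    then obtain U \<kappa> where U: "(U, \<kappa>) \<in> atlas M" "x \<in> U" by (rule M.obtain_chart)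
    note ch = is_chartD[OF M.chart_in_atlas[OF U(1)]]
    have "continuous_map (subtopology (topo Z) (\<kappa> ` U)) (topo E) (\<phi> a \<circ> inv_into U \<kappa>)"
      using Ck[OF U(1), of 0] by (simp add: zero_enat_def[symmetric])
    from continuous_map_comp[OF this ch(5)]
    have "continuous_map (subtopology (mtop M) U) (topo E) (\<phi> a)"
      by (rule continuous_map_eq) (use ch(3) in auto)
    then show "\<exists>W. openin (mtop M) W \<and> x \<in> W \<and> W \<subseteq> topspace (mtop M) \<and> continuous_map (subtopology (mtop M) W) (topo E) (\<phi> a)"
      using ch(1,4) U(2) by blast
  qed
  then show ?thesis using Ck by (auto simp: Ck_mfd_to_tvs_def Ck_def)
qed

lemma plot_imp_continuous_map:
  assumes E: "topological_vector_space TF E" and p: "plot E A \<phi>"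
    and z: "\<And>a. a \<in> topspace A \<Longrightarrow> zero_off K (\<phi> a)"
  shows "continuous_map A (topo (C E)) \<phi>"
proof -
  have 1: "continuous_map A (Cr_topology TF Z (\<kappa> ` U) E r) (\<lambda>a. local_rep (U, \<kappa>) (\<phi> a))" if U: "(U, \<kappa>) \<in> atlas M" for U \<kappa>
    unfolding Cr_topology_def
  proof (rule continuous_map_into_initial_topology)
    note V = is_chartD(2)[OF M.chart_in_atlas[OF U]]
    note D = param_CV_D[OF Z E V, of _ A "\<lambda>a z. \<phi> a (inv_into U \<kappa> z)"]
    have pc: "param_CV TF Z (\<kappa> ` U) E i A (\<lambda>a z. \<phi> a (inv_into U \<kappa> z))" if "enat i \<le> r" for i
      using p U that by (simp add: plot_def)
    fix a assume a: "a \<in> topspace A"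
    have "Ck_nat TF Z (\<kappa> ` U) E j (local_rep (U, \<kappa>) (\<phi> a))" if "enat j \<le> r" for j
      by (rule Ck_nat_cong[OF _ D(1)[OF pc[OF that] a]]) (simp add: local_rep_eq)
    then show "local_rep (U, \<kappa>) (\<phi> a) \<in> {\<gamma>. Ck TF Z (\<kappa> ` U) E r \<gamma> \<and> zero_off (\<kappa> ` U) \<gamma>}"
      by (auto simp: Ck_def zero_off_def local_rep_def)
  next
    note V = is_chartD(2)[OF M.chart_in_atlas[OF U]]
    fix j assume j: "j \<in> {j. enat j \<le> r}"
    then have pc: "param_CV TF Z (\<kappa> ` U) E j A (\<lambda>a z. \<phi> a (inv_into U \<kappa> z))"
      using p U by (simp add: plot_def)
    have eq: "iter_quotient TF Z (\<kappa> ` U) E (local_rep (U, \<kappa>) (\<phi> a)) j =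
        iter_quotient TF Z (\<kappa> ` U) E (\<lambda>z. \<phi> a (inv_into U \<kappa> z)) j" for a
      by (rule iter_quotient_cong) (simp add: local_rep_eq)
    have VZ: "Pt ` \<kappa> ` U \<subseteq> topspace (pts (topo Z))" using openin_subset[OF V] by auto
    show "continuous_map A (compact_open_topology (tower_dom_topology TF Z (\<kappa> ` U) j) (topo E))
       (\<lambda>a. iter_quotient TF Z (\<kappa> ` U) E (local_rep (U, \<kappa>) (\<phi> a)) j)"
      unfolding eq
    proof (rule continuous_map_into_compact_open)
      show "continuous_map (prod_topology A (tower_dom_topology TF Z (\<kappa> ` U) j)) (topo E)
         (\<lambda>(a, x). iter_quotient TF Z (\<kappa> ` U) E (\<lambda>z. \<phi> a (inv_into U \<kappa> z)) j x)"
        using param_CV_D(2)[OF Z E V pc, of j] by simp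
      fix a assume a: "a \<in> topspace A"
      have "zero_off (tower_dom TF Z (\<kappa> ` U) j) (iter_quotient TF Z (\<kappa> ` U) E (\<lambda>z. \<phi> a (inv_into U \<kappa> z)) j)"
        by (rule zero_off_iter_quotient[OF Z E V param_CV_D(1)[OF Z E V pc a]])
      then show "zero_off (topspace (tower_dom_topology TF Z (\<kappa> ` U) j))
          (iter_quotient TF Z (\<kappa> ` U) E (\<lambda>z. \<phi> a (inv_into U \<kappa> z)) j)"
        using tdom_subset[OF VZ, of TF "vline Z" j]
        by (auto simp: zero_off_def tower_dom_tdom tower_topology_ups)
    qed
  qed
  have "continuous_map A (Cr_mfd_topology TF Z M E r) \<phi>"
    unfolding Cr_mfd_topology_def
  proof (rule continuous_map_into_initial_topology)
    fix a assume "a \<in> topspace A"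
    then show "\<phi> a \<in> {\<gamma>. Ck_mfd_to_tvs TF Z M E r \<gamma> \<and> zero_off (topspace (mtop M)) \<gamma>}"
      using plot_Ck_mfd[OF E p] z zero_off_K_iff by blast
  next
    fix c assume "c \<in> atlas M"
    then show "continuous_map A (case c of (U, \<kappa>) \<Rightarrow> Cr_topology TF Z (\<kappa> ` U) E r) (\<lambda>a. local_rep c (\<phi> a))"
      using 1 by (cases c) simp
  qed
  then show ?thesis
    using z zero_off_K_iff by (auto simp: CrK_def continuous_map_in_subtopology)
qed

text \<open>The universal plot, from which all others arise by reparametrisation. Its quotients are
  jointly continuous as composites of the continuous map \<gamma> \<mapsto> \<gamma>^[i] with the
  evaluation map, which is continuous since the tower domains are locally compact.\<close>

lemma plot_id:
  assumes E: "topological_vector_space TF E"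
  shows "plot E (topo (C E)) (\<lambda>\<gamma>. \<gamma>)"
  unfolding plot_def
proof (intro allI impI)
  fix U \<kappa> and n :: nat assume U: "(U, \<kappa>) \<in> atlas M" and n: "enat n \<le> r"
  note V = is_chartD(2)[OF M.chart_in_atlas[OF U]]
  have VZ: "Pt ` \<kappa> ` U \<subseteq> topspace (pts (topo Z))" using openin_subset[OF V] by auto
  have Ck: "Ck_nat TF Z (\<kappa> ` U) E i (\<lambda>z. \<gamma> (inv_into U \<kappa> z))"
    if "Ck_mfd_to_tvs TF Z M E r \<gamma>" "enat i \<le> r" for \<gamma> i
    using that U by (auto simp: Ck_mfd_to_tvs_def Ck_def o_def)
  have Ck': "Ck_nat TF Z (\<kappa> ` U) E i (local_rep (U, \<kappa>) \<gamma>)"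
    if "Ck_mfd_to_tvs TF Z M E r \<gamma>" "enat i \<le> r" for \<gamma> i
    by (rule Ck_nat_cong[OF _ Ck[OF that]]) (simp add: local_rep_eq)
  show "param_CV TF Z (\<kappa> ` U) E n (topo (C E)) (\<lambda>\<gamma> z. \<gamma> (inv_into U \<kappa> z))"
  proof (rule param_CV_I[OF Z E V])
    fix \<gamma> assume "\<gamma> \<in> topspace (topo (C E))"
    then show "Ck_nat TF Z (\<kappa> ` U) E n (\<lambda>z. \<gamma> (inv_into U \<kappa> z))" using Ck n by (simp add: topspace_C)
  next
    fix i assume "i \<le> n"
    then have i: "enat i \<le> r" using n by (meson enat_ord_simps(1) order_trans)
    let ?Y = "tower_dom_topology TF Z (\<kappa> ` U) i"
    let ?Q = "compact_open_topology ?Y (topo E)"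
    let ?q = "\<lambda>\<gamma>. iter_quotient TF Z (\<kappa> ` U) E \<gamma> i"
    have tY: "topspace ?Y = tower_dom TF Z (\<kappa> ` U) i"
      using tdom_subset[OF VZ, of TF "vline Z" i] by (auto simp: tower_dom_tdom tower_topology_ups)
    have "continuous_map (Cr_topology TF Z (\<kappa> ` U) E r) ?Q ?q"
      unfolding Cr_topology_def
    proof (rule continuous_map_initial_topology[where f = "\<lambda>j \<gamma>. iter_quotient TF Z (\<kappa> ` U) E \<gamma> j"
          and T = "\<lambda>j. compact_open_topology (tower_dom_topology TF Z (\<kappa> ` U) j) (topo E)"])
      fix \<gamma> assume "\<gamma> \<in> {\<gamma>. Ck TF Z (\<kappa> ` U) E r \<gamma> \<and> zero_off (\<kappa> ` U) \<gamma>}"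
      then have *: "Ck_nat TF Z (\<kappa> ` U) E i \<gamma>" using i by (simp add: Ck_def)
      then have "continuous_map ?Y (topo E) (?q \<gamma>)"
        using Ck_nat_dq_seq[OF Z E V *] by (simp add: dq_seq_def tower_dom_tdom tower_topology_ups)
      then show "?q \<gamma> \<in> topspace ?Q" using zero_off_iter_quotient[OF Z E V *] tY by simp
    qed (use i in simp)
    moreover have "continuous_map (topo (C E)) (Cr_topology TF Z (\<kappa> ` U) E r) (local_rep (U, \<kappa>))"
    proof -
      have "continuous_map (Cr_mfd_topology TF Z M E r) ((\<lambda>(U, \<kappa>). Cr_topology TF Z (\<kappa> ` U) E r) (U, \<kappa>)) (local_rep (U, \<kappa>))"
        unfolding Cr_mfd_topology_def
        by (rule continuous_map_initial_topology[OF U])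
          (use Ck' in \<open>auto simp: Cr_topology_def Ck_def zero_off_def local_rep_def\<close>)
      then show ?thesis by (simp add: CrK_def continuous_map_from_subtopology)
    qed
    ultimately have "continuous_map (topo (C E)) ?Q (\<lambda>\<gamma>. ?q (local_rep (U, \<kappa>) \<gamma>))"
      by (rule continuous_map_comp)
    then have "continuous_map (prod_topology (topo (C E)) ?Y) (prod_topology ?Q ?Y) (\<lambda>z. (?q (local_rep (U, \<kappa>) (fst z)), snd z))"
      by (intro continuous_map_pairedI continuous_map_snd continuous_map_comp[OF _ continuous_map_fst])
    from continuous_map_comp[OF continuous_map_compact_open_eval[OF tower_dom_locally_compact[OF locally_compact finite_dimensional V]] this]
    have "continuous_map (prod_topology (topo (C E)) ?Y) (topo E) (\<lambda>z. ?q (local_rep (U, \<kappa>) (fst z)) (snd z))"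
      by simp
    moreover have "?q (local_rep (U, \<kappa>) \<gamma>) = ?q (\<lambda>z. \<gamma> (inv_into U \<kappa> z))" for \<gamma>
      by (rule iter_quotient_cong) (simp add: local_rep_eq)
    ultimately show "continuous_map (prod_topology (topo (C E)) ?Y) (topo E)
        (\<lambda>(\<gamma>, v). iter_quotient TF Z (\<kappa> ` U) E (\<lambda>z. \<gamma> (inv_into U \<kappa> z)) i v)"
      by (simp add: case_prod_unfold)
  qed
qed

lemma plot_reparametrise:
  assumes "plot E A \<phi>" "continuous_map A' A q"
  shows "plot E A' (\<lambda>a. \<phi> (q a))"
  using assms unfolding plot_def
  by (auto intro!: param_CV_reparametrise[OF assms(2), where \<phi> = "\<lambda>a z. \<phi> a (inv_into _ _ z)"]
      openin_subset is_chartD(2)[OF M.chart_in_atlas])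

lemma continuous_map_imp_plot:
  "topological_vector_space TF E \<Longrightarrow> continuous_map A (topo (C E)) \<phi> \<Longrightarrow> plot E A \<phi>"
  using plot_reparametrise[OF plot_id] by blast

lemma C_value:
  assumes "topological_vector_space TF E" "\<gamma> \<in> topspace (topo (C E))"
  shows "\<gamma> x \<in> topspace (topo E)"
proof -
  interpret E: topological_vector_space TF E by fact
  show ?thesis
  proof (cases "x \<in> K")
    case True
    then show ?thesis
      using assms(2) K_subset continuous_map_topspaceD[of "mtop M" "topo E" \<gamma> x]
      by (auto simp: topspace_C Ck_mfd_to_tvs_def)
  next
    case False
    then show ?thesis using assms(2) E.zero_mem by (simp add: topspace_C zero_off_def)
  qed
qed

text \<open>The order 0 case of \<open>plot_id\<close>, glued over the charts of \<open>M\<close>.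
  It provides the Hausdorff property, the openness of \<open>CrK_into\<close> and the continuity of
  point evaluations.\<close>

lemma continuous_map_C_eval:
  assumes E: "topological_vector_space TF E"
  shows "continuous_map (prod_topology (topo (C E)) (mtop M)) (topo E) (\<lambda>(\<gamma>, x). \<gamma> x)"
proof -
  let ?P = "prod_topology (topo (C E)) (mtop M)"
  have "continuous_map (subtopology ?P (topspace ?P)) (topo E) (\<lambda>(\<gamma>, x). \<gamma> x)"
  proof (rule continuous_map_local)
    fix p assume p: "p \<in> topspace ?P"
    then obtain U \<kappa> where U: "(U, \<kappa>) \<in> atlas M" "snd p \<in> U" by (auto elim: M.obtain_chart)
    note ch = is_chartD[OF M.chart_in_atlas[OF U(1)]]
    let ?W = "topspace (topo (C E)) \<times> U"
    let ?T = "pts (prod_topology (topo (C E)) (topo Z)) :: (('m \<Rightarrow> _) \<times> _, 'k) tower topology"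
    have "param_CV TF Z (\<kappa> ` U) E 0 (topo (C E)) (\<lambda>\<gamma> z. \<gamma> (inv_into U \<kappa> z))"
      using plot_id[OF E] U by (simp add: plot_def zero_enat_def[symmetric])
    then have 1: "continuous_map (subtopology ?T (Pt ` (topspace (topo (C E)) \<times> \<kappa> ` U))) (topo E)
       (\<lambda>w. fst (pt w) (inv_into U \<kappa> (snd (pt w))))"
      by (simp add: param_CV_def CL_0)
    have k: "continuous_map (subtopology (mtop M) U) (topo Z) \<kappa>"
      using ch(5) by (rule continuous_map_into_fulltopology)
    have "continuous_map (prod_topology (topo (C E)) (subtopology (mtop M) U)) ?T (\<lambda>z. Pt (fst z, \<kappa> (snd z)))"
      unfolding continuous_map_Pt
      by (intro continuous_map_pairedI continuous_map_fst continuous_map_comp[OF k continuous_map_snd])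
    then have "continuous_map (prod_topology (topo (C E)) (subtopology (mtop M) U))
       (subtopology ?T (Pt ` (topspace (topo (C E)) \<times> \<kappa> ` U))) (\<lambda>z. Pt (fst z, \<kappa> (snd z)))"
      by (auto simp: continuous_map_in_subtopology)
    from continuous_map_comp[OF 1 this]
    have "continuous_map (prod_topology (topo (C E)) (subtopology (mtop M) U)) (topo E) (\<lambda>(\<gamma>, x). \<gamma> x)"
      by (rule continuous_map_eq) (use ch(3) in auto)
    moreover have "prod_topology (topo (C E)) (subtopology (mtop M) U) = subtopology ?P ?W"
      by (simp add: subtopology_Times)
    ultimately have "continuous_map (subtopology ?P ?W) (topo E) (\<lambda>(\<gamma>, x). \<gamma> x)" by simp
    moreover have "openin ?P ?W" using ch(1) by (simp add: openin_prod_Times_iff)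
    ultimately show "\<exists>W. openin ?P W \<and> p \<in> W \<and> W \<subseteq> topspace ?P \<and> continuous_map (subtopology ?P W) (topo E) (\<lambda>(\<gamma>, x). \<gamma> x)"
      using p U(2) ch(4) by (intro exI[of _ ?W]) (auto simp: mem_Times_iff)
  qed
  then show ?thesis by (simp only: subtopology_topspace)
qed

text \<open>The projections from a product with \<open>C E\<close> are plots, and plots are closed
  under sums and under multiplication with continuous \<open>TK\<close>-valued functions of the
  parameter. Points are separated by evaluations.\<close>

lemma tvs_C:
  assumes EK: "topological_vector_space TK E"
  shows "topological_vector_space TK (C E)"
proof -
  have E: "topological_vector_space TF E" using ext EK by (rule tvs_restrict)
  interpret E: topological_vector_space TK E by fact
  interpret EF: topological_vector_space TF E by fact
  note V = is_chartD(2)[OF M.chart_in_atlas]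
  let ?C = "topo (C E)"
  have zo: "\<gamma> x = 0" if "\<gamma> \<in> topspace ?C" "x \<notin> K" for \<gamma> x
    using that by (simp add: topspace_C zero_off_def)
  note val = C_value[OF E]
  have sc: "scal (C E) = (\<lambda>a \<gamma> x. scal E a (\<gamma> x))" by (simp add: CrK_def)
  have Haus: "Hausdorff_space ?C"
    unfolding Hausdorff_space_def
  proof (intro allI impI)
    fix \<gamma> \<eta> assume *: "\<gamma> \<in> topspace ?C \<and> \<eta> \<in> topspace ?C \<and> \<gamma> \<noteq> \<eta>"
    then obtain x where x: "\<gamma> x \<noteq> \<eta> x" by blast
    with * zo have "x \<in> K" by metis
    then have "x \<in> topspace (mtop M)" using K_subset by blast
    then have "continuous_map ?C (prod_topology ?C (mtop M)) (\<lambda>\<gamma>. (\<gamma>, x))"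
      by (simp add: continuous_map_pairedI)
    from continuous_map_comp[OF continuous_map_C_eval[OF E] this]
    have c: "continuous_map ?C (topo E) (\<lambda>\<gamma>. \<gamma> x)" by simp
    obtain A B where AB: "openin (topo E) A" "openin (topo E) B" "\<gamma> x \<in> A" "\<eta> x \<in> B" "disjnt A B"
      using E.Hausdorff_space val * x unfolding Hausdorff_space_def by metis
    show "\<exists>A B. openin ?C A \<and> openin ?C B \<and> \<gamma> \<in> A \<and> \<eta> \<in> B \<and> disjnt A B"
      using openin_continuous_map_preimage_in[OF c AB(1)] openin_continuous_map_preimage_in[OF c AB(2)] AB *
      by (intro exI[of _ "{\<gamma> \<in> topspace ?C. \<gamma> x \<in> A}"] exI[of _ "{\<gamma> \<in> topspace ?C. \<gamma> x \<in> B}"])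
        (auto simp: disjnt_def)
  qed
  have zero: "0 \<in> topspace ?C"
  proof -
    \<comment> \<open>A plot over a one-point space is a single element, so membership of 0 follows
      from the rule for plots, too.\<close>
    have "plot E (discrete_topology UNIV) (\<lambda>_::unit. 0)"
      unfolding plot_def param_CV_def
    proof (intro allI impI)
      fix U \<kappa> i assume "(U, \<kappa>) \<in> atlas M"
      from openin_subset[OF V[OF this]] have "Pt ` (topspace (discrete_topology UNIV) \<times> \<kappa> ` U) \<subseteq> topspace (pts (prod_topology (discrete_topology (UNIV::unit set)) (topo Z)))"
        by (auto simp: image_subset_iff)
      from CV_const[OF E EF.zero_mem this]
      show "CV TF (pline cline (vline Z)) i (pts (prod_topology (discrete_topology (UNIV::unit set)) (topo Z)))
          (Pt ` (topspace (discrete_topology UNIV) \<times> \<kappa> ` U)) E (\<lambda>w. 0 (inv_into U \<kappa> (snd (pt w))))"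
        by simp
    qed
    from plot_imp_continuous_map[OF E this] have "continuous_map (discrete_topology (UNIV::unit set)) ?C (\<lambda>_. 0)"
      by (simp add: zero_off_def)
    from continuous_map_topspaceD[OF this] show ?thesis by simp
  qed
  have plus: "continuous_map (prod_topology ?C ?C) ?C (\<lambda>z. fst z + snd z)"
  proof (rule plot_imp_continuous_map[OF E])
    have p: "plot E (prod_topology ?C ?C) fst" "plot E (prod_topology ?C ?C) snd"
      using continuous_map_imp_plot[OF E] continuous_map_fst continuous_map_snd by blast+
    show "plot E (prod_topology ?C ?C) (\<lambda>z. fst z + snd z)"
      unfolding plot_def
    proof (intro allI impI)
      fix U \<kappa> i assume U: "(U, \<kappa>) \<in> atlas M" "enat i \<le> r"
      show "param_CV TF Z (\<kappa> ` U) E i (prod_topology ?C ?C) (\<lambda>a z. (fst a + snd a) (inv_into U \<kappa> z))"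
        using p U by (auto simp: plot_def intro!: param_CV_add[OF Z E V[OF U(1)]])
    qed
  qed (auto simp: zero_off_def zo)
  have smul: "continuous_map (prod_topology TK ?C) ?C (\<lambda>z x. scal E (fst z) (snd z x))"
  proof (rule plot_imp_continuous_map[OF E])
    have p: "plot E (prod_topology TK ?C) snd"
      using continuous_map_imp_plot[OF E] continuous_map_snd by blast
    show "plot E (prod_topology TK ?C) (\<lambda>z x. scal E (fst z) (snd z x))"
      unfolding plot_def
    proof (intro allI impI)
      fix U \<kappa> i assume U: "(U, \<kappa>) \<in> atlas M" "enat i \<le> r"
      show "param_CV TF Z (\<kappa> ` U) E i (prod_topology TK ?C) (\<lambda>a z. scal E (fst a) (snd a (inv_into U \<kappa> z)))"
        using p U by (auto simp: plot_def intro!: param_CV_scal[OF ext Z EK V[OF U(1)] _ continuous_map_fst])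
    qed
  qed (auto simp: zero_off_def E.scal_zero_right zo)
  show ?thesis
    unfolding topological_vector_space_def topological_vector_space_axioms_def
    using Haus zero plus smul val
    by (auto simp: sc case_prod_unfold TK.topological_field_axioms fun_eq_iff E.scal_add_right E.scal_add_left
      E.scal_scal E.scal_one)
qed

text \<open>The evaluation map is continuous and \<open>K\<close> compact, so by the tube lemma all
  maps near \<gamma> send \<open>K\<close> into \<open>U\<close>. Off \<open>K\<close> they take the
  value 0, which lies in \<open>U\<close> if there are such points.\<close>

lemma openin_CrK_into:
  assumes E: "topological_vector_space TF E" and U: "openin (topo E) U"
    and 0: "K \<noteq> topspace (mtop M) \<Longrightarrow> 0 \<in> U"
  shows "openin (topo (C E)) (CrK_into TF Z M K E r U)"
proof -
  let ?P = "prod_topology (topo (C E)) (mtop M)"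
  define N where "N = {z \<in> topspace ?P. (\<lambda>(\<gamma>, x). \<gamma> x) z \<in> U}"
  have N: "openin ?P N"
    unfolding N_def by (rule openin_continuous_map_preimage_in[OF continuous_map_C_eval[OF E] U])
  show ?thesis
  proof (subst openin_subopen, intro ballI)
    fix \<gamma> assume "\<gamma> \<in> CrK_into TF Z M K E r U"
    then have \<gamma>: "\<gamma> \<in> topspace (topo (C E))" "{\<gamma>} \<times> K \<subseteq> N"
      using K_subset by (auto simp: CrK_into_def N_def)
    from tube_lemma_right[OF N compact_K this] obtain O1 O2
      where O12: "openin (topo (C E)) O1" "\<gamma> \<in> O1" "K \<subseteq> O2" "O1 \<times> O2 \<subseteq> N" by metis
    have "O1 \<subseteq> CrK_into TF Z M K E r U"
    proof
      fix \<eta> assume \<eta>: "\<eta> \<in> O1"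
      then have "\<eta> \<in> topspace (topo (C E))" using openin_subset[OF O12(1)] by blast
      moreover have "\<eta> x \<in> U" if "x \<in> topspace (mtop M)" for x
      proof (cases "x \<in> K")
        case True
        then have "(\<eta>, x) \<in> N" using \<eta> O12(3,4) by blast
        then show ?thesis by (simp add: N_def)
      next
        case False
        then have "K \<noteq> topspace (mtop M)" "\<eta> x = 0"
          using that calculation by (auto simp: topspace_C zero_off_def)
        then show ?thesis using 0 by simp
      qed
      ultimately show "\<eta> \<in> CrK_into TF Z M K E r U" by (auto simp: CrK_into_def)
    qed
    with O12 show "\<exists>T. openin (topo (C E)) T \<and> \<gamma> \<in> T \<and> T \<subseteq> CrK_into TF Z M K E r U" by blast
  qed
qed

end

section \<open>Product charts\<close>

lemma topo_prod_tvs [simp]: "topo (prod_tvs E F) = prod_topology (topo E) (topo F)"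
  by (simp add: prod_tvs_def)

lemma is_chart_prod:
  assumes "is_chart T TZ (A, f)" "is_chart T' TZ' (B, g)"
  shows "is_chart (prod_topology T T') (prod_topology TZ TZ') (A \<times> B, map_prod f g)"
proof -
  obtain f' where f: "homeomorphic_maps (subtopology T A) (subtopology TZ (f ` A)) f f'"
    using assms(1) by (auto simp: is_chart_def homeomorphic_map_maps)
  obtain g' where g: "homeomorphic_maps (subtopology T' B) (subtopology TZ' (g ` B)) g g'"
    using assms(2) by (auto simp: is_chart_def homeomorphic_map_maps)
  have "homeomorphic_maps (prod_topology (subtopology T A) (subtopology T' B))
    (prod_topology (subtopology TZ (f ` A)) (subtopology TZ' (g ` B))) (\<lambda>(x, y). (f x, g y)) (\<lambda>(x, y). (f' x, g' y))"
    using f g by (simp add: homeomorphic_maps_prod)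
  moreover have "(\<lambda>(x, y). (f x, g y)) = map_prod f g" by (auto simp: fun_eq_iff)
  ultimately have "homeomorphic_map (prod_topology (subtopology T A) (subtopology T' B))
    (prod_topology (subtopology TZ (f ` A)) (subtopology TZ' (g ` B))) (map_prod f g)"
    using homeomorphic_map_maps by metis
  moreover have "map_prod f g ` (A \<times> B) = f ` A \<times> g ` B" by (rule map_prod_surj_on[OF refl refl])
  ultimately show ?thesis
    using is_chartD(1,2)[OF assms(1)] is_chartD(1,2)[OF assms(2)]
    by (simp add: is_chart_def subtopology_Times openin_prod_Times_iff)
qed

lemma chart_image_open:
  assumes "is_chart T TZ (A, f)" "openin T W" "W \<subseteq> A"
  shows "openin TZ (f ` W)"
proof -
  have h: "homeomorphic_map (subtopology T A) (subtopology TZ (f ` A)) f"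
    using assms(1) by (auto simp: is_chart_def)
  have "openin (subtopology T A) W"
    using assms(2,3) by (auto simp: openin_subtopology)
  then have "openin (subtopology TZ (f ` A)) (f ` W)"
    using homeomorphic_map_openness[OF h] openin_subset by metis
  then show ?thesis using is_chartD(2)[OF assms(1)] by (rule openin_trans_full)
qed

lemma Ck_cong: "(\<And>x. x \<in> U \<Longrightarrow> f x = g x) \<Longrightarrow> Ck S E U F k f \<Longrightarrow> Ck S E U F k g"
  unfolding Ck_def using Ck_nat_cong[of U f g] by blast

lemma Ck_map_prod:
  assumes E: "topological_vector_space S E" and E': "topological_vector_space S E'"
    and F: "topological_vector_space S F" and F': "topological_vector_space S F'"
    and U: "openin (topo E) U" and U': "openin (topo E') U'"
    and "Ck S E U F k f" "Ck S E' U' F' k g"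
  shows "Ck S (prod_tvs E E') (U \<times> U') (prod_tvs F F') k (map_prod f g)"
  unfolding Ck_def
proof (intro allI impI)
  fix j assume j: "enat j \<le> k"
  let ?T = "pts (prod_topology (topo E) (topo E'))" and ?l = "pline (vline E) (vline E')" and ?V = "Pt ` (U \<times> U')"
  have sub: "?V \<subseteq> topspace ?T" using openin_subset[OF U] openin_subset[OF U'] by auto
  have 1: "Cn S ?l (vline E) j ?T ?V (pts (topo E)) (\<lambda>w. Pt (fst (pt w)))"
    by (rule Cn_linear[OF _ sub]) (auto simp: continuous_map_Pt continuous_map_comp[OF continuous_map_fst continuous_map_pt])
  have 2: "Cn S ?l (vline E') j ?T ?V (pts (topo E')) (\<lambda>w. Pt (snd (pt w)))"
    by (rule Cn_linear[OF _ sub]) (auto simp: continuous_map_Pt continuous_map_comp[OF continuous_map_snd continuous_map_pt])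
  have f: "CV S (vline E) j (pts (topo E)) (Pt ` U) F (\<lambda>w. f (pt w))"
    and g: "CV S (vline E') j (pts (topo E')) (Pt ` U') F' (\<lambda>w. g (pt w))"
    using assms(7,8) j Ck_nat_iff_CV[OF E F U] Ck_nat_iff_CV[OF E' F' U'] by (auto simp: Ck_def)
  note c1 = CL_comp[OF 1 f _ sub, unfolded tower.sel] and c2 = CL_comp[OF 2 g _ sub, unfolded tower.sel]
  have "CV S ?l j ?T ?V F (\<lambda>w. f (fst (pt w)))" by (rule c1) auto
  moreover have "CV S ?l j ?T ?V F' (\<lambda>w. g (snd (pt w)))" by (rule c2) auto
  ultimately have "CL S ?l j ?T ?V (pline (vline F) (vline F')) (prod_topology (topo F) (topo F')) (\<lambda>w. (f (fst (pt w)), g (snd (pt w))))"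
    by (rule CL_pair[OF _ _ sub])
  then have "CV S (vline (prod_tvs E E')) j (pts (topo (prod_tvs E E'))) ?V (prod_tvs F F') (\<lambda>w. map_prod f g (pt w))"
    by (simp add: vline_prod_tvs map_prod_def case_prod_unfold)
  then show "Ck_nat S (prod_tvs E E') (U \<times> U') (prod_tvs F F') j (map_prod f g)"
    using U U' by (subst Ck_nat_iff_CV[OF tvs_prod_tvs[OF E E'] tvs_prod_tvs[OF F F']]) (auto simp: openin_prod_Times_iff)
qed

lemma Ck_product_charts:
  assumes E: "topological_vector_space S E" and E': "topological_vector_space S E'"
    and A: "is_chart T (topo E) (A, f)" and A': "openin T A'"
    and B: "is_chart T' (topo E') (B, g)" and B': "openin T' B'"
    and "Ck S E (f ` (A \<inter> A')) E k (f' \<circ> inv_into A f)" "Ck S E' (g ` (B \<inter> B')) E' k (g' \<circ> inv_into B g)"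
  shows "Ck S (prod_tvs E E') (map_prod f g ` (A \<times> B \<inter> A' \<times> B')) (prod_tvs E E') k
    (map_prod f' g' \<circ> inv_into (A \<times> B) (map_prod f g))"
proof -
  have i: "inj_on f A" "inj_on g B" using is_chartD(3) A B by blast+
  have eq: "map_prod f g ` (A \<times> B \<inter> A' \<times> B') = f ` (A \<inter> A') \<times> g ` (B \<inter> B')"
    by (auto simp: Times_Int_Times map_prod_surj_on[OF refl refl])
  have "openin (topo E) (f ` (A \<inter> A'))" "openin (topo E') (g ` (B \<inter> B'))"
    using chart_image_open[OF A] chart_image_open[OF B] is_chartD(1)[OF A] is_chartD(1)[OF B] A' B' by auto
  from Ck_map_prod[OF E E' E E' this assms(7,8)] show ?thesis
    unfolding eq
  proof (rule Ck_cong[rotated])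
    fix x assume "x \<in> f ` (A \<inter> A') \<times> g ` (B \<inter> B')"
    then obtain a b where ab: "x = map_prod f g (a, b)" "a \<in> A" "b \<in> B" by auto
    have "inv_into (A \<times> B) (map_prod f g) x = (a, b)"
      unfolding ab(1) by (rule inv_into_f_f[OF map_prod_inj_on[OF i]]) (use ab in simp)
    then show "map_prod (f' \<circ> inv_into A f) (g' \<circ> inv_into B g) x = (map_prod f' g' \<circ> inv_into (A \<times> B) (map_prod f g)) x"
      using ab i by simp
  qed
qed

text \<open>The product atlas is generated by products with all charts of \<open>U\<close>, so
  \<kappa> x id has to be compatible with products involving an arbitrary chart \<phi> of
  \<open>U\<close>, not only the identity.\<close>

lemma product_chart_open_mfd:
  assumes "manifold S Z R M" and E: "topological_vector_space S E" and U: "openin (topo E) U"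
    and A: "(A, \<kappa>) \<in> atlas M"
  shows "(A \<times> U, map_prod \<kappa> (\<lambda>x. x)) \<in> atlas (prod_mfd S R Z M E (open_mfd S R E U))"
proof -
  interpret M: manifold S Z R M by fact
  have Z: "topological_vector_space S Z" ..
  have idU: "is_chart (subtopology (topo E) U) (topo E) (U, \<lambda>x. x)"
    using U openin_subset[OF U]
    by (auto simp: is_chart_def subtopology_subtopology openin_subtopology homeomorphic_map_maps homeomorphic_maps_def
        intro!: exI[of _ "\<lambda>x. x"])
  note chA = M.chart_in_atlas[OF A]
  have "compatible S R (prod_tvs Z E) (A \<times> U, map_prod \<kappa> (\<lambda>x. x)) (A' \<times> B, map_prod \<kappa>' \<phi>)"
    if A': "(A', \<kappa>') \<in> atlas M" and B: "(B, \<phi>) \<in> atlas (open_mfd S R E U)" for A' \<kappa>' B \<phi>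
  proof -
    have chB: "is_chart (subtopology (topo E) U) (topo E) (B, \<phi>)"
      and cB: "Ck S E (\<phi> ` (B \<inter> U)) E R ((\<lambda>x. x) \<circ> inv_into B \<phi>)" "Ck S E ((\<lambda>x. x) ` (U \<inter> B)) E R (\<phi> \<circ> inv_into U (\<lambda>x. x))"
      using B by (auto simp: open_mfd_def maximal_atlas_def compatible_def Int_commute)
    have cA: "Ck S Z (\<kappa> ` (A \<inter> A')) Z R (\<kappa>' \<circ> inv_into A \<kappa>)" "Ck S Z (\<kappa>' ` (A' \<inter> A)) Z R (\<kappa> \<circ> inv_into A' \<kappa>')"
      using M.charts_compatible[OF A A'] by (auto simp: compatible_def Int_commute)
    note chA' = M.chart_in_atlas[OF A']
    show ?thesis
      using Ck_product_charts[OF Z E chA is_chartD(1)[OF chA'] idU is_chartD(1)[OF chB] cA(1) cB(2)]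
        Ck_product_charts[OF Z E chA' is_chartD(1)[OF chA] chB is_chartD(1)[OF idU] cA(2) cB(1)]
      by (simp add: compatible_def Int_commute)
  qed
  then show ?thesis
    using is_chart_prod[OF chA idU] by (auto simp: prod_mfd_def maximal_atlas_def open_mfd_def)
qed

text \<open>Moves a map on the product manifold to an open set of the product vector space. The
  charts \<kappa> x id leave the second variable unchanged, so the variable in \<open>U\<close>
  remains the original one.\<close>

lemma Ck_in_product_chart:
  assumes M: "manifold S Z R M" and E: "topological_vector_space S E" and U: "openin (topo E) U"
    and A: "(A, \<kappa>) \<in> atlas M"
    and f: "Ck_mfd_to_tvs S (prod_tvs Z E) (prod_mfd S R Z M E (open_mfd S R E U)) F R f"
  shows "Ck S (prod_tvs Z E) (\<kappa> ` A \<times> U) F R (\<lambda>z. f (inv_into A \<kappa> (fst z), snd z))"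
proof -
  interpret M: manifold S Z R M by fact
  have i: "inj_on (map_prod \<kappa> (\<lambda>x. x)) (A \<times> U)"
    by (intro map_prod_inj_on is_chartD(3)[OF M.chart_in_atlas[OF A]]) simp
  have eq: "map_prod \<kappa> (\<lambda>x. x) ` (A \<times> U) = \<kappa> ` A \<times> U" by (rule map_prod_surj_on) auto
  have "Ck S (prod_tvs Z E) (\<kappa> ` A \<times> U) F R (f \<circ> inv_into (A \<times> U) (map_prod \<kappa> (\<lambda>x. x)))"
    using product_chart_open_mfd[OF M E U A] f eq by (force simp: Ck_mfd_to_tvs_def)
  then show ?thesis
  proof (rule Ck_cong[rotated])
    fix z assume "z \<in> \<kappa> ` A \<times> U"
    then obtain a where a: "a \<in> A" "fst z = \<kappa> a" "snd z \<in> U" by auto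
    then have z: "z = map_prod \<kappa> (\<lambda>x. x) (a, snd z)" by (cases z) simp
    have "inv_into (A \<times> U) (map_prod \<kappa> (\<lambda>x. x)) z = (a, snd z)"
      by (subst z, rule inv_into_f_f[OF i]) (use a in simp)
    then show "(f \<circ> inv_into (A \<times> U) (map_prod \<kappa> (\<lambda>x. x))) z = f (inv_into A \<kappa> (fst z), snd z)"
      using a is_chartD(3)[OF M.chart_in_atlas[OF A]] by simp
  qed
qed

section \<open>The pushforward\<close>

lemma tmap_tmap: "tmap f (tmap g w) = tmap (\<lambda>x. f (g x)) w"
  by (induction w) auto

lemma tmap_cong: "(\<And>x. x \<in> topspace T \<Longrightarrow> f x = g x) \<Longrightarrow> w \<in> topspace (ups S (pts T) i) \<Longrightarrow> tmap f w = tmap g w"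
proof (induction i arbitrary: w)
  case (Suc i)
  from Suc.prems(2) obtain x y t where "w = Tr x y t" "x \<in> topspace (ups S (pts T) i)" "y \<in> topspace (ups S (pts T) i)"
    by (auto elim: topspace_upE)
  with Suc.IH[of x] Suc.IH[of y] Suc.prems(1) show ?case by simp
qed auto

text \<open>The tower here has all points 0 but arbitrary scalars. The composite of f with the
  constant map 0 is the zero function, whose j-th quotient is 0 on the one hand and f^[j] at this
  tower on the other.\<close>

lemma iter_quotient_zero_tower:
  assumes E: "topological_vector_space S E" and F: "topological_vector_space S F" and U: "openin (topo E) U"
    and f: "Ck_nat S E U F j f" and 0: "0 \<in> U" "f 0 = 0"
    and w: "w \<in> tower_dom S E (topspace (topo E)) j"
  shows "iter_quotient S E U F f j (tmap (\<lambda>_. 0) w) = 0"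
proof -
  interpret E: topological_vector_space S E by fact
  interpret F: topological_vector_space S F by fact
  let ?V = "Pt ` topspace (topo E)" and ?q = "iter_quotient S E U F f"
  have aff: "affine_on S (vline E) (topo E) (vline E) (topo E) (\<lambda>_. 0) (\<lambda>_. 0)"
    by (auto simp: affine_on_def E.zero_mem vline_def E.scal_zero_right)
  have "dq_seq S (vline E) (pts (topo E)) ?V F j (\<lambda>i w. ?q i (tmap_aff (\<lambda>_. 0) (\<lambda>_. 0) w))"
    by (rule dq_seq_affine[OF aff _ _ Ck_nat_dq_seq[OF E F U f]]) (use 0 in auto)
  then have 1: "dq_seq S (vline E) (pts (topo E)) ?V F j (\<lambda>i w. ?q i (tmap (\<lambda>_. 0) w))"
    by (simp add: tmap_aff_same)
  have 2: "dq_seq S (vline E) (pts (topo E)) ?V F j (\<lambda>i w. 0)"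
    by (auto simp: dq_seq_def F.zero_mem vline_def F.scal_zero_right)
  from dq_seq_Ck_nat[OF E F openin_topspace _ 1, of "\<lambda>_. 0"]
  have "iter_quotient S E (topspace (topo E)) F (\<lambda>_. 0) j w = ?q j (tmap (\<lambda>_. 0) w)"
    using w 0 by simp
  moreover from dq_seq_Ck_nat[OF E F openin_topspace _ 2, of "\<lambda>_. 0"]
  have "iter_quotient S E (topspace (topo E)) F (\<lambda>_. 0) j w = 0"
    using w by simp
  ultimately show ?thesis by simp
qed

locale pushforward_setting = compact_support TF TK Z M K r
  for TF TK :: "'k::field topology" and Z :: "('k, 'z::ab_group_add) tvs" and M :: "('m, 'z) mfd"
    and K :: "'m set" and r :: enat +
  fixes E :: "('k, 'e::ab_group_add) tvs" and F :: "('k, 'f::ab_group_add) tvs"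
    and Zt :: "('k, 'zt::ab_group_add) tvs" and Mt :: "('mt, 'zt) mfd" and U :: "'e set" and k :: enat
    and ft :: "'mt \<times> 'e \<Rightarrow> 'f" and \<sigma> :: "'m \<Rightarrow> 'mt"
  assumes E: "topological_vector_space TK E" and F: "topological_vector_space TK F"
    and Zt: "topological_vector_space TK Zt"
    and U: "openin (topo E) U" and manifold_Mt: "manifold TK Zt (r + k) Mt"
    and ft: "Ck_mfd_to_tvs TK (prod_tvs Zt E) (prod_mfd TK (r + k) Zt Mt E (open_mfd TK (r + k) E U)) F (r + k) ft"
    and \<sigma>: "Ck_mfd_to_mfd TF Z M Zt Mt r \<sigma>"
    and zero: "K \<noteq> topspace (mtop M) \<Longrightarrow> 0 \<in> U \<and> (\<forall>x \<in> topspace (mtop M) - K. ft (\<sigma> x, 0) = 0)"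
begin

sublocale E: topological_vector_space TK E by (rule E)
sublocale F: topological_vector_space TK F by (rule F)
sublocale Zt: topological_vector_space TK Zt by (rule Zt)
sublocale Mt: manifold TK Zt "r + k" Mt by (rule manifold_Mt)

lemma EF: "topological_vector_space TF E" and FF: "topological_vector_space TF F" and ZtF: "topological_vector_space TF Zt"
  using tvs_restrict[OF ext] E F Zt by blast+

abbreviation P where "P \<equiv> prod_tvs Zt E"

lemma P: "topological_vector_space TK P" by (rule tvs_prod_tvs[OF Zt E])

abbreviation D where "D \<equiv> CrK_into TF Z M K E r U"

lemma openin_D: "openin (topo (C E)) D"
  using openin_CrK_into[OF EF U] zero by blast

lemma D_value: "\<gamma> \<in> D \<Longrightarrow> x \<in> topspace (mtop M) \<Longrightarrow> \<gamma> x \<in> U"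
  by (auto simp: CrK_into_def)

section \<open>Chart representatives of \<open>ft\<close> and the slices f(x, .)\<close>

definition g where "g A \<kappa> = (\<lambda>z. ft (inv_into A \<kappa> (fst z), snd z))"

lemma openin_chart_U: "(A, \<kappa>) \<in> atlas Mt \<Longrightarrow> openin (topo P) (\<kappa> ` A \<times> U)"
  using is_chartD(2)[OF Mt.chart_in_atlas] U by (simp add: openin_prod_Times_iff)

lemma Ck_nat_g: "(A, \<kappa>) \<in> atlas Mt \<Longrightarrow> enat n \<le> r + k \<Longrightarrow> Ck_nat TK P (\<kappa> ` A \<times> U) F n (g A \<kappa>)"
  using Ck_in_product_chart[OF manifold_Mt E U _ ft] by (simp add: Ck_def g_def)

text \<open>Freezing the first variable at z is affine but not linear; its linear part y \<mapsto>
  (0, y) fills the first component of every direction with 0.\<close>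

lemma affine_on_slice:
  assumes "z \<in> topspace (topo Zt)"
  shows "affine_on TK (vline E) (topo E) (vline P) (topo P) (Pair z) (Pair 0)"
  using assms Zt.zero_mem
  by (auto simp: affine_on_def vline_prod_tvs pline_def continuous_map_pairedI vline_def Zt.scal_zero_right)

text \<open>The left-hand side does not depend on a chart, whereas the right-hand side uses one
  function \<open>g\<close> for all x with \<sigma> x in the chart domain. This exhibits how the
  quotients of the slices vary with x.\<close>

lemma slice:
  assumes A: "(A, \<kappa>) \<in> atlas Mt" and x: "\<sigma> x \<in> A" and n: "enat n \<le> r + k"
  shows "Ck_nat TK E U F n (\<lambda>y. ft (\<sigma> x, y))"
    and "w \<in> tower_dom TK E U n \<Longrightarrow> iter_quotient TK E U F (\<lambda>y. ft (\<sigma> x, y)) n w =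
      iter_quotient TK P (\<kappa> ` A \<times> U) F (g A \<kappa>) n (tmap_aff (Pair (\<kappa> (\<sigma> x))) (Pair 0) w)"
proof -
  note ch = is_chartD[OF Mt.chart_in_atlas[OF A]]
  have z: "\<kappa> (\<sigma> x) \<in> topspace (topo Zt)" using openin_subset[OF ch(2)] x by blast
  have "dq_seq TK (vline E) (pts (topo E)) (Pt ` U) F n
     (\<lambda>i w. iter_quotient TK P (\<kappa> ` A \<times> U) F (g A \<kappa>) i (tmap_aff (Pair (\<kappa> (\<sigma> x))) (Pair 0) w))"
    by (rule dq_seq_affine[OF affine_on_slice[OF z] _ _ Ck_nat_dq_seq[OF P F openin_chart_U[OF A] Ck_nat_g[OF A n]]])
      (use x openin_subset[OF U] in auto)
  from dq_seq_Ck_nat[OF E F U _ this, of "\<lambda>y. ft (\<sigma> x, y)"]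
  have "Ck_nat TK E U F n (\<lambda>y. ft (\<sigma> x, y)) \<and> (\<forall>i\<le>n. \<forall>w\<in>tower_dom TK E U i.
     iter_quotient TK E U F (\<lambda>y. ft (\<sigma> x, y)) i w =
     iter_quotient TK P (\<kappa> ` A \<times> U) F (g A \<kappa>) i (tmap_aff (Pair (\<kappa> (\<sigma> x))) (Pair 0) w))"
    using x ch(3) by (simp add: g_def)
  then show "Ck_nat TK E U F n (\<lambda>y. ft (\<sigma> x, y))"
    and "w \<in> tower_dom TK E U n \<Longrightarrow> iter_quotient TK E U F (\<lambda>y. ft (\<sigma> x, y)) n w =
      iter_quotient TK P (\<kappa> ` A \<times> U) F (g A \<kappa>) n (tmap_aff (Pair (\<kappa> (\<sigma> x))) (Pair 0) w)" by blast+
qed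

lemma \<sigma>_chart:
  assumes "x \<in> topspace (mtop M)"
  obtains A \<kappa> where "(A, \<kappa>) \<in> atlas Mt" "\<sigma> x \<in> A"
proof -
  have "\<sigma> x \<in> topspace (mtop Mt)"
    using \<sigma> assms continuous_map_topspaceD by (auto simp: Ck_mfd_to_mfd_def)
  then show ?thesis using that Mt.obtain_chart by metis
qed

lemma slice_Ck_nat: "x \<in> topspace (mtop M) \<Longrightarrow> enat n \<le> r + k \<Longrightarrow> Ck_nat TK E U F n (\<lambda>y. ft (\<sigma> x, y))"
  using \<sigma>_chart slice(1) by metis

section \<open>Point evaluations and the candidate quotients of the pushforward\<close>

lemma affine_on_eval:
  assumes "x \<in> topspace (mtop M)"
  shows "affine_on TK (vline (C E)) (topo (C E)) (vline E) (topo E) (\<lambda>\<gamma>. \<gamma> x) (\<lambda>\<gamma>. \<gamma> x)"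
proof -
  have "continuous_map (topo (C E)) (prod_topology (topo (C E)) (mtop M)) (\<lambda>\<gamma>. (\<gamma>, x))"
    using assms by (simp add: continuous_map_pairedI)
  from continuous_map_comp[OF continuous_map_C_eval[OF EF] this]
  have "continuous_map (topo (C E)) (topo E) (\<lambda>\<gamma>. \<gamma> x)" by simp
  then show ?thesis by (simp add: affine_on_def vline_def CrK_def)
qed

lemma eval_tdom:
  assumes "x \<in> topspace (mtop M)" "T \<in> tower_dom TK (C E) D j"
  shows "tmap (\<lambda>\<gamma>. \<gamma> x) T \<in> tower_dom TK E U j"
proof -
  have "tmap_aff (\<lambda>\<gamma>. \<gamma> x) (\<lambda>\<gamma>. \<gamma> x) T \<in> tdom TK (vline E) (pts (topo E)) (Pt ` U) j"
    by (rule tmap_aff_tdom[OF affine_on_eval[OF assms(1)] openin_subset[OF openin_D] _ assms(2)[unfolded tower_dom_tdom]])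
      (use D_value assms(1) in auto)
  then show ?thesis by (simp add: tmap_aff_same tower_dom_tdom)
qed

text \<open>Formulated with slices, so no chart is involved and the quotient equation can be
  verified at each x separately. Charts are needed only for continuity.\<close>

definition H :: "nat \<Rightarrow> ('m \<Rightarrow> 'e, 'k) tower \<Rightarrow> 'm \<Rightarrow> 'f" where
  "H j T x = (if x \<in> topspace (mtop M)
     then iter_quotient TK E U F (\<lambda>y. ft (\<sigma> x, y)) j (tmap (\<lambda>\<gamma>. \<gamma> x) T) else 0)"

lemma sub_D: "Pt ` D \<subseteq> topspace (pts (topo (C E)))"
  using openin_subset[OF openin_D] by auto

lemma tower_dom_D: "T \<in> tower_dom TK (C E) D j \<Longrightarrow> T \<in> topspace (ups TK (pts (topo (C E))) j)"
  using tdom_subset[OF sub_D] by (auto simp: tower_dom_tdom)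

lemma H_quotient:
  assumes "enat (Suc j) \<le> k" "Tr T T' t \<in> tower_dom TK (C E) D (Suc j)"
  shows "vline (C F) (H j T) (H (Suc j) (Tr T T' t)) t = H j (tline (vline (C E)) T T' t)"
proof
  fix x
  have t: "t \<in> topspace TK" using assms(2) by simp
  show "vline (C F) (H j T) (H (Suc j) (Tr T T' t)) t x = H j (tline (vline (C E)) T T' t) x"
  proof (cases "x \<in> topspace (mtop M)")
    case True
    let ?ev = "tmap (\<lambda>\<gamma>. \<gamma> x)" and ?q = "iter_quotient TK E U F (\<lambda>y. ft (\<sigma> x, y))"
    have "enat (Suc j) \<le> r + k" using assms(1) by (simp add: add_increasing)
    from Ck_nat_dq_seq[OF E F U slice_Ck_nat[OF True this]] eval_tdom[OF True assms(2)]
    have "vline F (?q j (?ev T)) (?q (Suc j) (?ev (Tr T T' t))) t = ?q j (tline (vline E) (?ev T) (?ev T') t)"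
      unfolding dq_seq_def tower_dom_tdom by simp
    also have "tline (vline E) (?ev T) (?ev T') t = ?ev (tline (vline (C E)) T T' t)"
      by (rule tmap_tline[OF affine_on_eval[OF True]])
        (use tower_dom_D[OF assms(2)] in auto)
    finally show ?thesis using True by (simp add: H_def vline_def CrK_def del: iter_quotient.simps)
  next
    case False
    then show ?thesis using t by (simp add: H_def vline_def CrK_def F.scal_zero_right)
  qed
qed

text \<open>At a point x outside \<open>K\<close> all maps in the tower vanish, so evaluation yields
  a tower of zeros with unchanged scalars, and f(x, .) vanishes at 0.\<close>

lemma H_zero_off:
  assumes j: "enat j \<le> k" and T: "T \<in> tower_dom TK (C E) D j"
  shows "zero_off K (H j T)"
  unfolding zero_off_def
proof (intro allI impI)
  fix x assume x: "x \<notin> K"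
  show "H j T x = 0"
  proof (cases "x \<in> topspace (mtop M)")
    case True
    then have z: "0 \<in> U" "ft (\<sigma> x, 0) = 0" using zero x by auto
    have "tmap_aff (\<lambda>\<gamma>. \<gamma> x) (\<lambda>\<gamma>. \<gamma> x) T \<in> tdom TK (vline E) (pts (topo E)) (Pt ` topspace (topo E)) j"
      by (rule tmap_aff_tdom[OF affine_on_eval[OF True] openin_subset[OF openin_D] _ T[unfolded tower_dom_tdom]])
        (use D_value openin_subset[OF U] True in auto)
    then have w: "tmap (\<lambda>\<gamma>. \<gamma> x) T \<in> tower_dom TK E (topspace (topo E)) j"
      by (simp add: tmap_aff_same tower_dom_tdom)
    have "tmap (\<lambda>\<gamma>. \<gamma> x) T = tmap (\<lambda>_. 0) T"
      by (rule tmap_cong[OF _ tower_dom_D[OF T]]) (use x in \<open>auto simp: topspace_C zero_off_def\<close>)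
    then have "tmap (\<lambda>\<gamma>. \<gamma> x) T = tmap (\<lambda>_. 0) (tmap (\<lambda>\<gamma>. \<gamma> x) T)" by (simp add: tmap_tmap)
    moreover have "enat j \<le> r + k" using j by (simp add: add_increasing)
    ultimately show ?thesis
      using iter_quotient_zero_tower[OF E F U slice_Ck_nat[OF True] z w] True by (simp add: H_def)
  qed (simp add: H_def)
qed

text \<open>
  The directions are only taken in \<open>E\<close>, hence the recursion step also needs the statement for \<open>s = 0\<close>.
\<close>

lemma Cn_eval_tower:
  assumes A: "(A, \<kappa>) \<in> atlas M" and i: "enat i \<le> r" and V: "V \<subseteq> \<kappa> ` A"
    and s: "CV TF (vline Z) i (pts (topo Z)) (Pt ` V) Zt (\<lambda>w. s (pt w))"
  shows "Cn TF (pline cline (vline Z)) (vline P) i (pts (prod_topology (ups TK (pts (topo (C E))) j) (topo Z)))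
    (Pt ` (topspace (ups TK (pts (topo (C E))) j) \<times> V)) (ups TK (pts (topo P)) j)
    (\<lambda>w. tmap_aff (Pair (s (snd (pt w)))) (Pair 0) (tmap (\<lambda>\<gamma>. \<gamma> (inv_into A \<kappa> (snd (pt w)))) (fst (pt w))))"
  using s
proof (induction j arbitrary: s)
  case 0
  let ?A = "pts (topo (C E)) :: ('m \<Rightarrow> 'e, 'k) tower topology"
  let ?T = "pts (prod_topology ?A (topo Z))" and ?V = "Pt ` (topspace ?A \<times> V)"
  have VZ: "V \<subseteq> topspace (topo Z)"
    using V openin_subset[OF is_chartD(2)[OF M.chart_in_atlas[OF A]]] by blast
  have sub: "?V \<subseteq> topspace ?T" using VZ by auto
  have 1: "Cn TF (pline cline (vline Z)) (vline Z) i ?T ?V (pts (topo Z)) (\<lambda>w. Pt (snd (pt w)))"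
    by (rule Cn_linear[OF _ sub]) (auto simp: continuous_map_Pt continuous_map_comp[OF continuous_map_snd continuous_map_pt])
  note c1 = CL_comp[OF 1 0 _ sub, unfolded tower.sel]
  have s': "CV TF (pline cline (vline Z)) i ?T ?V Zt (\<lambda>w. s (snd (pt w)))" by (rule c1) auto
  have "plot E ?A pt" by (rule continuous_map_imp_plot[OF EF continuous_map_pt])
  then have "param_CV TF Z (\<kappa> ` A) E i ?A (\<lambda>a z. pt a (inv_into A \<kappa> z))"
    using A i by (simp add: plot_def)
  then have ev: "CV TF (pline cline (vline Z)) i ?T ?V E (\<lambda>w. pt (fst (pt w)) (inv_into A \<kappa> (snd (pt w))))"
    unfolding param_CV_def by (rule CL_subset) (use V in auto)
  have "Cn TF (pline cline (vline Z)) (vline P) i ?T ?V (pts (topo P))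
      (\<lambda>w. Pt (s (snd (pt w)), pt (fst (pt w)) (inv_into A \<kappa> (snd (pt w)))))"
    using CL_pair[OF s' ev sub] by (simp add: CL_def vline_prod_tvs)
  then show ?case unfolding ups.simps by (rule Cn_cong) auto
next
  case (Suc j)
  let ?X = "ups TK (pts (topo (C E))) j :: ('m \<Rightarrow> 'e, 'k) tower topology"
  let ?A = "up TK ?X"
  let ?T = "pts (prod_topology ?A (topo Z))" and ?V = "Pt ` (topspace ?A \<times> V)"
  let ?c = "\<lambda>s q w. tmap_aff (Pair (s (snd (pt w)))) (Pair 0) (tmap (\<lambda>\<gamma>. \<gamma> (inv_into A \<kappa> (snd (pt w)))) (q (fst (pt w))))"
  have VZ: "V \<subseteq> topspace (topo Z)"
    using V openin_subset[OF is_chartD(2)[OF M.chart_in_atlas[OF A]]] by blast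
  have sub: "?V \<subseteq> topspace ?T" using VZ by auto
  interpret ZtF: topological_vector_space TF Zt by (rule ZtF)
  interpret KF: topological_vector_space TF "kvs TK"
    using tvs_restrict[OF ext tvs_kvs[OF TK.topological_field_axioms]] .
  have step: "Cn TF (pline cline (vline Z)) (vline P) i ?T ?V (ups TK (pts (topo P)) j)
      (?c s q)"
    if s: "CV TF (vline Z) i (pts (topo Z)) (Pt ` V) Zt (\<lambda>w. s (pt w))" and q: "continuous_map ?A ?X q" for s q
  proof -
    note c = Cn_comp[OF Cn_reparametrise[OF q VZ] Suc.IH[OF s] _ sub, unfolded tower.sel fst_conv snd_conv]
    show ?thesis by (rule c) (use continuous_map_topspaceD[OF q] in auto)
  qed
  have zero: "CV TF (vline Z) i (pts (topo Z)) (Pt ` V) Zt (\<lambda>w. 0)"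
    by (rule CV_const[OF ZtF ZtF.zero_mem]) (use VZ in auto)
  \<comment> \<open>The scalar of the tower is part of the parameter, hence constant along
    lines.\<close>
  have "CV TF (pline cline (vline Z)) i ?T ?V (kvs TK) (\<lambda>w. par (fst (pt w)))"
  proof (rule CL_locally_const[OF _ sub])
    show "continuous_map (subtopology ?T ?V) (topo (kvs TK)) (\<lambda>w. par (fst (pt w)))"
      using continuous_map_comp[OF continuous_map_par continuous_map_comp[OF continuous_map_fst continuous_map_pt]]
      by (auto intro: continuous_map_from_subtopology)
    show "0 \<in> topspace (topo (kvs TK))" by (rule KF.zero_mem)
  qed (auto simp: pline_def cline_def sline_def)
  then have par: "Cn TF (pline cline (vline Z)) sline i ?T ?V (pts TK) (\<lambda>w. Pt (par (fst (pt w))))"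
    by (simp add: CL_def)
  have "Cn TF (pline cline (vline Z)) (vline P) i ?T ?V (up TK (ups TK (pts (topo P)) j))
      (\<lambda>w. Tr (?c s base w) (?c (\<lambda>_. 0) dir w) (par (fst (pt w))))"
    by (intro Cn_Tr step[OF Suc.prems continuous_map_base] step[OF zero continuous_map_dir] par sub)
  then show ?case
    unfolding ups.simps by (rule Cn_cong) (auto simp: topspace_up tmap_aff_same)
qed

lemma H_continuous:
  assumes j: "enat j \<le> k"
  shows "continuous_map (tower_dom_topology TK (C E) D j) (topo (C F)) (H j)"
proof (rule plot_imp_continuous_map[OF FF])
  let ?A = "tower_dom_topology TK (C E) D j"
  have tA: "topspace ?A = tower_dom TK (C E) D j"
    using tower_dom_D by (auto simp: tower_topology_ups)
  show "zero_off K (H j T)" if "T \<in> topspace ?A" for T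
    using H_zero_off[OF j] that tA by blast
  show "plot F ?A (H j)"
    unfolding plot_def
  proof (intro allI impI)
    fix B \<phi> i assume B: "(B, \<phi>) \<in> atlas M" and i: "enat i \<le> r"
    note chB = is_chartD[OF M.chart_in_atlas[OF B]]
    let ?x = "\<lambda>z. inv_into B \<phi> z"
    have VZ: "\<phi> ` B \<subseteq> topspace (topo Z)" by (rule openin_subset[OF chB(2)])
    show "param_CV TF Z (\<phi> ` B) F i ?A (\<lambda>T z. H j T (?x z))"
      unfolding param_CV_def
    proof (rule CV_local[OF M.topological_field_axioms FF M.good_param])
      fix w :: "(('m \<Rightarrow> 'e, 'k) tower \<times> 'z, 'k) tower"
      assume "w \<in> Pt ` (topspace ?A \<times> \<phi> ` B)"
      then obtain T b where w: "w = Pt (T, \<phi> b)" "T \<in> topspace ?A" "b \<in> B" by auto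
      \<comment> \<open>\<sigma> need not map all of \<open>B\<close> into one chart of
        \<open>Mt\<close>. By \<open>CV_local\<close> it suffices to treat the part of
        \<open>B\<close> that is mapped into a chart around \<sigma> b.\<close>
      obtain A \<kappa> where A: "(A, \<kappa>) \<in> atlas Mt" "\<sigma> b \<in> A"
        using \<sigma>_chart chB(4) w(3) by blast
      note chA = is_chartD[OF Mt.chart_in_atlas[OF A(1)]]
      let ?B = "B \<inter> \<sigma> -` A"
      let ?V = "\<phi> ` ?B"
      let ?W = "Pt ` (topspace ?A \<times> ?V) :: (('m \<Rightarrow> 'e, 'k) tower \<times> 'z, 'k) tower set"
      have "openin (mtop M) ?B"
      proof -
        have "continuous_map (mtop M) (mtop Mt) \<sigma>" using \<sigma> by (simp add: Ck_mfd_to_mfd_def)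
        from openin_Int[OF chB(1) openin_continuous_map_preimage_in[OF this chA(1)]]
        have "openin (mtop M) (B \<inter> {x \<in> topspace (mtop M). \<sigma> x \<in> A})" .
        moreover have "B \<inter> {x \<in> topspace (mtop M). \<sigma> x \<in> A} = ?B" using chB(4) by auto
        ultimately show ?thesis by simp
      qed
      then have V: "openin (topo Z) ?V" by (rule chart_image_open[OF M.chart_in_atlas[OF B]]) blast
      have W: "openin (pts (prod_topology ?A (topo Z))) ?W"
        unfolding openin_pts_image using V openin_topspace[of ?A] openin_prod_Times_iff by blast
      have "Ck TF Z ?V Zt r (\<kappa> \<circ> \<sigma> \<circ> ?x)"
        using \<sigma> B A(1) by (fastforce simp: Ck_mfd_to_mfd_def)
      then have s: "CV TF (vline Z) i (pts (topo Z)) (Pt ` ?V) Zt (\<lambda>w. \<kappa> (\<sigma> (?x (pt w))))"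
        using i Ck_nat_iff_CV[OF Z ZtF V, of i "\<kappa> \<circ> \<sigma> \<circ> ?x"] by (simp add: Ck_def)
      let ?c = "\<lambda>w. tmap_aff (Pair (\<kappa> (\<sigma> (?x (snd (pt w)))))) (Pair 0) (tmap (\<lambda>\<gamma>. \<gamma> (?x (snd (pt w)))) (fst (pt w)))"
      let ?X = "ups TK (pts (topo (C E))) j"
      have Wsub: "?W \<subseteq> topspace (pts (prod_topology ?A (topo Z)))" by (rule openin_subset[OF W])
      have c0: "Cn TF (pline cline (vline Z)) (vline P) i (pts (prod_topology ?X (topo Z))) (Pt ` (topspace ?X \<times> ?V)) (ups TK (pts (topo P)) j) ?c"
        by (rule Cn_eval_tower[OF B i _ s]) auto
      have inc: "continuous_map ?A ?X (\<lambda>T. T)"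
        by (simp add: tower_topology_ups continuous_map_from_subtopology)
      note c1 = Cn_comp[OF Cn_reparametrise[OF inc openin_subset[OF V]] c0 _ Wsub, unfolded tower.sel fst_conv snd_conv]
      have c: "Cn TF (pline cline (vline Z)) (vline P) i (pts (prod_topology ?A (topo Z))) ?W (ups TK (pts (topo P)) j) ?c"
        by (rule c1) (use tA tower_dom_D in auto)
      let ?O = "\<kappa> ` A \<times> U"
      let ?q = "iter_quotient TK P ?O F (g A \<kappa>) j"
      have O: "Pt ` ?O \<subseteq> topspace (pts (topo P))" using openin_subset[OF openin_chart_U[OF A(1)]] by auto
      \<comment> \<open>The count of orders: j quotients in \<gamma> and i further ones in z, all
        taken from \<open>g\<close>.\<close>
      have n: "enat (j + i) \<le> r + k"
        using add_mono[OF i j] by (simp add: add.commute)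
      have "CV TK (vline P) i (ups TK (pts (topo P)) j) (tdom TK (vline P) (pts (topo P)) (Pt ` ?O) j) F ?q"
        by (rule dq_seq_CV[OF Ck_nat_dq_seq[OF P F openin_chart_U[OF A(1)] Ck_nat_g[OF A(1) n]] O order_refl])
      \<comment> \<open>Scalars are restricted only after the j quotients over \<open>TK\<close>
        have been formed; the remaining i orders are over \<open>TF\<close>, where \<sigma> and the
        evaluated maps are differentiable.\<close>
      then have q: "CV TF (vline P) i (ups TK (pts (topo P)) j) (tdom TK (vline P) (pts (topo P)) (Pt ` ?O) j) F ?q"
        unfolding CL_def by (rule Cn_restrict_scalars[OF ext _ tdom_subset[OF O]])
      have mem: "?c v \<in> tdom TK (vline P) (pts (topo P)) (Pt ` ?O) j \<and> ?q (?c v) = H j (fst (pt v)) (?x (snd (pt v)))"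
        if "v \<in> ?W" for v
      proof -
        from that obtain S y where v: "v = Pt (S, \<phi> y)" "S \<in> tower_dom TK (C E) D j" "y \<in> B" "\<sigma> y \<in> A"
          using tA by auto
        have y: "?x (\<phi> y) = y" "y \<in> topspace (mtop M)" using v chB(3,4) by auto
        have z: "\<kappa> (\<sigma> y) \<in> topspace (topo Zt)" using openin_subset[OF chA(2)] v by blast
        have e: "tmap (\<lambda>\<gamma>. \<gamma> y) S \<in> tower_dom TK E U j" by (rule eval_tdom[OF y(2) v(2)])
        have "tmap_aff (Pair (\<kappa> (\<sigma> y))) (Pair 0) (tmap (\<lambda>\<gamma>. \<gamma> y) S) \<in> tdom TK (vline P) (pts (topo P)) (Pt ` ?O) j"
          by (rule tmap_aff_tdom[OF affine_on_slice[OF z] openin_subset[OF U] _ e[unfolded tower_dom_tdom]])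
            (use v in auto)
        moreover have "enat j \<le> r + k" using j by (simp add: add_increasing)
        ultimately show ?thesis
          using slice(2)[OF A(1) v(4) _ e] y by (simp add: v(1) H_def)
      qed
      have "CV TF (pline cline (vline Z)) i (pts (prod_topology ?A (topo Z))) ?W F (\<lambda>w. ?q (?c w))"
        by (rule CL_comp[OF c q _ Wsub]) (use mem in blast)
      then have "CV TF (pline cline (vline Z)) i (pts (prod_topology ?A (topo Z))) ?W F (\<lambda>w. H j (fst (pt w)) (?x (snd (pt w))))"
        by (rule CL_cong) (use mem in blast)
      then show "\<exists>W. openin (pts (prod_topology ?A (topo Z))) W \<and> w \<in> W \<and> W \<subseteq> Pt ` (topspace ?A \<times> \<phi> ` B) \<and>
          CV TF (pline cline (vline Z)) i (pts (prod_topology ?A (topo Z))) W F (\<lambda>w. H j (fst (pt w)) (?x (snd (pt w))))"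
        using W w A(2) by (intro exI[of _ ?W]) auto
    qed
  qed
qed

lemma Ck_pushforward: "Ck TK (C E) D (C F) k (pushforward (topspace (mtop M)) (ft \<circ> map_prod \<sigma> id))"
  unfolding Ck_def
proof (intro allI impI)
  fix n assume n: "enat n \<le> k"
  have le: "enat i \<le> k" if "i \<le> n" for i using n that by (meson enat_ord_simps(1) order_trans)
  have "dq_seq TK (vline (C E)) (pts (topo (C E))) (Pt ` D) (C F) n H"
    unfolding dq_seq_def
  proof (intro conjI allI impI)
    show "continuous_map (subtopology (ups TK (pts (topo (C E))) i) (tdom TK (vline (C E)) (pts (topo (C E))) (Pt ` D) i)) (topo (C F)) (H i)"
      if "i \<le> n" for i
      using H_continuous[OF le[OF that]] by (simp add: tower_topology_ups tower_dom_tdom)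
    show "vline (C F) (H i x) (H (Suc i) (Tr x y t)) t = H i (tline (vline (C E)) x y t)"
      if "i < n" "Tr x y t \<in> tdom TK (vline (C E)) (pts (topo (C E))) (Pt ` D) (Suc i)" for i x y t
      by (rule H_quotient) (use that le[of "Suc i"] in \<open>auto simp: tower_dom_tdom\<close>)
  qed
  moreover have "H 0 (Pt \<gamma>) = pushforward (topspace (mtop M)) (ft \<circ> map_prod \<sigma> id) \<gamma>" if "\<gamma> \<in> D" for \<gamma>
    using D_value[OF that] by (auto simp: H_def pushforward_def fun_eq_iff)
  ultimately show "Ck_nat TK (C E) D (C F) n (pushforward (topspace (mtop M)) (ft \<circ> map_prod \<sigma> id))"
    using dq_seq_Ck_nat[OF tvs_C[OF E] tvs_C[OF F] openin_D, of H] by blast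
qed

end

theorem proposition4p20:
  fixes TF TK :: "'k::field topology"
    and E :: "('k, 'e::ab_group_add) tvs"
    and F :: "('k, 'f::ab_group_add) tvs"
    and Zt :: "('k, 'zt::ab_group_add) tvs"
    and Mt :: "('mt, 'zt) mfd"
    and Z :: "('k, 'z::ab_group_add) tvs"
    and M :: "('m, 'z) mfd"
    and U :: "'e set" and K :: "'m set"
    and r k :: enat
    and ft :: "'mt \<times> 'e \<Rightarrow> 'f"
    and \<sigma> :: "'m \<Rightarrow> 'mt"
    and f :: "'m \<times> 'e \<Rightarrow> 'f"
  assumes "topological_field TF" and "locally_compact_space TF"
    and "topological_field TK" and "extends TK TF"
    and "topological_vector_space TK E"
    and "topological_vector_space TK F"
    and "topological_vector_space TK Zt"
    and "openin (topo E) U"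
    and "manifold TK Zt (r + k) Mt"
    and "Ck_mfd_to_tvs TK (prod_tvs Zt E)
           (prod_mfd TK (r + k) Zt Mt E (open_mfd TK (r + k) E U)) F (r + k) ft"
    and "finite_dimensional_tvs TF Z" and "manifold TF Z r M"
    and "compactin (mtop M) K"
    and "Ck_mfd_to_mfd TF Z M Zt Mt r \<sigma>"
    and "f = ft \<circ> map_prod \<sigma> id"
    and "K \<noteq> topspace (mtop M) \<Longrightarrow> 0 \<in> U \<and> (\<forall>x \<in> topspace (mtop M) - K. f (x, 0) = 0)"
  shows "openin (topo (CrK TF Z M K E r)) (CrK_into TF Z M K E r U) \<and>
         Ck TK (CrK TF Z M K E r) (CrK_into TF Z M K E r U) (CrK TF Z M K F r) k
            (pushforward (topspace (mtop M)) f)"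
proof -
  interpret pushforward_setting TF TK Z M K r E F Zt Mt U k ft \<sigma>
    by (intro pushforward_setting.intro compact_support.intro pushforward_setting_axioms.intro)
      (use assms in auto)
  show ?thesis using openin_D Ck_pushforward assms(15) by simp
qed

end
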